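(* Let $d\ge 3$ be an integer, let $V$ be a $d$-dimensional $\mathbb{C}$-vector space, and let $H(r)$ be the Hilbert function of the graded ring $$\frac{\mathrm{Sym}^{\bullet}(\mathbb{S}_{(3,1,1,\cdots,1,0)}V)}{\langle\mathbb{S}_{(4,3,2,\cdots,2,1)}V\rangle}.$$ For each $r$ write $$\mathrm{Sym}^{r}(\mathbb{S}_{(3,1,1,\cdots,1,0)}V)\cong\bigoplus_{|\lambda|=r(d+1)} (\mathbb{S}_\lambda V)^{\oplus m_\lambda},$$ where $m_\lambda\in \mathbb{Z}_{\geq 0}$ and $\lambda=(\lambda_1,\lambda_2,\dots,\lambda_d)$ runs over partitions of $r(d+1)$, i.e. $\sum_{i=1}^d\lambda_i=r(d+1)$ and $\lambda_1\geq\lambda_2\geq\cdots\geq\lambda_d$ (with $\lambda_d\ge 0$). Then $$H(r)\geq\sum_{\substack{|\lambda|=r(d+1) \\ \lambda_{d-k}+\cdots+\lambda_d\leq rk}} m_\lambda\, \dim_{\mathbb{C}} \mathbb{S}_\lambda V$$ for any $r\geq 2$ and any $k=0,\dots,d-1$.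
   Context: The base field is $\mathbb{C}$. For a partition $\lambda$, $\mathbb{S}_\lambda V$ is the Schur module (Schur functor applied to $V$). All partitions are written with exactly $d$ parts: $(3,1,1,\cdots,1,0)=(3,1^{d-2},0)$, a partition of $d+1$, and $(4,3,2,\cdots,2,1)=(4,3,2^{d-3},1)$, a partition of $2d+2$. There is an injective homomorphism of Schur modules (i.e. of $GL(V)$-representations) $j:\mathbb{S}_{(4,3,2,\cdots,2,1)}V \hookrightarrow \mathrm{Sym}^{2}(\mathbb{S}_{(3,1,1,\cdots,1,0)}V)$; the multiplicity of $\mathbb{S}_{(4,3,2,\cdots,2,1)}V$ in this $\mathrm{Sym}^2$ is one, so the image of $j$ is well defined. The displayed quotient ring is the quotient of the symmetric algebra by the ideal generated by the image of $j$ (in degree $2$), graded so that $\mathbb{S}_{(3,1,\cdots,1,0)}V$ has degree $1$; its Hilbert function $H(r)$ is the $\mathbb{C}$-dimension of its degree $r$ component. *)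

theory Defs
  imports
    Complex_Main
    "HOL-Library.Function_Algebras"
    "HOL-Combinatorics.Permutations"
    "HOL-Algebra.QuotRing"
    "HOL-Algebra.Embedded_Algebras"
begin

text \<open>
  All vector spaces built from \<open>V\<close> are realised as subspaces of spaces of complex-valued
  functions, with the pointwise operations of \<^theory>\<open>HOL-Library.Function_Algebras\<close>.
\<close>

definition fscale :: "complex \<Rightarrow> ('x \<Rightarrow> complex) \<Rightarrow> 'x \<Rightarrow> complex" where
  "fscale c f = (\<lambda>x. c * f x)"

interpretation fun_space: vector_space fscale
  by unfold_locales (auto simp: fscale_def fun_eq_iff algebra_simps)

definition dual :: "(complex \<Rightarrow> 'w \<Rightarrow> 'w) \<Rightarrow> ('w::ab_group_add \<Rightarrow> complex) set" where
  "dual scale = {\<phi>. Vector_Spaces.linear scale (*) \<phi>}"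

definition GL :: "(complex \<Rightarrow> 'v \<Rightarrow> 'v) \<Rightarrow> ('v::ab_group_add \<Rightarrow> 'v) set" where
  "GL scale = {g. Vector_Spaces.linear scale scale g \<and> bij g}"


section \<open>Representations\<close>

text \<open>
  A representation is given by a subspace and an action; \<open>G\<close> is the set of group elements.
\<close>

definition rep_hom ::
  "'g set \<Rightarrow> ('x \<Rightarrow> complex) set \<Rightarrow> ('g \<Rightarrow> ('x \<Rightarrow> complex) \<Rightarrow> 'x \<Rightarrow> complex)
    \<Rightarrow> ('y \<Rightarrow> complex) set \<Rightarrow> ('g \<Rightarrow> ('y \<Rightarrow> complex) \<Rightarrow> 'y \<Rightarrow> complex)
    \<Rightarrow> (('x \<Rightarrow> complex) \<Rightarrow> 'y \<Rightarrow> complex) \<Rightarrow> bool" where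
  "rep_hom G U actU W actW f \<longleftrightarrow>
     f ` U \<subseteq> W \<and>
     (\<forall>x\<in>U. \<forall>y\<in>U. f (x + y) = f x + f y) \<and>
     (\<forall>c. \<forall>x\<in>U. f (fscale c x) = fscale c (f x)) \<and>
     (\<forall>g\<in>G. \<forall>x\<in>U. f (actU g x) = actW g (f x))"

definition rep_isomorphic ::
  "'g set \<Rightarrow> ('x \<Rightarrow> complex) set \<Rightarrow> ('g \<Rightarrow> ('x \<Rightarrow> complex) \<Rightarrow> 'x \<Rightarrow> complex)
    \<Rightarrow> ('y \<Rightarrow> complex) set \<Rightarrow> ('g \<Rightarrow> ('y \<Rightarrow> complex) \<Rightarrow> 'y \<Rightarrow> complex) \<Rightarrow> bool" where
  "rep_isomorphic G U actU W actW \<longleftrightarrow>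
     (\<exists>f. rep_hom G U actU W actW f \<and> bij_betw f U W)"

text \<open>
  External direct sum of a family indexed by a finite set \<open>I\<close>: the component at \<open>i\<close> of \<open>F\<close>
  is \<open>\<lambda>x. F (i, x)\<close>.
\<close>

definition direct_sum :: "'i set \<Rightarrow> ('i \<Rightarrow> ('x \<Rightarrow> complex) set) \<Rightarrow> ('i \<times> 'x \<Rightarrow> complex) set" where
  "direct_sum I W =
     {F. (\<forall>i\<in>I. (\<lambda>x. F (i, x)) \<in> W i) \<and> (\<forall>i. i \<notin> I \<longrightarrow> (\<forall>x. F (i, x) = 0))}"

definition direct_sum_act ::
  "('g \<Rightarrow> ('x \<Rightarrow> complex) \<Rightarrow> 'x \<Rightarrow> complex) \<Rightarrow> 'g \<Rightarrow> ('i \<times> 'x \<Rightarrow> complex) \<Rightarrow> 'i \<times> 'x \<Rightarrow> complex" where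
  "direct_sum_act act g F = (\<lambda>(i, x). act g (\<lambda>y. F (i, y)) x)"


section \<open>Tensor powers and Schur modules\<close>

text \<open>
  The tensor power of a finite-dimensional \<open>V\<close> is realised inside the multilinear forms on
  lists of linear functionals: \<open>v\<^sub>1 \<otimes> \<dots> \<otimes> v\<^sub>n\<close> is the form
  \<open>(\<phi>\<^sub>1, \<dots>, \<phi>\<^sub>n) \<mapsto> \<phi>\<^sub>1(v\<^sub>1) \<cdots> \<phi>\<^sub>n(v\<^sub>n)\<close>, extended by 0 to all other lists.
\<close>

type_synonym 'v tensor = "('v \<Rightarrow> complex) list \<Rightarrow> complex"

definition pure_tensor :: "(complex \<Rightarrow> 'v \<Rightarrow> 'v) \<Rightarrow> 'v::ab_group_add list \<Rightarrow> 'v tensor" where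
  "pure_tensor scale vs = (\<lambda>\<phi>s.
     if length \<phi>s = length vs \<and> set \<phi>s \<subseteq> dual scale
     then (\<Prod>i<length vs. (\<phi>s ! i) (vs ! i)) else 0)"

definition tensor_power :: "(complex \<Rightarrow> 'v \<Rightarrow> 'v) \<Rightarrow> nat \<Rightarrow> 'v::ab_group_add tensor set" where
  "tensor_power scale n = fun_space.span (pure_tensor scale ` {vs. length vs = n})"

text \<open>The diagonal action: \<open>g (v\<^sub>1 \<otimes> \<dots> \<otimes> v\<^sub>n) = g v\<^sub>1 \<otimes> \<dots> \<otimes> g v\<^sub>n\<close> for \<open>g\<close> in \<open>GL(V)\<close>.\<close>

definition tensor_act :: "('v \<Rightarrow> 'v) \<Rightarrow> 'v tensor \<Rightarrow> 'v tensor" where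
  "tensor_act g t = (\<lambda>\<phi>s. t (map (\<lambda>\<phi>. \<phi> \<circ> g) \<phi>s))"

text \<open>
  The right action of the symmetric group:
  \<open>(v\<^sub>1 \<otimes> \<dots> \<otimes> v\<^sub>n) \<sigma> = v\<^bsub>\<sigma>(1)\<^esub> \<otimes> \<dots> \<otimes> v\<^bsub>\<sigma>(n)\<^esub>\<close>. The inverse appears because
  \<open>\<sigma>\<close> is moved from the vectors to the functionals.
\<close>

definition tensor_perm :: "(nat \<Rightarrow> nat) \<Rightarrow> 'v tensor \<Rightarrow> 'v tensor" where
  "tensor_perm \<sigma> t = (\<lambda>\<phi>s. t (permute_list (Hilbert_Choice.inv \<sigma>) \<phi>s))"

definition partitions :: "nat \<Rightarrow> nat \<Rightarrow> nat list set" where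
  "partitions d n = {\<nu>. length \<nu> = d \<and> sorted_wrt (\<ge>) \<nu> \<and> sum_list \<nu> = n}"

text \<open>
  The boxes (row, column) of the Young diagram in reading order; box number \<open>p\<close> carries the
  entry \<open>p\<close> of the canonical tableau.
\<close>

definition boxes :: "nat list \<Rightarrow> (nat \<times> nat) list" where
  "boxes \<nu> = concat (map (\<lambda>i. map (\<lambda>c. (i, c)) [0..<\<nu> ! i]) [0..<length \<nu>])"

definition row_group :: "nat list \<Rightarrow> (nat \<Rightarrow> nat) set" where
  "row_group \<nu> = {\<sigma>. \<sigma> permutes {..<sum_list \<nu>} \<and>
     (\<forall>p<sum_list \<nu>. fst (boxes \<nu> ! \<sigma> p) = fst (boxes \<nu> ! p))}"

definition column_group :: "nat list \<Rightarrow> (nat \<Rightarrow> nat) set" where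
  "column_group \<nu> = {\<sigma>. \<sigma> permutes {..<sum_list \<nu>} \<and>
     (\<forall>p<sum_list \<nu>. snd (boxes \<nu> ! \<sigma> p) = snd (boxes \<nu> ! p))}"

text \<open>
  Right multiplication by the Young symmetrizer
  \<open>c\<^sub>\<nu> = (\<Sum>\<sigma>. \<sigma>) (\<Sum>\<tau>. sign \<tau> \<tau>)\<close>, with \<open>\<sigma>\<close> ranging over the row group and \<open>\<tau>\<close> over the
  column group.
\<close>

definition young_symmetrizer :: "nat list \<Rightarrow> 'v tensor \<Rightarrow> 'v tensor" where
  "young_symmetrizer \<nu> t =
     (\<Sum>\<sigma>\<in>row_group \<nu>. \<Sum>\<tau>\<in>column_group \<nu>.
        fscale (of_int (sign \<tau>)) (tensor_perm (\<sigma> \<circ> \<tau>) t))"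

definition schur_module :: "(complex \<Rightarrow> 'v \<Rightarrow> 'v) \<Rightarrow> nat list \<Rightarrow> 'v::ab_group_add tensor set" where
  "schur_module scale \<nu> = young_symmetrizer \<nu> ` tensor_power scale (sum_list \<nu>)"


section \<open>The symmetric algebra and quotients by ideals\<close>

text \<open>
  The symmetric algebra of a subspace \<open>W\<close> is realised as the algebra of polynomial functions on
  linear functionals, \<open>w\<close> in \<open>W\<close> being identified with \<open>\<psi> \<mapsto> \<psi> w\<close>. The functionals are taken
  on the whole ambient function space; restricting them to \<open>W\<close> is onto the dual of \<open>W\<close>, so this
  is the usual algebra of polynomial functions on the dual of \<open>W\<close>. As \<open>\<complex>\<close> is infinite, no
  relations are lost. Arguments outside the dual are treated like the zero functional.
\<close>

type_synonym 'x sym = "(('x \<Rightarrow> complex) \<Rightarrow> complex) \<Rightarrow> complex"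

definition sym_gen :: "('x \<Rightarrow> complex) \<Rightarrow> 'x sym" where
  "sym_gen w = (\<lambda>\<psi>. if \<psi> \<in> dual fscale then \<psi> w else 0)"

definition sym_power :: "('x \<Rightarrow> complex) set \<Rightarrow> nat \<Rightarrow> 'x sym set" where
  "sym_power W r =
     fun_space.span {prod_list (map sym_gen ws) | ws. length ws = r \<and> set ws \<subseteq> W}"

definition sym_algebra :: "('x \<Rightarrow> complex) set \<Rightarrow> 'x sym ring" where
  "sym_algebra W =
     \<lparr>carrier = fun_space.span (\<Union>r. sym_power W r),
      mult = (*), one = 1, zero = 0, add = (+)\<rparr>"

text \<open>
  The action on the symmetric algebra induced by an action on \<open>W\<close>; it sends
  \<^term>\<open>sym_gen w\<close> to \<^term>\<open>sym_gen (act g w)\<close> when \<^term>\<open>act g\<close> is linear and bijective.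
\<close>

definition sym_act ::
  "('g \<Rightarrow> ('x \<Rightarrow> complex) \<Rightarrow> 'x \<Rightarrow> complex) \<Rightarrow> 'g \<Rightarrow> 'x sym \<Rightarrow> 'x sym" where
  "sym_act act g F = (\<lambda>\<psi>. F (\<psi> \<circ> act g))"

text \<open>
  Hilbert function of \<open>Sym(W) / \<langle>J\<rangle>\<close> for a set \<open>J\<close> of homogeneous elements: the degree \<open>r\<close>
  component of the quotient ring is the image of the \<open>r\<close>-th symmetric power, and the base field
  is the image of the constants.
\<close>

definition hilbert_function :: "('x \<Rightarrow> complex) set \<Rightarrow> 'x sym set \<Rightarrow> nat \<Rightarrow> nat" where
  "hilbert_function W J r =
     (let R = sym_algebra W;
          I = genideal R J;
          proj = (\<lambda>F. I +>\<^bsub>R\<^esub> F)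
      in ring.dim (R Quot I) (proj ` range (\<lambda>c. fscale c 1)) (proj ` sym_power W r))"

end

theory Submission
  imports Defs "HOL-Computational_Algebra.Polynomial"
begin

text \<open>
  The bound is a weight count. Fix a basis of \<open>V\<close> and let \<open>D(t)\<close> be the diagonal matrix whose
  first \<open>l = d - k - 1\<close> entries are \<open>1\<close> and whose last \<open>k + 1\<close> entries are \<open>t\<close>; a vector has
  weight \<open>a\<close> if \<open>D(t)\<close> multiplies it by \<open>t ^ a\<close>. A Schur module is spanned by the images of the
  basis tensors under the Young symmetrizer, and these are weight vectors. Such an image vanishes
  unless, after a permutation within the rows, all columns have distinct entries. A column
  of length \<open>c\<close> then contains at least \<open>c - l\<close> of the \<open>k + 1\<close> scaled indices, so every weight of
  \<open>W\<close> is at least \<open>k\<close>, while the first two columns of the diagram of \<open>U\<close> already force weights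
  of at least \<open>2 * k + 1\<close> (\<open>young_word_weight\<close>). Consequently all weights in degree \<open>r\<close> of the
  ideal generated by \<open>j ` U\<close> exceed \<open>r * k\<close>, and since \<open>j ` U\<close> is stable under \<open>GL(V)\<close> the same
  holds for all translates of elements of the ideal.

  On the other hand, every nonzero \<open>x\<close> in the Schur module of \<open>\<nu>\<close> has a \<open>GL(V)\<close>-translate
  with a nonzero coordinate at the tableau whose row \<open>i\<close> is filled with \<open>i\<close>
  (\<open>schur_highest_coordinate\<close>), and this coordinate has weight
  \<open>\<nu>\<^sub>d\<^sub>-\<^sub>k + \<dots> + \<nu>\<^sub>d\<close>. If this number is at most \<open>r * k\<close>, then the ideal therefore has
  zero projection to every copy of that Schur module in the \<open>r\<close>-th symmetric power
  (\<open>vanishing_component\<close>). So the sum of all these copies embeds into the quotient ring, and its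
  dimension is the right-hand side; \<open>hilbert_function_eq\<close> and \<open>dim_add_card_image_le\<close> do the
  bookkeeping.

  Two devices keep the argument elementary. Weights of elements of the ideal are read off along
  curves: at the functional \<open>t\<^sup>-\<^sup>k \<psi> \<circ> D(t) \<circ> g\<close> all elements of the symmetric algebra
  of \<open>W\<close> are polynomial in \<open>t\<close>, those of \<open>j ` U\<close> vanish at \<open>t = 0\<close>, and vanishing at
  \<open>t = 0\<close> defines an ideal (\<open>vanishing_ideal\<close>). The nonzero coordinate comes from polarization
  together with a Hermitian form for which row symmetrization and column antisymmetrization are
  self-adjoint (\<open>schur_module_detected_by_row_constant\<close>).
\<close>

section \<open>Spaces of complex functions\<close>

lemma sum_fun_apply: "(\<Sum>a\<in>A. f a) x = (\<Sum>a\<in>A. f a x)"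
  by (induction A rule: infinite_finite_induct) auto

lemma additive_sum:
  assumes "L 0 = 0" "\<And>x y. L (x + y) = L x + L y"
  shows "L (\<Sum>a\<in>A. f a) = (\<Sum>a\<in>A. L (f a))"
  using sum_comp_morphism[of L f A] assms by (simp add: comp_def)

lemma fscale_apply: "fscale c f x = c * f x"
  by (simp add: fscale_def)

lemmas pointwise = fscale_apply sum_fun_apply plus_fun_apply zero_fun_apply times_fun_apply one_fun_apply

text \<open>
  Tensors and polynomial functions are handled as vectors, although they are functions. Pointwise
  evaluation is unfolded only on demand, so that sums and multiples stay visible to the simplifier.
\<close>

declare plus_fun_apply [simp del] zero_fun_apply [simp del] times_fun_apply [simp del] one_fun_apply [simp del]

lemma fscale_simps [simp]: "fscale c 0 = 0" "fscale 0 f = 0" "fscale 1 f = f"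
  by (auto simp: fun_eq_iff pointwise)

lemma fspan_induct [consumes 1, case_names gen zero add scale]:
  assumes "x \<in> fun_space.span S" "\<And>x. x \<in> S \<Longrightarrow> P x" "P 0"
    "\<And>x y. P x \<Longrightarrow> P y \<Longrightarrow> P (x + y)" "\<And>c x. P x \<Longrightarrow> P (fscale c x)"
  shows "P x"
proof (rule fun_space.span_induct[OF assms(1)])
  show "fun_space.subspace {x. P x}"
    using assms(3-5) by (auto simp: fun_space.subspace_def)
qed (fact assms(2))

section \<open>Words and symmetrizers\<close>

text \<open>
  The index set of the standard basis of the \<open>n\<close>-th tensor power of a \<open>d\<close>-dimensional space.
\<close>

definition words :: "nat \<Rightarrow> nat \<Rightarrow> nat list set" where
  "words d n = {xs. length xs = n \<and> set xs \<subseteq> {..<d}}"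

lemma finite_words: "finite (words d n)"
proof -
  have "words d n = {xs. set xs \<subseteq> {..<d} \<and> length xs = n}"
    by (auto simp: words_def)
  then show ?thesis
    using finite_lists_length_eq[of "{..<d}" n] by simp
qed

lemma prod_sum_words:
  fixes f :: "nat \<Rightarrow> nat \<Rightarrow> 'c::comm_semiring_1"
  shows "(\<Prod>p<n. \<Sum>i<d. f p i) = (\<Sum>xs\<in>words d n. \<Prod>p<n. f p (xs ! p))"
proof -
  have bij: "bij_betw (\<lambda>g. map g [0..<n]) ({..<n} \<rightarrow>\<^sub>E {..<d}) (words d n)"
  proof (rule bij_betw_byWitness[where f' = "\<lambda>xs. restrict ((!) xs) {..<n}"])
    show "\<forall>g\<in>{..<n} \<rightarrow>\<^sub>E {..<d}. restrict ((!) (map g [0..<n])) {..<n} = g"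
      by (force simp: fun_eq_iff restrict_def PiE_def extensional_def)
    show "\<forall>xs\<in>words d n. map (restrict ((!) xs) {..<n}) [0..<n] = xs"
      by (auto simp: words_def intro!: nth_equalityI)
    show "(\<lambda>g. map g [0..<n]) ` ({..<n} \<rightarrow>\<^sub>E {..<d}) \<subseteq> words d n"
      by (auto simp: words_def PiE_def Pi_def)
    show "(\<lambda>xs. restrict ((!) xs) {..<n}) ` words d n \<subseteq> {..<n} \<rightarrow>\<^sub>E {..<d}"
      by (auto simp: words_def subset_iff PiE_def)
  qed
  have "(\<Prod>p<n. \<Sum>i<d. f p i) = (\<Sum>g\<in>{..<n} \<rightarrow>\<^sub>E {..<d}. \<Prod>p<n. f p (g p))"
    by (rule prod_sum_PiE) auto
  also have "\<dots> = (\<Sum>g\<in>{..<n} \<rightarrow>\<^sub>E {..<d}. \<Prod>p<n. f p (map g [0..<n] ! p))"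
    by (intro sum.cong prod.cong) auto
  also have "\<dots> = (\<Sum>xs\<in>words d n. \<Prod>p<n. f p (xs ! p))"
    by (rule sum.reindex_bij_betw[OF bij])
  finally show ?thesis .
qed

lemma GL_D:
  assumes "g \<in> GL scale"
  shows "g (x + y) = g x + g y" "g (scale c x) = scale c (g x)" "bij g"
  using assms unfolding GL_def Vector_Spaces.linear_iff by auto

lemma tensor_act_simps:
  "tensor_act g (s + t) = tensor_act g s + tensor_act g t"
  "tensor_act g (fscale c t) = fscale c (tensor_act g t)"
  "tensor_act g 0 = 0"
  by (auto simp: tensor_act_def fun_eq_iff pointwise)

lemma tensor_act_compose: "tensor_act g (tensor_act h t) = tensor_act (g \<circ> h) t"
  by (simp add: tensor_act_def comp_assoc fun_eq_iff comp_def)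

lemma tensor_perm_simps:
  "tensor_perm \<sigma> (s + t) = tensor_perm \<sigma> s + tensor_perm \<sigma> t"
  "tensor_perm \<sigma> (fscale c t) = fscale c (tensor_perm \<sigma> t)"
  "tensor_perm \<sigma> 0 = 0"
  by (auto simp: tensor_perm_def fun_eq_iff pointwise)

lemma tensor_perm_sum: "tensor_perm \<sigma> (sum f A) = (\<Sum>a\<in>A. tensor_perm \<sigma> (f a))"
  by (rule additive_sum[of "tensor_perm \<sigma>"]) (simp_all add: tensor_perm_simps)

text \<open>
  For \<open>\<chi> = 1\<close> and the row group this is row symmetrization, for the sign character and the column
  group it is column antisymmetrization.
\<close>

definition sym_sum ::
  "((nat \<Rightarrow> nat) \<Rightarrow> int) \<Rightarrow> (nat \<Rightarrow> nat) set \<Rightarrow> 'v tensor \<Rightarrow> 'v tensor" where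
  "sym_sum \<chi> G t = (\<Sum>\<sigma>\<in>G. fscale (of_int (\<chi> \<sigma>)) (tensor_perm \<sigma> t))"

lemma sym_sum_simps:
  "sym_sum \<chi> G (s + t) = sym_sum \<chi> G s + sym_sum \<chi> G t"
  "sym_sum \<chi> G (fscale c t) = fscale c (sym_sum \<chi> G t)"
  "sym_sum \<chi> G 0 = 0"
  by (auto simp: sym_sum_def tensor_perm_simps pointwise fun_eq_iff algebra_simps
      sum.distrib sum_distrib_left)

lemma sym_sum_sum: "sym_sum \<chi> G (sum f A) = (\<Sum>a\<in>A. sym_sum \<chi> G (f a))"
  by (rule additive_sum[of "sym_sum \<chi> G"]) (simp_all add: sym_sum_simps)

text \<open>
  The row and the column group have the same shape: both consist of the permutations of the
  positions that preserve a colouring, by row and by column respectively.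
\<close>

definition fibre_perms :: "nat \<Rightarrow> (nat \<Rightarrow> 'c) \<Rightarrow> (nat \<Rightarrow> nat) set" where
  "fibre_perms n c = {\<sigma>. \<sigma> permutes {..<n} \<and> (\<forall>p<n. c (\<sigma> p) = c p)}"

lemma row_group_fibre: "row_group \<nu> = fibre_perms (sum_list \<nu>) (\<lambda>p. fst (boxes \<nu> ! p))"
  by (simp add: row_group_def fibre_perms_def)

lemma column_group_fibre: "column_group \<nu> = fibre_perms (sum_list \<nu>) (\<lambda>p. snd (boxes \<nu> ! p))"
  by (simp add: column_group_def fibre_perms_def)

lemma fibre_perms_permutes: "\<sigma> \<in> fibre_perms n c \<Longrightarrow> \<sigma> permutes {..<n}"
  by (simp add: fibre_perms_def)

lemma fibre_perms_permutation: "\<sigma> \<in> fibre_perms n c \<Longrightarrow> permutation \<sigma>"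
  by (auto simp: fibre_perms_def permutation_permutes)

lemma inv_in_fibre_perms:
  assumes "\<sigma> \<in> fibre_perms n c"
  shows "Hilbert_Choice.inv \<sigma> \<in> fibre_perms n c"
proof -
  have s: "\<sigma> permutes {..<n}" and eq: "\<And>p. p < n \<Longrightarrow> c (\<sigma> p) = c p"
    using assms by (auto simp: fibre_perms_def)
  have "c (Hilbert_Choice.inv \<sigma> p) = c p" if "p < n" for p
    using eq[of "Hilbert_Choice.inv \<sigma> p"] permutes_in_image[OF permutes_inv[OF s], of p] that
      permutes_inverses(1)[OF s, of p] by auto
  then show ?thesis
    using permutes_inv[OF s] by (simp add: fibre_perms_def)
qed

lemma comp_in_fibre_perms:
  assumes "\<sigma> \<in> fibre_perms n c" "\<tau> \<in> fibre_perms n c"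
  shows "\<sigma> \<circ> \<tau> \<in> fibre_perms n c"
proof -
  have t: "\<tau> p < n" if "p < n" for p
    using permutes_in_image[of \<tau> "{..<n}" p] assms(2) that by (auto simp: fibre_perms_def)
  then show ?thesis
    using assms by (auto simp: fibre_perms_def intro: permutes_compose)
qed

lemma bij_inv_fibre_perms: "bij_betw Hilbert_Choice.inv (fibre_perms n c) (fibre_perms n c)"
  by (rule bij_betw_byWitness[where f' = Hilbert_Choice.inv])
     (auto simp: inv_in_fibre_perms inv_inv_eq permutes_bij[OF fibre_perms_permutes])

lemma bij_comp_fibre_perms:
  assumes "\<sigma> \<in> fibre_perms n c"
  shows "bij_betw ((\<circ>) \<sigma>) (fibre_perms n c) (fibre_perms n c)"
proof (rule bij_betw_byWitness[where f' = "(\<circ>) (Hilbert_Choice.inv \<sigma>)"])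
  note s = fibre_perms_permutes[OF assms]
  show "\<forall>\<tau>\<in>fibre_perms n c. Hilbert_Choice.inv \<sigma> \<circ> (\<sigma> \<circ> \<tau>) = \<tau>"
    by (auto simp: fun_eq_iff permutes_inverses[OF s])
  show "\<forall>\<tau>\<in>fibre_perms n c. \<sigma> \<circ> (Hilbert_Choice.inv \<sigma> \<circ> \<tau>) = \<tau>"
    by (auto simp: fun_eq_iff permutes_inverses[OF s])
qed (use assms in \<open>auto simp: comp_in_fibre_perms inv_in_fibre_perms\<close>)

section \<open>Tensor powers and Schur modules in coordinates\<close>

locale coordinate_space = vector_space scale
  for scale :: "complex \<Rightarrow> 'v::ab_group_add \<Rightarrow> 'v" +
  fixes d :: nat and e :: "nat \<Rightarrow> 'v"
  assumes inj_e: "inj_on e {..<d}"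
    and indep_e: "independent (e ` {..<d})"
    and span_e: "span (e ` {..<d}) = UNIV"
begin

definition coord :: "nat \<Rightarrow> 'v \<Rightarrow> complex" where
  "coord i v = representation (e ` {..<d}) v (e i)"

lemma dual_iff:
  "\<phi> \<in> dual scale \<longleftrightarrow> (\<forall>x y. \<phi> (x + y) = \<phi> x + \<phi> y) \<and> (\<forall>c x. \<phi> (scale c x) = c * \<phi> x)"
proof -
  have "vector_space ((*) :: complex \<Rightarrow> complex \<Rightarrow> complex)"
    by unfold_locales (simp_all add: algebra_simps)
  then show ?thesis
    using vector_space_axioms by (auto simp: dual_def Vector_Spaces.linear_iff)
qed

lemma dual_add: "\<phi> \<in> dual scale \<Longrightarrow> \<phi> (x + y) = \<phi> x + \<phi> y"
  and dual_scale: "\<phi> \<in> dual scale \<Longrightarrow> \<phi> (scale c x) = c * \<phi> x"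
  by (auto simp: dual_iff)

lemma dual_zero: "\<phi> \<in> dual scale \<Longrightarrow> \<phi> 0 = 0"
  using dual_scale[of \<phi> 0 0] by simp

lemma dual_sum: "\<phi> \<in> dual scale \<Longrightarrow> \<phi> (sum f A) = (\<Sum>a\<in>A. \<phi> (f a))"
  by (induction A rule: infinite_finite_induct) (auto simp: dual_zero dual_add)

lemma zero_in_dual: "(\<lambda>_. 0) \<in> dual scale"
  by (simp add: dual_iff)

lemma add_in_dual: "\<phi> \<in> dual scale \<Longrightarrow> \<psi> \<in> dual scale \<Longrightarrow> (\<lambda>v. \<phi> v + \<psi> v) \<in> dual scale"
  by (simp add: dual_iff algebra_simps)

lemma scale_in_dual: "\<phi> \<in> dual scale \<Longrightarrow> (\<lambda>v. c * \<phi> v) \<in> dual scale"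
  by (simp add: dual_iff algebra_simps)

lemma sum_in_dual:
  "(\<And>a. a \<in> A \<Longrightarrow> f a \<in> dual scale) \<Longrightarrow> (\<lambda>v. \<Sum>a\<in>A. f a v) \<in> dual scale"
  by (induction A rule: infinite_finite_induct) (auto simp: zero_in_dual add_in_dual)

lemma GL_iff:
  "g \<in> GL scale \<longleftrightarrow> (\<forall>x y. g (x + y) = g x + g y) \<and> (\<forall>c x. g (scale c x) = scale c (g x)) \<and> bij g"
  using vector_space_axioms by (auto simp: GL_def Vector_Spaces.linear_iff)

lemma comp_in_dual_iff:
  assumes "g \<in> GL scale"
  shows "\<phi> \<circ> g \<in> dual scale \<longleftrightarrow> \<phi> \<in> dual scale"
proof
  assume a: "\<phi> \<circ> g \<in> dual scale"
  have eq: "g (Hilbert_Choice.inv g x) = x" for x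
    using GL_D(3)[OF assms] by (simp add: bij_is_surj surj_f_inv_f)
  show "\<phi> \<in> dual scale"
    unfolding dual_iff
  proof (intro conjI allI)
    show "\<phi> (x + y) = \<phi> x + \<phi> y" for x y
      using dual_add[OF a, of "Hilbert_Choice.inv g x" "Hilbert_Choice.inv g y"]
      by (simp add: GL_D(1)[OF assms] eq)
    show "\<phi> (scale c x) = c * \<phi> x" for c x
      using dual_scale[OF a, of c "Hilbert_Choice.inv g x"]
      by (simp add: GL_D(2)[OF assms] eq)
  qed
qed (use GL_D[OF assms] in \<open>auto simp: dual_iff\<close>)

lemma coord_in_dual: "coord i \<in> dual scale"
  using representation_add[OF indep_e] representation_scale[OF indep_e] span_e
  by (auto simp: dual_iff coord_def)

lemma coord_e: "i < d \<Longrightarrow> l < d \<Longrightarrow> coord i (e l) = (if i = l then 1 else 0)"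
  using representation_basis[OF indep_e, of "e l"] inj_e
  by (auto simp: coord_def inj_on_def)

lemma coord_expand: "v = (\<Sum>i<d. scale (coord i v) (e i))"
proof -
  have "v = (\<Sum>b\<in>e ` {..<d}. scale (representation (e ` {..<d}) v b) b)"
    using sum_representation_eq[OF indep_e, of v "e ` {..<d}"] span_e by simp
  also have "\<dots> = (\<Sum>i<d. scale (coord i v) (e i))"
    by (simp add: sum.reindex[OF inj_e] coord_def)
  finally show ?thesis .
qed

lemma dual_expand: "\<phi> \<in> dual scale \<Longrightarrow> \<phi> v = (\<Sum>i<d. coord i v * \<phi> (e i))"
  using dual_sum[of \<phi> "\<lambda>i. scale (coord i v) (e i)" "{..<d}"] coord_expand[of v]
  by (simp add: dual_scale)

lemma coord_sum_e: "i < d \<Longrightarrow> coord i (\<Sum>l<d. scale (a l) (e l)) = a i"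
  by (simp add: dual_sum[OF coord_in_dual] dual_scale[OF coord_in_dual] coord_e sum.delta if_distrib
      cong: if_cong)

abbreviation tensors :: "nat \<Rightarrow> 'v tensor set" where
  "tensors \<equiv> tensor_power scale"

lemma tensors_induct [consumes 1, case_names pure zero add scale]:
  assumes "t \<in> tensors n" "\<And>vs. length vs = n \<Longrightarrow> P (pure_tensor scale vs)" "P 0"
    "\<And>x y. P x \<Longrightarrow> P y \<Longrightarrow> P (x + y)" "\<And>c x. P x \<Longrightarrow> P (fscale c x)"
  shows "P t"
  by (rule fspan_induct[OF assms(1)[unfolded tensor_power_def]]) (use assms(2-5) in auto)

lemma tensors_subspace: "fun_space.subspace (tensors n)"
  by (simp add: tensor_power_def)

lemma pure_in_tensors: "length vs = n \<Longrightarrow> pure_tensor scale vs \<in> tensors n"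
  unfolding tensor_power_def by (rule fun_space.span_base) auto

lemma tensors_add: "s \<in> tensors n \<Longrightarrow> t \<in> tensors n \<Longrightarrow> s + t \<in> tensors n"
  and tensors_scale: "t \<in> tensors n \<Longrightarrow> fscale c t \<in> tensors n"
  and tensors_zero: "0 \<in> tensors n"
  and tensors_sum: "(\<And>a. a \<in> A \<Longrightarrow> f a \<in> tensors n) \<Longrightarrow> sum f A \<in> tensors n"
  using tensors_subspace fun_space.subspace_add fun_space.subspace_scale fun_space.subspace_0
    fun_space.subspace_sum by blast+

lemma tensors_support:
  assumes "t \<in> tensors n" "length \<phi>s \<noteq> n \<or> \<not> set \<phi>s \<subseteq> dual scale"
  shows "t \<phi>s = 0"
  by (rule tensors_induct[OF assms(1)]) (use assms(2) in \<open>auto simp: pure_tensor_def pointwise\<close>)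

lemma tensors_linear_induct:
  assumes "t \<in> tensors n" "\<And>vs. length vs = n \<Longrightarrow> L (pure_tensor scale vs) = L' (pure_tensor scale vs)"
   "\<And>x y. L (x + y) = L x + L y" "\<And>x y. L' (x + y) = L' x + L' y"
   "\<And>c x. L (fscale c x) = c * L x" "\<And>c x. L' (fscale c x) = c * L' x"
  shows "L t = (L' t :: complex)"
proof (rule tensors_induct[OF assms(1)])
  show "L 0 = L' 0" using assms(5)[of 0 0] assms(6)[of 0 0] by simp
qed (simp_all only: assms)

lemma pure_nth:
  assumes "length \<phi>s = length vs" "set \<phi>s \<subseteq> dual scale" "n = length vs"
  shows "pure_tensor scale vs \<phi>s = (\<Prod>i<n. (\<phi>s ! i) (vs ! i))"
  using assms by (simp add: pure_tensor_def)

definition word_tensor :: "nat list \<Rightarrow> 'v tensor" where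
  "word_tensor xs = pure_tensor scale (map e xs)"

lemma word_tensor_in: "length xs = n \<Longrightarrow> word_tensor xs \<in> tensors n"
  by (simp add: word_tensor_def pure_in_tensors)

lemma coords_dual: "set (map coord xs) \<subseteq> dual scale"
  by (auto simp: coord_in_dual)

text \<open>
  A multilinear form is determined by its values on the dual basis. Both sides are linear in \<open>t\<close>,
  so a pure tensor suffices; there it is the expansion of a product of sums.
\<close>

lemma tensor_expand_apply:
  assumes "t \<in> tensors n"
  shows "t \<phi>s = (\<Sum>xs\<in>words d n. t (map coord xs) * word_tensor xs \<phi>s)"
proof (cases "length \<phi>s = n \<and> set \<phi>s \<subseteq> dual scale")
  case False
  have "word_tensor xs \<phi>s = 0" if "xs \<in> words d n" for xs
    using that False tensors_support[OF word_tensor_in[of xs n]] by (auto simp: words_def)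
  then show ?thesis
    using False tensors_support[OF assms] by auto
next
  case True
  show ?thesis
    using assms
  proof (rule tensors_linear_induct, goal_cases)
    case (1 vs)
    have d: "p < n \<Longrightarrow> \<phi>s ! p \<in> dual scale" for p
      using True by (auto dest: nth_mem)
    have "pure_tensor scale vs \<phi>s = (\<Prod>p<n. (\<phi>s ! p) (vs ! p))"
      using 1 True by (simp add: pure_nth)
    also have "\<dots> = (\<Prod>p<n. \<Sum>i<d. coord i (vs ! p) * (\<phi>s ! p) (e i))"
      by (intro prod.cong refl) (simp add: dual_expand[OF d, symmetric])
    also have "\<dots> = (\<Sum>xs\<in>words d n. \<Prod>p<n. coord (xs ! p) (vs ! p) * (\<phi>s ! p) (e (xs ! p)))"
      by (rule prod_sum_words)
    also have "\<dots> = (\<Sum>xs\<in>words d n. pure_tensor scale vs (map coord xs) * word_tensor xs \<phi>s)"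
      using 1 True coords_dual
      by (intro sum.cong refl) (simp add: pure_nth[where n = n] words_def word_tensor_def prod.distrib)
    finally show ?case .
  qed (simp_all add: distrib_right mult.assoc sum.distrib sum_distrib_left plus_fun_apply fscale_apply)
qed

lemma tensor_expand:
  assumes "t \<in> tensors n"
  shows "t = (\<Sum>xs\<in>words d n. fscale (t (map coord xs)) (word_tensor xs))"
  unfolding fun_eq_iff sum_fun_apply fscale_apply using tensor_expand_apply[OF assms] by blast

lemma tensor_act_pure:
  assumes "g \<in> GL scale"
  shows "tensor_act g (pure_tensor scale vs) = pure_tensor scale (map g vs)"
proof
  fix \<phi>s
  have "set (map (\<lambda>\<phi>. \<phi> \<circ> g) \<phi>s) \<subseteq> dual scale \<longleftrightarrow> set \<phi>s \<subseteq> dual scale"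
    using comp_in_dual_iff[OF assms] by auto
  then show "tensor_act g (pure_tensor scale vs) \<phi>s = pure_tensor scale (map g vs) \<phi>s"
    by (simp add: tensor_act_def pure_tensor_def)
qed

lemma tensor_act_in:
  assumes "g \<in> GL scale" "t \<in> tensors n"
  shows "tensor_act g t \<in> tensors n"
  by (rule tensors_induct[OF assms(2)])
     (simp_all add: assms(1) tensor_act_simps tensor_act_pure pure_in_tensors tensors_add tensors_scale tensors_zero)

lemma tensor_perm_pure:
  assumes "\<sigma> permutes {..<n}" "length vs = n"
  shows "tensor_perm \<sigma> (pure_tensor scale vs) = pure_tensor scale (permute_list \<sigma> vs)"
proof
  fix \<phi>s
  note s' = permutes_inv[OF assms(1)]
  show "tensor_perm \<sigma> (pure_tensor scale vs) \<phi>s = pure_tensor scale (permute_list \<sigma> vs) \<phi>s"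
  proof (cases "length \<phi>s = n \<and> set \<phi>s \<subseteq> dual scale")
    case True
    have "(\<Prod>i<n. (permute_list (Hilbert_Choice.inv \<sigma>) \<phi>s ! i) (vs ! i))
        = (\<Prod>i<n. (\<phi>s ! Hilbert_Choice.inv \<sigma> i) (vs ! i))"
      using True s' by (intro prod.cong refl) (simp add: permute_list_nth)
    also have "\<dots> = (\<Prod>i<n. (\<phi>s ! Hilbert_Choice.inv \<sigma> (\<sigma> i)) (vs ! \<sigma> i))"
      by (rule prod.reindex_bij_betw[symmetric]) (rule permutes_imp_bij[OF assms(1)])
    also have "\<dots> = (\<Prod>i<n. (\<phi>s ! i) (permute_list \<sigma> vs ! i))"
      using assms by (intro prod.cong refl) (simp add: permute_list_nth permutes_inverses[OF assms(1)])
    finally show ?thesis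
      using True assms s' by (simp add: tensor_perm_def pure_tensor_def)
  next
    case False
    moreover have "length \<phi>s = n \<Longrightarrow> set (permute_list (Hilbert_Choice.inv \<sigma>) \<phi>s) = set \<phi>s"
      using s' by simp
    ultimately show ?thesis
      using assms(2) by (auto simp: tensor_perm_def pure_tensor_def)
  qed
qed

lemma tensor_perm_in:
  assumes "\<sigma> permutes {..<n}" "t \<in> tensors n"
  shows "tensor_perm \<sigma> t \<in> tensors n"
  by (rule tensors_induct[OF assms(2)])
     (simp_all add: tensor_perm_simps tensor_perm_pure[OF assms(1)] pure_in_tensors tensors_add tensors_scale tensors_zero)

lemma tensor_perm_compose:
  assumes "\<sigma> permutes {..<n}" "\<tau> permutes {..<n}" "t \<in> tensors n"
  shows "tensor_perm (\<sigma> \<circ> \<tau>) t = tensor_perm \<tau> (tensor_perm \<sigma> t)"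
proof
  fix \<phi>s
  show "tensor_perm (\<sigma> \<circ> \<tau>) t \<phi>s = tensor_perm \<tau> (tensor_perm \<sigma> t) \<phi>s"
  proof (cases "length \<phi>s = n")
    case True
    have "Hilbert_Choice.inv (\<sigma> \<circ> \<tau>) = Hilbert_Choice.inv \<tau> \<circ> Hilbert_Choice.inv \<sigma>"
      using assms by (intro o_inv_distrib permutes_bij)
    then show ?thesis
      using True permutes_inv[OF assms(1)]
      by (simp add: tensor_perm_def permute_list_compose)
  next
    case False
    then show ?thesis
      using tensors_support[OF assms(3)] by (simp add: tensor_perm_def)
  qed
qed

lemma tensor_perm_act:
  assumes "\<sigma> permutes {..<n}" "t \<in> tensors n"
  shows "tensor_perm \<sigma> (tensor_act g t) = tensor_act g (tensor_perm \<sigma> t)"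
proof
  fix \<phi>s
  show "tensor_perm \<sigma> (tensor_act g t) \<phi>s = tensor_act g (tensor_perm \<sigma> t) \<phi>s"
    using permutes_inv[OF assms(1)] tensors_support[OF assms(2)]
    by (cases "length \<phi>s = n") (simp_all add: tensor_perm_def tensor_act_def permute_list_map)
qed

lemma sym_sum_in: "t \<in> tensors n \<Longrightarrow> sym_sum \<chi> (fibre_perms n c) t \<in> tensors n"
  unfolding sym_sum_def
  by (intro tensors_sum tensors_scale tensor_perm_in) (auto simp: fibre_perms_permutes)

lemma sym_sum_act:
  assumes "t \<in> tensors n"
  shows "sym_sum \<chi> (fibre_perms n c) (tensor_act g t) = tensor_act g (sym_sum \<chi> (fibre_perms n c) t)"
proof -
  have "tensor_act g (sum f A) = (\<Sum>a\<in>A. tensor_act g (f a))" for f :: "_ \<Rightarrow> 'v tensor" and A :: "(nat \<Rightarrow> nat) set"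
    by (rule additive_sum[of "tensor_act g"]) (simp_all add: tensor_act_simps)
  then show ?thesis
    unfolding sym_sum_def
    by (simp add: tensor_act_simps fibre_perms_permutes tensor_perm_act[OF _ assms])
qed

text \<open>
  The permutations act from the right, so the product of a row and a column permutation applies the
  row permutation first: rows are symmetrized, then columns are antisymmetrized.
\<close>

lemma young_symmetrizer_eq:
  assumes "t \<in> tensors (sum_list \<nu>)"
  shows "young_symmetrizer \<nu> t = sym_sum sign (column_group \<nu>) (sym_sum (\<lambda>_. 1) (row_group \<nu>) t)"
proof -
  have "young_symmetrizer \<nu> t = (\<Sum>\<sigma>\<in>row_group \<nu>. \<Sum>\<tau>\<in>column_group \<nu>.
        fscale (of_int (sign \<tau>)) (tensor_perm \<tau> (tensor_perm \<sigma> t)))"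
    unfolding young_symmetrizer_def row_group_fibre column_group_fibre
    by (intro sum.cong refl) (simp add: tensor_perm_compose[OF _ _ assms] fibre_perms_permutes)
  also have "\<dots> = (\<Sum>\<tau>\<in>column_group \<nu>. \<Sum>\<sigma>\<in>row_group \<nu>. 
        fscale (of_int (sign \<tau>)) (tensor_perm \<tau> (tensor_perm \<sigma> t)))"
    by (rule sum.swap)
  also have "\<dots> = sym_sum sign (column_group \<nu>) (sym_sum (\<lambda>_. 1) (row_group \<nu>) t)"
    by (simp add: sym_sum_def tensor_perm_sum fun_space.scale_sum_right)
  finally show ?thesis .
qed

lemma young_symmetrizer_in:
  "t \<in> tensors (sum_list \<nu>) \<Longrightarrow> young_symmetrizer \<nu> t \<in> tensors (sum_list \<nu>)"
  by (simp add: young_symmetrizer_eq row_group_fibre column_group_fibre sym_sum_in)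

lemma young_symmetrizer_act:
  assumes "g \<in> GL scale" "t \<in> tensors (sum_list \<nu>)"
  shows "young_symmetrizer \<nu> (tensor_act g t) = tensor_act g (young_symmetrizer \<nu> t)"
  using assms
  by (simp add: young_symmetrizer_eq tensor_act_in row_group_fibre column_group_fibre sym_sum_in sym_sum_act)

lemma young_symmetrizer_simps:
  shows "s \<in> tensors (sum_list \<nu>) \<Longrightarrow> t \<in> tensors (sum_list \<nu>) \<Longrightarrow>
      young_symmetrizer \<nu> (s + t) = young_symmetrizer \<nu> s + young_symmetrizer \<nu> t"
    "t \<in> tensors (sum_list \<nu>) \<Longrightarrow> young_symmetrizer \<nu> (fscale c t) = fscale c (young_symmetrizer \<nu> t)"
  by (simp_all add: young_symmetrizer_eq sym_sum_simps tensors_add tensors_scale)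

lemma young_symmetrizer_sum:
  "(\<And>a. a \<in> A \<Longrightarrow> f a \<in> tensors (sum_list \<nu>)) \<Longrightarrow>
    young_symmetrizer \<nu> (sum f A) = (\<Sum>a\<in>A. young_symmetrizer \<nu> (f a))"
  by (simp add: young_symmetrizer_eq tensors_sum sym_sum_sum)

lemma schur_subset: "schur_module scale \<nu> \<subseteq> tensors (sum_list \<nu>)"
  by (auto simp: schur_module_def young_symmetrizer_in)

lemma schurI: "t \<in> tensors (sum_list \<nu>) \<Longrightarrow> young_symmetrizer \<nu> t \<in> schur_module scale \<nu>"
  by (simp add: schur_module_def)

text \<open>
  The generators are eigenvectors of every diagonal matrix, which is what makes weights available.
\<close>

lemma schur_span:
  "schur_module scale \<nu> = fun_space.span ((\<lambda>xs. young_symmetrizer \<nu> (word_tensor xs)) ` words d (sum_list \<nu>))"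
    (is "_ = fun_space.span (?f ` _)")
proof
  have w: "xs \<in> words d (sum_list \<nu>) \<Longrightarrow> word_tensor xs \<in> tensors (sum_list \<nu>)" for xs
    by (simp add: words_def word_tensor_in)
  show "schur_module scale \<nu> \<subseteq> fun_space.span (?f ` words d (sum_list \<nu>))"
  proof
    fix x assume "x \<in> schur_module scale \<nu>"
    then obtain t where t: "t \<in> tensors (sum_list \<nu>)" "x = young_symmetrizer \<nu> t"
      by (auto simp: schur_module_def)
    have "x = young_symmetrizer \<nu> (\<Sum>xs\<in>words d (sum_list \<nu>). fscale (t (map coord xs)) (word_tensor xs))"
      using tensor_expand[OF t(1)] t(2) by simp
    also have "\<dots> = (\<Sum>xs\<in>words d (sum_list \<nu>). fscale (t (map coord xs)) (?f xs))"
      by (simp add: young_symmetrizer_sum w tensors_scale young_symmetrizer_simps(2) cong: sum.cong)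
    also have "\<dots> \<in> fun_space.span (?f ` words d (sum_list \<nu>))"
      by (intro fun_space.span_sum fun_space.span_scale fun_space.span_base) auto
    finally show "x \<in> fun_space.span (?f ` words d (sum_list \<nu>))" .
  qed
  show "fun_space.span (?f ` words d (sum_list \<nu>)) \<subseteq> schur_module scale \<nu>"
  proof (rule fun_space.span_minimal)
    show "?f ` words d (sum_list \<nu>) \<subseteq> schur_module scale \<nu>"
      by (auto simp: schur_module_def w)
    show "fun_space.subspace (schur_module scale \<nu>)"
      unfolding fun_space.subspace_def
    proof (intro conjI ballI allI)
      have "0 = young_symmetrizer \<nu> (0 :: 'v tensor)"
        by (simp add: young_symmetrizer_eq tensors_zero sym_sum_simps)
      then show "0 \<in> schur_module scale \<nu>"
        using tensors_zero unfolding schur_module_def by blast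
    next
      fix x y assume "x \<in> schur_module scale \<nu>" "y \<in> schur_module scale \<nu>"
      then obtain s t where "s \<in> tensors (sum_list \<nu>)" "t \<in> tensors (sum_list \<nu>)"
        "x = young_symmetrizer \<nu> s" "y = young_symmetrizer \<nu> t"
        by (auto simp: schur_module_def)
      then show "x + y \<in> schur_module scale \<nu>"
        using schurI[OF tensors_add[of s _ t]] by (simp add: young_symmetrizer_simps(1))
    next
      fix c x assume "x \<in> schur_module scale \<nu>"
      then obtain t where "t \<in> tensors (sum_list \<nu>)" "x = young_symmetrizer \<nu> t"
        by (auto simp: schur_module_def)
      then show "fscale c x \<in> schur_module scale \<nu>"
        using schurI[OF tensors_scale[of t _ c]] by (simp add: young_symmetrizer_simps(2))
    qed
  qed
qed

lemma schur_subspace: "fun_space.subspace (schur_module scale \<nu>)"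
  unfolding schur_span by (rule fun_space.subspace_span)

lemma schur_act:
  assumes "g \<in> GL scale" "x \<in> schur_module scale \<nu>"
  shows "tensor_act g x \<in> schur_module scale \<nu>"
proof -
  obtain t where "t \<in> tensors (sum_list \<nu>)" "x = young_symmetrizer \<nu> t"
    using assms(2) by (auto simp: schur_module_def)
  then show ?thesis
    using schurI[OF tensor_act_in[OF assms(1)]] young_symmetrizer_act[OF assms(1)] by simp
qed

end


section \<open>Polarization and the Hermitian form\<close>

lemma poly_eqI_cofinite:
  fixes p q :: "complex poly"
  assumes "finite B" "\<And>t. t \<notin> B \<Longrightarrow> poly p t = poly q t"
  shows "p = q"
proof (rule ccontr)
  assume "p \<noteq> q"
  then have "finite {t. poly (p - q) t = 0}"
    by (intro poly_roots_finite) simp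
  moreover have "UNIV = B \<union> {t. poly (p - q) t = 0}"
    using assms(2) by auto
  ultimately have "finite (UNIV :: complex set)"
    using assms(1) by (metis finite_UnI)
  then show False
    by (simp add: infinite_UNIV_char_0)
qed

text \<open>
  A self-map of a finite set is a permutation as soon as it is surjective. The two sides differ in
  the values outside of \<open>{..<n}\<close>, where functions in \<open>PiE\<close> are undefined and permutations are the
  identity; hence the hypothesis on \<open>F\<close>.
\<close>

lemma sum_PiE_surj_fibre_perms:
  fixes c :: "nat \<Rightarrow> 'c" and F :: "(nat \<Rightarrow> nat) \<Rightarrow> 'd::comm_monoid_add"
  assumes "\<And>h h'. (\<And>p. p < n \<Longrightarrow> h p = h' p) \<Longrightarrow> F h = F h'"
  shows "(\<Sum>h\<in>{h \<in> ({..<n} \<rightarrow>\<^sub>E {..<n}). (\<forall>p<n. c (h p) = c p) \<and> {..<n} \<subseteq> h ` {..<n}}. F h)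
    = (\<Sum>\<sigma>\<in>fibre_perms n c. F \<sigma>)"
proof -
  let ?H = "{h \<in> ({..<n} \<rightarrow>\<^sub>E {..<n}). (\<forall>p<n. c (h p) = c p) \<and> {..<n} \<subseteq> h ` {..<n}}"
  have "bij_betw (\<lambda>\<sigma>. restrict \<sigma> {..<n}) (fibre_perms n c) ?H"
  proof (rule bij_betw_byWitness[where f' = "\<lambda>h p. if p < n then h p else p"])
    show "\<forall>\<sigma>\<in>fibre_perms n c. (\<lambda>p. if p < n then restrict \<sigma> {..<n} p else p) = \<sigma>"
      by (auto simp: fibre_perms_def fun_eq_iff permutes_def)
    show "\<forall>h\<in>?H. restrict (\<lambda>p. if p < n then h p else p) {..<n} = h"
      by (auto simp: fun_eq_iff PiE_def extensional_def)
    show "(\<lambda>\<sigma>. restrict \<sigma> {..<n}) ` fibre_perms n c \<subseteq> ?H"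
    proof (rule image_subsetI)
      fix \<sigma> assume s: "\<sigma> \<in> fibre_perms n c"
      note p = fibre_perms_permutes[OF s]
      have "restrict \<sigma> {..<n} \<in> {..<n} \<rightarrow>\<^sub>E {..<n}"
        using permutes_in_image[OF p] by (auto simp: PiE_def)
      moreover have "\<forall>q<n. c (restrict \<sigma> {..<n} q) = c q"
        using s by (simp add: fibre_perms_def)
      moreover have "restrict \<sigma> {..<n} ` {..<n} = {..<n}"
        using permutes_image[OF p] by simp
      ultimately show "restrict \<sigma> {..<n} \<in> ?H"
        by simp
    qed
    show "(\<lambda>h p. if p < n then h p else p) ` ?H \<subseteq> fibre_perms n c"
    proof (rule image_subsetI)
      fix h assume "h \<in> ?H"
      then have h: "h \<in> {..<n} \<rightarrow>\<^sub>E {..<n}" "\<forall>p<n. c (h p) = c p" "{..<n} \<subseteq> h ` {..<n}"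
        by auto
      have im: "h ` {..<n} = {..<n}"
        using h(1,3) by (auto simp: PiE_def)
      then have "inj_on h {..<n}"
        by (intro eq_card_imp_inj_on) simp_all
      then have "bij_betw h {..<n} {..<n}"
        using im by (simp add: bij_betw_def)
      then have "bij_betw (\<lambda>p. if p < n then h p else p) {..<n} {..<n}"
        by (subst bij_betw_cong[of _ _ h]) auto
      then have "(\<lambda>p. if p < n then h p else p) permutes {..<n}"
        by (rule bij_imp_permutes) auto
      then show "(\<lambda>p. if p < n then h p else p) \<in> fibre_perms n c"
        using h(2) by (simp add: fibre_perms_def)
    qed
  qed
  from sum.reindex_bij_betw[OF this, of F]
  have "(\<Sum>h\<in>?H. F h) = (\<Sum>\<sigma>\<in>fibre_perms n c. F (restrict \<sigma> {..<n}))"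
    by simp
  also have "\<dots> = (\<Sum>\<sigma>\<in>fibre_perms n c. F \<sigma>)"
    by (intro sum.cong refl assms) simp
  finally show ?thesis .
qed

text \<open>
  Expand the product of \<open>1 - of_bool (q \<notin> T)\<close> over all \<open>q < n\<close>.
\<close>

lemma alternating_sum_avoiding:
  fixes T :: "nat set"
  shows "(\<Sum>X\<in>Pow {..<n}. (-1) ^ card X * of_bool (X \<inter> T = {})) = (of_bool ({..<n} \<subseteq> T) :: complex)"
proof -
  have "(\<Prod>q<n. 1 - of_bool (q \<notin> T)) =
      (\<Sum>X\<in>Pow {..<n}. (-1) ^ card X * (\<Prod>q\<in>X. of_bool (q \<notin> T)) * (\<Prod>q\<in>{..<n} - X. 1) :: complex)"
    by (rule prod_diff_conv_sum) simp
  also have "\<dots> = (\<Sum>X\<in>Pow {..<n}. (-1) ^ card X * of_bool (X \<inter> T = {}))"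
  proof (intro sum.cong refl)
    fix X assume "X \<in> Pow {..<n}"
    then have fin: "finite X"
      by (auto intro: finite_subset)
    have "(\<Prod>q\<in>X. of_bool (q \<notin> T)) = (of_bool (X \<inter> T = {}) :: complex)"
    proof (cases "X \<inter> T = {}")
      case True
      then show ?thesis by (auto intro!: prod.neutral)
    next
      case False
      then show ?thesis using fin by (auto simp: prod_zero_iff)
    qed
    then show "(-1) ^ card X * (\<Prod>q\<in>X. of_bool (q \<notin> T)) * (\<Prod>q\<in>{..<n} - X. 1)
        = ((-1) ^ card X * of_bool (X \<inter> T = {}) :: complex)"
      by simp
  qed
  finally have eq: "(\<Sum>X\<in>Pow {..<n}. (-1) ^ card X * of_bool (X \<inter> T = {}))
      = (\<Prod>q<n. 1 - of_bool (q \<notin> T) :: complex)" by simp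
  show ?thesis
  proof (cases "{..<n} \<subseteq> T")
    case True
    then have "(\<Prod>q<n. 1 - of_bool (q \<notin> T) :: complex) = 1"
      by (intro prod.neutral) auto
    with True eq show ?thesis by simp
  next
    case False
    then obtain q where "q < n" "q \<notin> T" by auto
    then have "(\<Prod>q<n. 1 - of_bool (q \<notin> T) :: complex) = 0"
      by (intro prod_zero) auto
    with False eq show ?thesis by simp
  qed
qed

text \<open>
  Inclusion-exclusion. Expanding the products on the left yields all colour-preserving maps
  \<open>h\<close> that avoid \<open>X\<close>; in the alternating sum over \<open>X\<close> only the surjective maps survive, and these
  are the permutations.
\<close>

lemma polarization_scalar:
  fixes a :: "nat \<Rightarrow> nat \<Rightarrow> complex" and c :: "nat \<Rightarrow> 'c"
  shows "(\<Sum>X\<in>Pow {..<n}. (-1) ^ card X * (\<Prod>p<n. \<Sum>q\<in>{q \<in> {..<n} - X. c q = c p}. a q p))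
    = (\<Sum>\<sigma>\<in>fibre_perms n c. \<Prod>p<n. a (\<sigma> p) p)"
proof -
  let ?B = "\<lambda>p. {q. q < n \<and> c q = c p}"
  let ?E = "PiE {..<n} ?B"
  have finE: "finite ?E"
    by (intro finite_PiE) auto
  have expand: "(\<Prod>p<n. \<Sum>q\<in>{q \<in> {..<n} - X. c q = c p}. a q p)
      = (\<Sum>h\<in>?E. (\<Prod>p<n. a (h p) p) * of_bool (X \<inter> h ` {..<n} = {}))" for X
  proof -
    have "(\<Prod>p<n. \<Sum>q\<in>{q \<in> {..<n} - X. c q = c p}. a q p)
        = (\<Prod>p<n. \<Sum>q\<in>?B p. a q p * of_bool (q \<notin> X))"
    proof (intro prod.cong refl)
      fix p
      have "(\<Sum>q\<in>{q \<in> {..<n} - X. c q = c p}. a q p)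
          = (\<Sum>q\<in>{q \<in> {..<n} - X. c q = c p}. a q p * of_bool (q \<notin> X))"
        by (intro sum.cong) auto
      also have "\<dots> = (\<Sum>q\<in>?B p. a q p * of_bool (q \<notin> X))"
        by (intro sum.mono_neutral_left) auto
      finally show "(\<Sum>q\<in>{q \<in> {..<n} - X. c q = c p}. a q p) = (\<Sum>q\<in>?B p. a q p * of_bool (q \<notin> X))" .
    qed
    also have "\<dots> = (\<Sum>h\<in>?E. \<Prod>p<n. a (h p) p * of_bool (h p \<notin> X))"
      by (rule prod_sum_PiE) auto
    also have "\<dots> = (\<Sum>h\<in>?E. (\<Prod>p<n. a (h p) p) * of_bool (X \<inter> h ` {..<n} = {}))"
    proof (intro sum.cong refl)
      fix h
      have "(\<Prod>p<n. of_bool (h p \<notin> X)) = (of_bool (X \<inter> h ` {..<n} = {}) :: complex)"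
      proof (cases "X \<inter> h ` {..<n} = {}")
        case True
        then show ?thesis by (auto intro!: prod.neutral)
      next
        case False
        then show ?thesis by (auto simp: prod_zero_iff)
      qed
      then show "(\<Prod>p<n. a (h p) p * of_bool (h p \<notin> X)) = (\<Prod>p<n. a (h p) p) * of_bool (X \<inter> h ` {..<n} = {})"
        by (simp add: prod.distrib)
    qed
    finally show ?thesis .
  qed
  have "(\<Sum>X\<in>Pow {..<n}. (-1) ^ card X * (\<Prod>p<n. \<Sum>q\<in>{q \<in> {..<n} - X. c q = c p}. a q p))
      = (\<Sum>X\<in>Pow {..<n}. \<Sum>h\<in>?E. (\<Prod>p<n. a (h p) p) * ((-1) ^ card X * of_bool (X \<inter> h ` {..<n} = {})))"
    unfolding expand by (simp add: sum_distrib_left mult_ac)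
  also have "\<dots> = (\<Sum>h\<in>?E. (\<Prod>p<n. a (h p) p) * (\<Sum>X\<in>Pow {..<n}. (-1) ^ card X * of_bool (X \<inter> h ` {..<n} = {})))"
    by (subst sum.swap) (simp only: sum_distrib_left)
  also have "\<dots> = (\<Sum>h\<in>?E. (\<Prod>p<n. a (h p) p) * of_bool ({..<n} \<subseteq> h ` {..<n}))"
    by (simp only: alternating_sum_avoiding)
  also have "\<dots> = (\<Sum>h\<in>{h \<in> ?E. {..<n} \<subseteq> h ` {..<n}}. \<Prod>p<n. a (h p) p)"
    using finE by (intro sum.mono_neutral_cong_right) auto
  also have "{h \<in> ?E. {..<n} \<subseteq> h ` {..<n}}
      = {h \<in> ({..<n} \<rightarrow>\<^sub>E {..<n}). (\<forall>p<n. c (h p) = c p) \<and> {..<n} \<subseteq> h ` {..<n}}"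
    by (auto simp: PiE_def Pi_def)
  also have "(\<Sum>h\<in>\<dots>. \<Prod>p<n. a (h p) p) = (\<Sum>\<sigma>\<in>fibre_perms n c. \<Prod>p<n. a (\<sigma> p) p)"
    by (rule sum_PiE_surj_fibre_perms) (auto intro!: prod.cong)
  finally show ?thesis .
qed

text \<open>
  The weight of the basis tensor indexed by \<open>xs\<close>: the exponent of \<open>t\<close> by which the diagonal matrix
  with \<open>l\<close> entries \<open>1\<close> followed by entries \<open>t\<close> scales it.
\<close>

definition wt :: "nat \<Rightarrow> nat list \<Rightarrow> nat" where
  "wt l xs = length (filter (\<lambda>i. l \<le> i) xs)"

lemma prod_wt: "(\<Prod>p<length xs. if xs ! p < l then 1 else t) = (t :: complex) ^ wt l xs"
  by (induction xs) (simp_all add: wt_def prod.lessThan_Suc_shift del: prod.lessThan_Suc)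

context coordinate_space
begin

lemma sum_row_perms:
  "sym_sum (\<lambda>_. 1) (fibre_perms n c) x \<phi>s = (\<Sum>\<sigma>\<in>fibre_perms n c. x (permute_list \<sigma> \<phi>s))"
  using sum.reindex_bij_betw[OF bij_inv_fibre_perms, where g = "\<lambda>\<sigma>. x (permute_list \<sigma> \<phi>s)"]
  by (simp add: sym_sum_def pointwise tensor_perm_def)

text \<open>
  The symmetrization of \<open>x\<close> over the colour classes is recovered from the values of \<open>x\<close> at lists that
  are constant on every colour class.
\<close>

lemma polarization:
  assumes "x \<in> tensors n" "length \<phi>s = n" "set \<phi>s \<subseteq> dual scale"
  shows "(\<Sum>X\<in>Pow {..<n}. (-1) ^ card X *
            x (map (\<lambda>p v. \<Sum>q\<in>{q \<in> {..<n} - X. c q = c p}. (\<phi>s ! q) v) [0..<n]))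
       = (\<Sum>\<sigma>\<in>fibre_perms n c. x (permute_list \<sigma> \<phi>s))"
  using assms(1)
proof (rule tensors_linear_induct, goal_cases)
  case (1 vs)
  have d: "\<phi>s ! q \<in> dual scale" if "q < n" for q
    using assms(2,3) that by (auto dest: nth_mem)
  have sub: "set (map (\<lambda>p v. \<Sum>q\<in>{q \<in> {..<n} - X. c q = c p}. (\<phi>s ! q) v) [0..<n]) \<subseteq> dual scale" for X
    by (auto intro!: sum_in_dual d)
  have "pure_tensor scale vs (map (\<lambda>p v. \<Sum>q\<in>{q \<in> {..<n} - X. c q = c p}. (\<phi>s ! q) v) [0..<n])
      = (\<Prod>p<n. \<Sum>q\<in>{q \<in> {..<n} - X. c q = c p}. (\<phi>s ! q) (vs ! p))" for X
    using 1 sub[of X] by (simp add: pure_nth[where n = n])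
  moreover have "pure_tensor scale vs (permute_list \<sigma> \<phi>s) = (\<Prod>p<n. (\<phi>s ! \<sigma> p) (vs ! p))"
    if "\<sigma> \<in> fibre_perms n c" for \<sigma>
    using 1 assms(2,3) fibre_perms_permutes[OF that]
    by (simp add: pure_nth[where n = n] permute_list_nth)
  ultimately show ?case
    using polarization_scalar[where n = n and c = c and a = "\<lambda>q p. (\<phi>s ! q) (vs ! p)"] by simp
qed (simp_all add: distrib_left sum.distrib sum_distrib_left pointwise mult.left_commute)

lemma sym_sum_eq_0_if_vanishes_on_constant:
  fixes c :: "nat \<Rightarrow> 'c"
  assumes x: "x \<in> tensors n"
    and van: "\<And>\<theta>. (\<And>i. \<theta> i \<in> dual scale) \<Longrightarrow> x (map (\<lambda>p. \<theta> (c p)) [0..<n]) = 0"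
  shows "sym_sum (\<lambda>_. 1) (fibre_perms n c) x = 0"
proof
  fix \<phi>s
  show "sym_sum (\<lambda>_. 1) (fibre_perms n c) x \<phi>s = 0 \<phi>s"
  proof (cases "length \<phi>s = n \<and> set \<phi>s \<subseteq> dual scale")
    case True
    then have d: "\<phi>s ! q \<in> dual scale" if "q < n" for q
      using that by (auto dest: nth_mem)
    have "x (map (\<lambda>p v. \<Sum>q\<in>{q \<in> {..<n} - X. c q = c p}. (\<phi>s ! q) v) [0..<n]) = 0" for X
      by (rule van) (auto intro!: sum_in_dual d)
    then show ?thesis
      using polarization[OF x, of \<phi>s c] True by (simp add: sum_row_perms pointwise)
  next
    case False
    then show ?thesis
      using tensors_support[OF sym_sum_in[OF x]] by (auto simp: pointwise)
  qed
qed

text \<open>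
  The Hermitian form for which the basis tensors are orthonormal. Permutations of the positions
  permute this basis, so they act unitarily.
\<close>

definition form :: "nat \<Rightarrow> 'v tensor \<Rightarrow> 'v tensor \<Rightarrow> complex" where
  "form n s t = (\<Sum>xs\<in>words d n. s (map coord xs) * cnj (t (map coord xs)))"

lemma form_simps:
  "form n 0 t = 0" "form n s 0 = 0"
  "form n (s + s') t = form n s t + form n s' t"
  "form n s (t + t') = form n s t + form n s t'"
  "form n (fscale c s) t = c * form n s t"
  "form n s (fscale c t) = cnj c * form n s t"
  by (simp_all add: form_def pointwise algebra_simps sum.distrib sum_distrib_left)

lemma form_sum_left: "form n (sum f A) t = (\<Sum>a\<in>A. form n (f a) t)"
  by (rule additive_sum[of "\<lambda>s. form n s t"]) (simp_all add: form_simps)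

lemma form_sum_right: "form n s (sum f A) = (\<Sum>a\<in>A. form n s (f a))"
  by (rule additive_sum[of "form n s"]) (simp_all add: form_simps)

lemma form_definite:
  assumes "t \<in> tensors n" "form n t t = 0"
  shows "t = 0"
proof -
  have "complex_of_real (\<Sum>xs\<in>words d n. (cmod (t (map coord xs)))\<^sup>2) = 0"
    using assms(2) by (simp add: form_def complex_mult_cnj cmod_power2)
  then have "(\<Sum>xs\<in>words d n. (cmod (t (map coord xs)))\<^sup>2) = 0"
    by (simp only: of_real_eq_0_iff)
  then have "\<forall>xs\<in>words d n. t (map coord xs) = 0"
    by (subst (asm) sum_nonneg_eq_0_iff) (auto simp: finite_words)
  then have "(\<Sum>xs\<in>words d n. fscale (t (map coord xs)) (word_tensor xs)) = 0"
    by simp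
  then show ?thesis
    using tensor_expand[OF assms(1)] by simp
qed

lemma form_perm:
  assumes "\<sigma> permutes {..<n}"
  shows "form n (tensor_perm \<sigma> s) t = form n s (tensor_perm (Hilbert_Choice.inv \<sigma>) t)"
proof -
  note s' = permutes_inv[OF assms]
  have inj: "permute_list (\<tau> \<circ> Hilbert_Choice.inv \<tau>) ys = ys" if "\<tau> permutes {..<n}" for ys :: "nat list" and \<tau>
    using permutes_inv_o(1)[OF that] by (simp add: id_def)
  have bij: "bij_betw (permute_list \<sigma>) (words d n) (words d n)"
  proof (rule bij_betw_byWitness[where f' = "permute_list (Hilbert_Choice.inv \<sigma>)"])
    show "\<forall>ys\<in>words d n. permute_list (Hilbert_Choice.inv \<sigma>) (permute_list \<sigma> ys) = ys"
      using inj[OF assms] s' by (auto simp: words_def permute_list_compose[symmetric])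
    show "\<forall>ys\<in>words d n. permute_list \<sigma> (permute_list (Hilbert_Choice.inv \<sigma>) ys) = ys"
      using inj[OF s'] assms by (auto simp: words_def permute_list_compose[symmetric] inv_inv_eq permutes_bij)
  qed (use assms s' in \<open>auto simp: words_def\<close>)
  have "form n (tensor_perm \<sigma> s) t = (\<Sum>ys\<in>words d n.
      s (permute_list (Hilbert_Choice.inv \<sigma>) (map coord (permute_list \<sigma> ys))) *
      cnj (t (map coord (permute_list \<sigma> ys))))"
    unfolding form_def tensor_perm_def
    by (rule sum.reindex_bij_betw[OF bij, symmetric])
  also have "\<dots> = (\<Sum>ys\<in>words d n. s (map coord ys) * cnj (t (permute_list \<sigma> (map coord ys))))"
  proof (intro sum.cong refl)
    fix ys assume ys: "ys \<in> words d n"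
    then have len: "length ys = n" by (simp add: words_def)
    have "permute_list (Hilbert_Choice.inv \<sigma>) (map coord (permute_list \<sigma> ys))
        = map coord (permute_list (\<sigma> \<circ> Hilbert_Choice.inv \<sigma>) ys)"
      using s' len by (simp add: permute_list_map permute_list_compose)
    then show "s (permute_list (Hilbert_Choice.inv \<sigma>) (map coord (permute_list \<sigma> ys))) *
        cnj (t (map coord (permute_list \<sigma> ys)))
        = s (map coord ys) * cnj (t (permute_list \<sigma> (map coord ys)))"
      using assms len by (simp add: inj permute_list_map)
  qed
  also have "\<dots> = form n s (tensor_perm (Hilbert_Choice.inv \<sigma>) t)"
    by (simp add: form_def tensor_perm_def inv_inv_eq permutes_bij[OF assms])
  finally show ?thesis .
qed

lemma form_sym_sum:
  assumes "\<And>\<sigma>. \<sigma> \<in> fibre_perms n c \<Longrightarrow> \<chi> (Hilbert_Choice.inv \<sigma>) = \<chi> \<sigma>"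
  shows "form n (sym_sum \<chi> (fibre_perms n c) s) t = form n s (sym_sum \<chi> (fibre_perms n c) t)"
proof -
  have "form n (sym_sum \<chi> (fibre_perms n c) s) t
      = (\<Sum>\<sigma>\<in>fibre_perms n c. of_int (\<chi> (Hilbert_Choice.inv \<sigma>)) * form n s (tensor_perm (Hilbert_Choice.inv \<sigma>) t))"
    unfolding sym_sum_def form_sum_left
    by (intro sum.cong refl) (simp add: form_simps form_perm fibre_perms_permutes assms)
  also have "\<dots> = (\<Sum>\<sigma>\<in>fibre_perms n c. of_int (\<chi> \<sigma>) * form n s (tensor_perm \<sigma> t))"
    by (rule sum.reindex_bij_betw[OF bij_inv_fibre_perms])
  also have "\<dots> = form n s (sym_sum \<chi> (fibre_perms n c) t)"
    unfolding sym_sum_def form_sum_right by (simp add: form_simps)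
  finally show ?thesis .
qed

lemma alternating_perm:
  assumes "\<tau> \<in> fibre_perms n c" "t \<in> tensors n"
  shows "sym_sum sign (fibre_perms n c) (tensor_perm \<tau> t)
    = fscale (of_int (sign \<tau>)) (sym_sum sign (fibre_perms n c) t)"
proof -
  have "fscale (of_int (sign \<tau>)) (sym_sum sign (fibre_perms n c) t)
      = (\<Sum>\<sigma>\<in>fibre_perms n c. fscale (of_int (sign \<tau>)) (fscale (of_int (sign (\<tau> \<circ> \<sigma>))) (tensor_perm (\<tau> \<circ> \<sigma>) t)))"
    unfolding sym_sum_def fun_space.scale_sum_right
    by (rule sum.reindex_bij_betw[OF bij_comp_fibre_perms[OF assms(1)], symmetric])
  also have "\<dots> = (\<Sum>\<sigma>\<in>fibre_perms n c. fscale (of_int (sign \<sigma>)) (tensor_perm \<sigma> (tensor_perm \<tau> t)))"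
  proof (intro sum.cong refl)
    fix \<sigma> assume s: "\<sigma> \<in> fibre_perms n c"
    have "sign \<tau> * sign (\<tau> \<circ> \<sigma>) = sign \<sigma>"
      using sign_compose[OF fibre_perms_permutation[OF assms(1)] fibre_perms_permutation[OF s]]
      by (auto simp: sign_def split: if_splits)
    then have "complex_of_int (sign \<tau>) * complex_of_int (sign (\<tau> \<circ> \<sigma>)) = complex_of_int (sign \<sigma>)"
      by (metis of_int_mult)
    moreover have "tensor_perm (\<tau> \<circ> \<sigma>) t = tensor_perm \<sigma> (tensor_perm \<tau> t)"
      using assms s by (intro tensor_perm_compose) (auto intro: fibre_perms_permutes)
    ultimately show "fscale (of_int (sign \<tau>)) (fscale (of_int (sign (\<tau> \<circ> \<sigma>))) (tensor_perm (\<tau> \<circ> \<sigma>) t))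
        = fscale (of_int (sign \<sigma>)) (tensor_perm \<sigma> (tensor_perm \<tau> t))"
      by simp
  qed
  finally show ?thesis
    by (simp add: sym_sum_def)
qed

text \<open>
  Each of the summands of the outer antisymmetrization contributes the same tensor, because the
  two signs cancel.
\<close>

lemma alternating_idempotent:
  assumes "t \<in> tensors n"
  shows "sym_sum sign (fibre_perms n c) (sym_sum sign (fibre_perms n c) t)
    = fscale (of_nat (card (fibre_perms n c))) (sym_sum sign (fibre_perms n c) t)"
proof -
  let ?S = "sym_sum sign (fibre_perms n c)"
  have "?S (?S t) = (\<Sum>\<tau>\<in>fibre_perms n c. fscale (of_int (sign \<tau>)) (?S (tensor_perm \<tau> t)))"
    unfolding sym_sum_def[of _ _ t] by (simp only: sym_sum_sum sym_sum_simps)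
  also have "\<dots> = (\<Sum>\<tau>\<in>fibre_perms n c. ?S t)"
    by (intro sum.cong refl) (simp add: alternating_perm[OF _ assms] sign_def)
  also have "\<dots> = fscale (of_nat (card (fibre_perms n c))) (?S t)"
    by (simp add: fun_eq_iff pointwise)
  finally show ?thesis .
qed

text \<open>
  Write \<open>x = C (R t)\<close> with the row symmetrization \<open>R\<close> and the column antisymmetrization \<open>C\<close>. By
  polarization \<open>R x = 0\<close>. Both operators are self-adjoint and \<open>C x\<close> is a multiple of \<open>x\<close>, so
  \<open>\<langle>x, x\<rangle> = \<langle>R t, C x\<rangle>\<close> is a multiple of \<open>\<langle>R t, x\<rangle> = \<langle>t, R x\<rangle> = 0\<close>.
\<close>

lemma schur_module_detected_by_row_constant:
  assumes "x \<in> schur_module scale \<nu>"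
    and van: "\<And>\<theta>. (\<And>i. \<theta> i \<in> dual scale) \<Longrightarrow>
      x (map (\<lambda>p. \<theta> (fst (boxes \<nu> ! p))) [0..<sum_list \<nu>]) = 0"
  shows "x = 0"
proof -
  let ?n = "sum_list \<nu>"
  let ?R = "sym_sum (\<lambda>_. 1) (row_group \<nu>)" and ?C = "sym_sum sign (column_group \<nu>)"
  obtain t where t: "t \<in> tensors ?n" "x = ?C (?R t)"
    using assms(1) by (auto simp: schur_module_def young_symmetrizer_eq)
  have Rt: "?R t \<in> tensors ?n" and x: "x \<in> tensors ?n"
    using t assms(1) schur_subset by (auto simp: row_group_fibre sym_sum_in)
  have Rx: "?R x = 0"
    unfolding row_group_fibre using van by (intro sym_sum_eq_0_if_vanishes_on_constant[OF x]) auto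
  have "form ?n x x = form ?n (?R t) (?C x)"
    by (subst t(2), unfold column_group_fibre, rule form_sym_sum)
       (simp add: sign_inverse fibre_perms_permutation)
  also have "?C x = fscale (of_nat (card (column_group \<nu>))) x"
    using alternating_idempotent[OF Rt] unfolding t(2) column_group_fibre .
  also have "form ?n (?R t) (fscale (of_nat (card (column_group \<nu>))) x) = of_nat (card (column_group \<nu>)) * form ?n (?R t) x"
    by (simp add: form_simps)
  also have "form ?n (?R t) x = form ?n t (?R x)"
    unfolding row_group_fibre by (rule form_sym_sum) simp
  finally have "form ?n x x = 0"
    by (simp add: Rx form_simps)
  then show ?thesis
    by (rule form_definite[OF x])
qed

end


section \<open>Weights and the highest coordinate\<close>

lemma words_nth: "xs \<in> words d n \<Longrightarrow> p < n \<Longrightarrow> xs ! p < d"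
  by (fastforce simp: words_def dest: nth_mem)

text \<open>
  The tableau whose row \<open>i\<close> is filled with \<open>i\<close>; it indexes the coordinate of highest weight.
\<close>

definition row_word :: "nat list \<Rightarrow> nat list" where
  "row_word \<nu> = map fst (boxes \<nu>)"

lemma length_boxes [simp]: "length (boxes \<nu>) = sum_list \<nu>"
  by (simp add: boxes_def length_concat comp_def map_nth)

lemma set_boxes: "set (boxes \<nu>) = {(i, c). i < length \<nu> \<and> c < \<nu> ! i}"
  by (auto simp: boxes_def)

lemma distinct_boxes: "distinct (boxes \<nu>)"
proof -
  have "distinct (concat (map (\<lambda>i. map (\<lambda>c. (i, c)) [0..<\<nu> ! i]) [0..<n]))" for n
    by (induction n) (auto simp: distinct_map inj_on_def)
  then show ?thesis
    by (simp add: boxes_def)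
qed

lemma row_word_in_words: "row_word \<nu> \<in> words (length \<nu>) (sum_list \<nu>)"
  using set_boxes[of \<nu>] by (auto simp: row_word_def words_def)

lemma wt_row_word: "wt l (row_word \<nu>) = (\<Sum>i=l..<length \<nu>. \<nu> ! i)"
proof -
  have "length (filter (\<lambda>x. l \<le> fst x) (concat (map (\<lambda>i. map (\<lambda>c. (i, c)) [0..<f i]) [0..<n])))
      = (\<Sum>i=l..<n. f i)" for f :: "nat \<Rightarrow> nat" and n
    by (induction n) (auto simp: filter_map comp_def sum.atLeastLessThan_Suc not_le)
  then show ?thesis
    by (simp add: wt_def row_word_def boxes_def filter_map comp_def)
qed

lemma wt_permute_list: "\<sigma> permutes {..<length xs} \<Longrightarrow> wt l (permute_list \<sigma> xs) = wt l xs"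
  unfolding wt_def by (metis mset_filter mset_permute_list size_mset)

lemma column_card:
  "card {p. p < sum_list \<nu> \<and> snd (boxes \<nu> ! p) = c} = card {i. i < length \<nu> \<and> c < \<nu> ! i}"
proof -
  have inj: "inj_on ((!) (boxes \<nu>)) {..<sum_list \<nu>}"
    using distinct_boxes[of \<nu>] by (auto simp: inj_on_def nth_eq_iff_index_eq)
  have "(!) (boxes \<nu>) ` {p. p < sum_list \<nu> \<and> snd (boxes \<nu> ! p) = c} = {x \<in> set (boxes \<nu>). snd x = c}"
    by (force simp: in_set_conv_nth)
  also have "\<dots> = (\<lambda>i. (i, c)) ` {i. i < length \<nu> \<and> c < \<nu> ! i}"
    by (auto simp: set_boxes)
  finally have eq: "(!) (boxes \<nu>) ` {p. p < sum_list \<nu> \<and> snd (boxes \<nu> ! p) = c}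
      = (\<lambda>i. (i, c)) ` {i. i < length \<nu> \<and> c < \<nu> ! i}" .
  have "card ((!) (boxes \<nu>) ` {p. p < sum_list \<nu> \<and> snd (boxes \<nu> ! p) = c})
      = card {p. p < sum_list \<nu> \<and> snd (boxes \<nu> ! p) = c}"
    by (intro card_image inj_on_subset[OF inj]) auto
  moreover have "card ((\<lambda>i. (i, c)) ` {i. i < length \<nu> \<and> c < \<nu> ! i}) = card {i. i < length \<nu> \<and> c < \<nu> ! i}"
    by (intro card_image) (auto simp: inj_on_def)
  ultimately show ?thesis
    using eq by simp
qed

text \<open>
  Only \<open>l\<close> different entries are below \<open>l\<close>, so a column of length \<open>c\<close> with distinct entries has at
  least \<open>c - l\<close> entries that count for the weight; different columns occupy different positions.
\<close>

lemma wt_ge_columns: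
  assumes "length ys = sum_list \<nu>" "finite Cs"
    and inj: "\<And>c. inj_on ((!) ys) {p. p < sum_list \<nu> \<and> snd (boxes \<nu> ! p) = c}"
  shows "(\<Sum>c\<in>Cs. card {i. i < length \<nu> \<and> c < \<nu> ! i} - l) \<le> wt l ys"
proof -
  let ?P = "\<lambda>c. {p. p < sum_list \<nu> \<and> snd (boxes \<nu> ! p) = c}"
  let ?Q = "\<lambda>c. {p \<in> ?P c. l \<le> ys ! p}"
  have "card (?P c) - l \<le> card (?Q c)" for c
  proof -
    have "card (?P c - ?Q c) \<le> card {..<l}"
      by (rule card_inj_on_le[of "(!) ys"]) (auto intro: inj_on_subset[OF inj])
    moreover have "card (?P c - ?Q c) = card (?P c) - card (?Q c)"
      by (intro card_Diff_subset) auto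
    ultimately show ?thesis by simp
  qed
  then have "(\<Sum>c\<in>Cs. card (?P c) - l) \<le> (\<Sum>c\<in>Cs. card (?Q c))"
    by (rule sum_mono)
  also have "\<dots> = card (\<Union>c\<in>Cs. ?Q c)"
    using assms(2) by (intro card_UN_disjoint[symmetric]) auto
  also have "\<dots> \<le> card {p. p < length ys \<and> l \<le> ys ! p}"
    using assms(1) by (intro card_mono) auto
  also have "\<dots> = wt l ys"
    by (simp add: wt_def length_filter_conv_card)
  finally show ?thesis
    by (simp add: column_card)
qed

context coordinate_space
begin

lemma vec_eqI: "(\<And>i. i < d \<Longrightarrow> coord i v = coord i w) \<Longrightarrow> v = w"
  using coord_expand[of v] coord_expand[of w] by simp

definition from_coords :: "(nat \<Rightarrow> 'v \<Rightarrow> complex) \<Rightarrow> 'v \<Rightarrow> 'v" where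
  "from_coords \<theta> v = (\<Sum>i<d. scale (\<theta> i v) (e i))"

lemma coord_from_coords: "i < d \<Longrightarrow> coord i (from_coords \<theta> v) = \<theta> i v"
  by (simp add: from_coords_def coord_sum_e)

lemma from_coords_linear:
  assumes "\<And>i. i < d \<Longrightarrow> \<theta> i \<in> dual scale"
  shows "from_coords \<theta> (v + w) = from_coords \<theta> v + from_coords \<theta> w"
    "from_coords \<theta> (scale c v) = scale c (from_coords \<theta> v)"
  by (rule vec_eqI, simp add: coord_from_coords dual_add[OF coord_in_dual] dual_add[OF assms])
     (rule vec_eqI, simp add: coord_from_coords dual_scale[OF coord_in_dual] dual_scale[OF assms])

lemma GL_I:
  assumes "\<And>x y. g (x + y) = g x + g y" "\<And>c x. g (scale c x) = scale c (g x)"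
    and "\<And>x. g x = 0 \<Longrightarrow> x = 0"
  shows "g \<in> GL scale"
proof -
  have lin: "Vector_Spaces.linear scale scale g"
    using assms(1,2) vector_space_axioms by (auto simp: Vector_Spaces.linear_iff)
  then have "inj g"
    using assms(3) module_hom.inj_iff_eq_0 by (auto simp: Vector_Spaces.linear_def)
  moreover have "finite_dimensional_vector_space scale (e ` {..<d})"
    by unfold_locales (auto simp: indep_e span_e)
  ultimately have "bij g"
    using finite_dimensional_vector_space.linear_inj_imp_surj[OF _ lin] by (simp add: bij_def)
  then show ?thesis
    using assms by (auto simp: GL_iff)
qed

text \<open>
  Applying \<open>f - u\<close> to a relation removes the eigenvector of the eigenvalue \<open>u\<close> and multiplies the other
  coefficients by nonzero numbers. It follows that \<open>f + s\<close> is invertible for all but finitely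
  many scalars \<open>s\<close>.
\<close>

lemma eigenvectors_independent:
  assumes "finite S" "\<And>x y. f (x + y) = f x + f y" "\<And>c x. f (scale c x) = scale c (f x)"
    "\<And>s. s \<in> S \<Longrightarrow> v s \<noteq> 0 \<and> f (v s) = scale s (v s)"
    "(\<Sum>s\<in>S. scale (a s) (v s)) = 0" "s \<in> S"
  shows "a s = 0"
  using assms(1,4-6)
proof (induction S arbitrary: a s rule: finite_induct)
  case (insert u S)
  have f0: "f 0 = 0"
    using assms(3)[of 0 0] by simp
  have "f (\<Sum>s\<in>insert u S. scale (a s) (v s)) = (\<Sum>s\<in>insert u S. scale (a s * s) (v s))"
    using insert.prems(1) by (subst additive_sum[of f, OF f0 assms(2)]) (auto simp: assms(3) intro!: sum.cong)
  then have "0 = (\<Sum>s\<in>insert u S. scale (a s * s) (v s)) - scale u (\<Sum>s\<in>insert u S. scale (a s) (v s))"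
    using insert.prems(2) f0 by simp
  also have "\<dots> = (\<Sum>s\<in>insert u S. scale (a s * (s - u)) (v s))"
    unfolding scale_sum_right sum_subtractf[symmetric]
    by (intro sum.cong refl) (simp add: right_diff_distrib scale_left_diff_distrib mult.commute)
  also have "\<dots> = (\<Sum>s\<in>S. scale (a s * (s - u)) (v s))"
    using insert.hyps by simp
  finally have "(\<Sum>s\<in>S. scale (a s * (s - u)) (v s)) = 0" by simp
  then have "a s * (s - u) = 0" if "s \<in> S" for s
    using insert.IH[of "\<lambda>s. a s * (s - u)" s] insert.prems(1) that by auto
  then have S: "a s = 0" if "s \<in> S" for s
    using that insert.hyps by auto
  then have "scale (a u) (v u) = 0"
    using insert.prems(2) insert.hyps by simp
  then have "a u = 0"
    using insert.prems(1)[of u] by auto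
  with S insert.prems(3) show ?case by auto
qed simp

lemma finite_eigenvalues:
  assumes "\<And>x y. f (x + y) = f x + f y" "\<And>c x. f (scale c x) = scale c (f x)"
  shows "finite {s. \<exists>v. v \<noteq> 0 \<and> f v = scale s v}"
proof (rule ccontr)
  assume "infinite {s. \<exists>v. v \<noteq> 0 \<and> f v = scale s v}"
  then obtain S where S: "finite S" "card S = Suc d" "S \<subseteq> {s. \<exists>v. v \<noteq> 0 \<and> f v = scale s v}"
    using infinite_arbitrarily_large by blast
  then have "\<forall>s\<in>S. \<exists>v. v \<noteq> 0 \<and> f v = scale s v" by auto
  then obtain v where v: "\<And>s. s \<in> S \<Longrightarrow> v s \<noteq> 0 \<and> f (v s) = scale s (v s)"
    by metis
  note ind = eigenvectors_independent[OF S(1) assms v]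
  have inj: "inj_on v S"
  proof (rule inj_onI)
    fix s s' assume s: "s \<in> S" "s' \<in> S" "v s = v s'"
    then have "scale s (v s) = scale s' (v s)"
      using v by metis
    then show "s = s'"
      using v[OF s(1)] by simp
  qed
  have "independent (v ` S)"
  proof (rule independent_if_scalars_zero)
    fix a x assume "(\<Sum>x\<in>v ` S. scale (a x) x) = 0" "x \<in> v ` S"
    then show "a x = 0"
      using ind[of "a \<circ> v"] by (auto simp: sum.reindex[OF inj])
  qed (use S in simp)
  then have "card (v ` S) \<le> card (e ` {..<d})"
    using independent_span_bound[of "e ` {..<d}" "v ` S"] span_e by simp
  also have "\<dots> \<le> d"
    using card_image_le[of "{..<d}" e] by simp
  finally show False
    using S(2) card_image[OF inj] by simp
qed

lemma poly_along_line:
  assumes "x \<in> tensors n" "length is = n" "\<And>i. \<alpha> i \<in> dual scale" "\<And>i. \<beta> i \<in> dual scale"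
  shows "\<exists>p. \<forall>s. x (map (\<lambda>i v. \<alpha> i v + s * \<beta> i v) is) = poly p s"
proof (rule tensors_induct[OF assms(1)], goal_cases)
  case (1 vs)
  have "set (map (\<lambda>i v. \<alpha> i v + s * \<beta> i v) is) \<subseteq> dual scale" for s
    by (auto intro!: add_in_dual scale_in_dual assms)
  then have "pure_tensor scale vs (map (\<lambda>i v. \<alpha> i v + s * \<beta> i v) is)
      = poly (\<Prod>p<n. [:\<alpha> (is ! p) (vs ! p), \<beta> (is ! p) (vs ! p):]) s" for s
    using 1 assms(2) by (simp add: pure_nth[where n = n] poly_prod)
  then show ?case by blast
next
  case 2
  show ?case by (rule exI[of _ 0]) (simp add: pointwise)
next
  case (3 x y)
  then obtain p q where "\<forall>s. x (map (\<lambda>i v. \<alpha> i v + s * \<beta> i v) is) = poly p s"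
    "\<forall>s. y (map (\<lambda>i v. \<alpha> i v + s * \<beta> i v) is) = poly q s" by blast
  then show ?case by (intro exI[of _ "p + q"]) (simp add: pointwise)
next
  case (4 c x)
  then obtain p where "\<forall>s. x (map (\<lambda>i v. \<alpha> i v + s * \<beta> i v) is) = poly p s" by blast
  then show ?case by (intro exI[of _ "smult c p"]) (simp add: pointwise)
qed

text \<open>
  A row-constant list at which \<open>x\<close> does not vanish is the pullback of the coordinate functions
  along a linear map \<open>f\<close>, which may be singular. Along the line \<open>f + s\<close> the value of \<open>x\<close> is a
  polynomial in \<open>s\<close> that is nonzero at \<open>s = 0\<close>, and \<open>f + s\<close> is invertible for all but finitely
  many \<open>s\<close>.
\<close>

lemma schur_highest_coordinate:
  assumes x: "x \<in> schur_module scale \<nu>" "x \<noteq> 0" and len: "length \<nu> = d"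
  shows "\<exists>g\<in>GL scale. tensor_act g x (map coord (row_word \<nu>)) \<noteq> 0"
proof -
  obtain \<theta> where \<theta>: "\<And>i. \<theta> i \<in> dual scale"
    and nz: "x (map (\<lambda>p. \<theta> (fst (boxes \<nu> ! p))) [0..<sum_list \<nu>]) \<noteq> 0"
    using schur_module_detected_by_row_constant[OF x(1)] x(2) by blast
  have "map (\<lambda>p. \<theta> (fst (boxes \<nu> ! p))) [0..<sum_list \<nu>] = map \<theta> (row_word \<nu>)"
    by (rule nth_equalityI) (simp_all add: row_word_def)
  with nz have nz: "x (map \<theta> (row_word \<nu>)) \<noteq> 0" by simp
  have xt: "x \<in> tensors (sum_list \<nu>)"
    using x(1) schur_subset by blast
  have rw: "set (row_word \<nu>) \<subseteq> {..<d}" "length (row_word \<nu>) = sum_list \<nu>"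
    using row_word_in_words[of \<nu>] len by (auto simp: words_def)
  obtain p where p: "\<And>s. x (map (\<lambda>i v. \<theta> i v + s * coord i v) (row_word \<nu>)) = poly p s"
    using poly_along_line[OF xt rw(2), of \<theta> coord] \<theta> coord_in_dual by blast
  have "p \<noteq> 0"
    using p[of 0] nz by auto
  then have "finite {s. poly p s = 0}"
    by (rule poly_roots_finite)
  moreover let ?f = "from_coords \<theta>"
  have "finite {s. \<exists>v. v \<noteq> 0 \<and> ?f v = scale s v}"
    by (rule finite_eigenvalues) (simp_all add: from_coords_linear \<theta>)
  then have "finite (uminus ` {s. \<exists>v. v \<noteq> 0 \<and> ?f v = scale s v})"
    by simp
  ultimately have "finite ({s. poly p s = 0} \<union> uminus ` {s. \<exists>v. v \<noteq> 0 \<and> ?f v = scale s v})"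
    by blast
  then obtain s where s: "poly p s \<noteq> 0" "s \<notin> uminus ` {s. \<exists>v. v \<noteq> 0 \<and> ?f v = scale s v}"
    using infinite_UNIV_char_0[where 'a = complex] by (metis (mono_tags, lifting) UnCI ex_new_if_finite mem_Collect_eq)
  define g where "g = from_coords (\<lambda>i v. \<theta> i v + s * coord i v)"
  have gd: "(\<lambda>v. \<theta> i v + s * coord i v) \<in> dual scale" for i
    by (intro add_in_dual scale_in_dual \<theta> coord_in_dual)
  have "g \<in> GL scale"
    unfolding g_def
  proof (rule GL_I)
    fix v assume v: "from_coords (\<lambda>i v. \<theta> i v + s * coord i v) v = 0"
    have eig: "?f v = scale (- s) v"
    proof (rule vec_eqI)
      fix i assume i: "i < d"
      have "\<theta> i v + s * coord i v = 0"
        using coord_from_coords[OF i, of "\<lambda>i v. \<theta> i v + s * coord i v" v]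
        by (simp add: v dual_zero[OF coord_in_dual])
      moreover have "coord i (scale (- s) v) = - s * coord i v"
        by (rule dual_scale[OF coord_in_dual])
      ultimately show "coord i (?f v) = coord i (scale (- s) v)"
        using i by (simp only: coord_from_coords) (simp add: eq_neg_iff_add_eq_0)
    qed
    show "v = 0"
    proof (rule ccontr)
      assume "v \<noteq> 0"
      with eig have "- s \<in> {s. \<exists>v. v \<noteq> 0 \<and> ?f v = scale s v}"
        by blast
      from imageI[OF this, of uminus] s(2) show False
        by simp
    qed
  qed (simp_all add: from_coords_linear[OF gd])
  have map_eq: "map (\<lambda>\<phi>. \<phi> \<circ> g) (map coord (row_word \<nu>)) = map (\<lambda>i v. \<theta> i v + s * coord i v) (row_word \<nu>)"
    using rw(1) by (auto simp: fun_eq_iff g_def coord_from_coords)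
  have "tensor_act g x (map coord (row_word \<nu>)) = poly p s"
    unfolding tensor_act_def map_eq p ..
  then have "tensor_act g x (map coord (row_word \<nu>)) \<noteq> 0"
    using s(1) by metis
  then show ?thesis
    using \<open>g \<in> GL scale\<close> by blast
qed

text \<open>
  The diagonal matrix with \<open>l\<close> entries \<open>1\<close> followed by \<open>d - l\<close> entries \<open>t\<close>.
\<close>

definition torus :: "nat \<Rightarrow> complex \<Rightarrow> 'v \<Rightarrow> 'v" where
  "torus l t = from_coords (\<lambda>i v. (if i < l then 1 else t) * coord i v)"

lemma coord_torus: "i < d \<Longrightarrow> coord i (torus l t v) = (if i < l then 1 else t) * coord i v"
  by (simp add: torus_def coord_from_coords)

lemma torus_in_GL:
  assumes "t \<noteq> 0"
  shows "torus l t \<in> GL scale"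
proof (rule GL_I)
  have d: "(\<lambda>v. (if i < l then 1 else t) * coord i v) \<in> dual scale" for i
    by (intro scale_in_dual coord_in_dual)
  show "torus l t (x + y) = torus l t x + torus l t y" "torus l t (scale c x) = scale c (torus l t x)" for x y c
    unfolding torus_def by (rule from_coords_linear[OF d])+
  fix v assume "torus l t v = 0"
  then have "(if i < l then 1 else t) * coord i v = 0" if "i < d" for i
    using coord_torus[OF that, of l t v] by (simp add: dual_zero[OF coord_in_dual])
  moreover have "(if i < l then 1 else t) \<noteq> 0" for i
    using assms by simp
  ultimately have "coord i v = 0" if "i < d" for i
    using that by (metis mult_eq_0_iff)
  then show "v = 0"
    by (intro vec_eqI) (simp add: dual_zero[OF coord_in_dual])
qed

lemma torus_e: "i < d \<Longrightarrow> torus l t (e i) = scale (if i < l then 1 else t) (e i)"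
  by (rule vec_eqI) (auto simp: coord_torus coord_e dual_scale[OF coord_in_dual])

lemma torus_coordinate:
  assumes "y \<in> tensors n" "xs \<in> words d n" "t \<noteq> 0"
  shows "tensor_act (torus l t) y (map coord xs) = t ^ wt l xs * y (map coord xs)"
  using assms(1)
proof (rule tensors_linear_induct, goal_cases)
  case (1 vs)
  have xs: "length xs = n" "\<And>p. p < n \<Longrightarrow> xs ! p < d"
    using assms(2) words_nth by (auto simp: words_def)
  have "tensor_act (torus l t) (pure_tensor scale vs) (map coord xs)
      = (\<Prod>p<n. coord (xs ! p) (torus l t (vs ! p)))"
    using 1 xs coords_dual by (simp add: tensor_act_pure[OF torus_in_GL[OF assms(3)]] pure_nth[where n = n])
  also have "\<dots> = (\<Prod>p<n. (if xs ! p < l then 1 else t) * coord (xs ! p) (vs ! p))"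
    using xs by (intro prod.cong refl coord_torus) auto
  also have "\<dots> = t ^ wt l xs * (\<Prod>p<n. coord (xs ! p) (vs ! p))"
    using prod_wt[of xs l t] xs(1) by (simp add: prod.distrib)
  also have "(\<Prod>p<n. coord (xs ! p) (vs ! p)) = pure_tensor scale vs (map coord xs)"
    using 1 xs coords_dual by (simp add: pure_nth[where n = n])
  finally show ?case .
qed (simp_all only: tensor_act_simps, simp_all add: pointwise algebra_simps)

lemma torus_word_tensor:
  assumes "xs \<in> words d n" "t \<noteq> 0"
  shows "tensor_act (torus l t) (word_tensor xs) = fscale (t ^ wt l xs) (word_tensor xs)"
proof
  fix \<phi>s
  have xs: "length xs = n" "\<And>p. p < n \<Longrightarrow> xs ! p < d"
    using assms(1) words_nth by (auto simp: words_def)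
  show "tensor_act (torus l t) (word_tensor xs) \<phi>s = fscale (t ^ wt l xs) (word_tensor xs) \<phi>s"
  proof (cases "length \<phi>s = n \<and> set \<phi>s \<subseteq> dual scale")
    case True
    then have d: "\<phi>s ! p \<in> dual scale" if "p < n" for p
      using that by (auto dest: nth_mem)
    have "tensor_act (torus l t) (word_tensor xs) \<phi>s = (\<Prod>p<n. (\<phi>s ! p) (torus l t (e (xs ! p))))"
      using True xs by (simp add: word_tensor_def tensor_act_pure[OF torus_in_GL[OF assms(2)]] pure_nth[where n = n])
    also have "\<dots> = (\<Prod>p<n. (if xs ! p < l then 1 else t) * (\<phi>s ! p) (e (xs ! p)))"
      using xs by (intro prod.cong refl) (simp add: torus_e dual_scale[OF d])
    also have "\<dots> = t ^ wt l xs * (\<Prod>p<n. (\<phi>s ! p) (e (xs ! p)))"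
      using prod_wt[of xs l t] xs(1) by (simp add: prod.distrib)
    finally show ?thesis
      using True xs by (simp add: word_tensor_def pure_nth[where n = n] pointwise)
  next
    case False
    have w: "word_tensor xs \<in> tensors n"
      using xs(1) by (rule word_tensor_in)
    show ?thesis
      using False tensors_support[OF w] tensors_support[OF tensor_act_in[OF torus_in_GL[OF assms(2)] w]]
      by (auto simp: pointwise)
  qed
qed

lemma torus_young_word:
  assumes "xs \<in> words d (sum_list \<nu>)" "t \<noteq> 0"
  shows "tensor_act (torus l t) (young_symmetrizer \<nu> (word_tensor xs))
    = fscale (t ^ wt l xs) (young_symmetrizer \<nu> (word_tensor xs))"
proof -
  have w: "word_tensor xs \<in> tensors (sum_list \<nu>)"
    using assms(1) by (simp add: words_def word_tensor_in)
  show ?thesis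
    using young_symmetrizer_act[OF torus_in_GL[OF assms(2)] w, of l] torus_word_tensor[OF assms]
    by (simp add: young_symmetrizer_simps(2)[OF w])
qed

text \<open>
  The transposition of the positions \<open>p\<close> and \<open>q\<close> fixes the tensor and has sign \<open>- 1\<close>.
\<close>

lemma alternating_repeated_entry:
  assumes "length ys = n" "p < n" "q < n" "p \<noteq> q" "c p = c q" "ys ! p = ys ! q"
  shows "sym_sum sign (fibre_perms n c) (word_tensor ys) = 0"
proof -
  let ?\<tau> = "Transposition.transpose p q"
  have perm: "?\<tau> permutes {..<n}"
    using assms by (intro permutes_swap_id) auto
  have mem: "?\<tau> \<in> fibre_perms n c"
    using perm assms(5) by (auto simp: fibre_perms_def Transposition.transpose_def)
  have "permute_list ?\<tau> ys = ys"
    using perm assms by (intro nth_equalityI) (auto simp: permute_list_nth Transposition.transpose_def)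
  then have "tensor_perm ?\<tau> (word_tensor ys) = word_tensor ys"
    using perm assms(1) by (simp add: word_tensor_def tensor_perm_pure permute_list_map)
  then have "sym_sum sign (fibre_perms n c) (word_tensor ys)
      = fscale (of_int (sign ?\<tau>)) (sym_sum sign (fibre_perms n c) (word_tensor ys))"
    using alternating_perm[OF mem word_tensor_in[OF assms(1)]] by simp
  then show ?thesis
    using assms(4) by (auto simp: sign_swap_id fun_eq_iff pointwise)
qed

text \<open>
  If the image of the basis tensor is nonzero, then so is the antisymmetrization of one of the
  summands of its row symmetrization; that summand has no repeated entry in any column, and it has
  the weight of \<open>xs\<close>.
\<close>

lemma young_word_weight:
  assumes "xs \<in> words d (sum_list \<nu>)" "young_symmetrizer \<nu> (word_tensor xs) \<noteq> 0" "finite Cs"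
  shows "(\<Sum>c\<in>Cs. card {i. i < length \<nu> \<and> c < \<nu> ! i} - l) \<le> wt l xs"
proof -
  let ?n = "sum_list \<nu>" and ?C = "sym_sum sign (column_group \<nu>)"
  have len: "length xs = ?n"
    using assms(1) by (simp add: words_def)
  have "young_symmetrizer \<nu> (word_tensor xs) = (\<Sum>\<sigma>\<in>row_group \<nu>. ?C (tensor_perm \<sigma> (word_tensor xs)))"
    unfolding young_symmetrizer_eq[OF word_tensor_in[OF len]] sym_sum_def[of "\<lambda>_. 1"]
    by (simp add: sym_sum_sum)
  also have "\<dots> = 0" if "\<And>\<sigma>. \<sigma> \<in> row_group \<nu> \<Longrightarrow> ?C (tensor_perm \<sigma> (word_tensor xs)) = 0"
    using that by simp
  finally obtain \<sigma> where s: "\<sigma> \<in> row_group \<nu>" "?C (tensor_perm \<sigma> (word_tensor xs)) \<noteq> 0"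
    using assms(2) by blast
  have perm: "\<sigma> permutes {..<?n}"
    using s(1) by (simp add: row_group_fibre fibre_perms_permutes)
  have eq: "tensor_perm \<sigma> (word_tensor xs) = word_tensor (permute_list \<sigma> xs)"
    using perm len by (simp add: word_tensor_def tensor_perm_pure permute_list_map)
  have "(\<Sum>c\<in>Cs. card {i. i < length \<nu> \<and> c < \<nu> ! i} - l) \<le> wt l (permute_list \<sigma> xs)"
  proof (rule wt_ge_columns)
    fix c
    show "inj_on ((!) (permute_list \<sigma> xs)) {p. p < sum_list \<nu> \<and> snd (boxes \<nu> ! p) = c}"
    proof (rule inj_onI, rule ccontr)
      fix p q
      assume pq: "p \<in> {p. p < sum_list \<nu> \<and> snd (boxes \<nu> ! p) = c}"
        "q \<in> {p. p < sum_list \<nu> \<and> snd (boxes \<nu> ! p) = c}"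
        "permute_list \<sigma> xs ! p = permute_list \<sigma> xs ! q" "p \<noteq> q"
      then have "?C (word_tensor (permute_list \<sigma> xs)) = 0"
        unfolding column_group_fibre using len
        by (intro alternating_repeated_entry[of _ _ p q]) auto
      then show False
        using s(2) eq by simp
    qed
  qed (use len assms(3) in auto)
  then show ?thesis
    using perm len by (simp add: wt_permute_list)
qed

end


section \<open>The symmetric algebra and the Hilbert function\<close>

lemma fdual_iff:
  "\<psi> \<in> dual fscale \<longleftrightarrow> (\<forall>x y. \<psi> (x + y) = \<psi> x + \<psi> y) \<and> (\<forall>c x. \<psi> (fscale c x) = c * \<psi> x)"
proof -
  have "vector_space ((*) :: complex \<Rightarrow> complex \<Rightarrow> complex)"
    by unfold_locales (simp_all add: algebra_simps)
  then show ?thesis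
    using fun_space.vector_space_axioms by (auto simp: dual_def Vector_Spaces.linear_iff)
qed

lemma fdual_add: "\<psi> \<in> dual fscale \<Longrightarrow> \<psi> (x + y) = \<psi> x + \<psi> y"
  and fdual_scale: "\<psi> \<in> dual fscale \<Longrightarrow> \<psi> (fscale c x) = c * \<psi> x"
  by (simp_all add: fdual_iff)

lemma fdual_zero: "\<psi> \<in> dual fscale \<Longrightarrow> \<psi> 0 = 0"
  using fdual_scale[of \<psi> 0 0] by simp

lemma fscale_mult: "fscale c F * G = fscale c (F * G)" "F * fscale c G = fscale c (F * G)"
  by (simp_all add: fun_eq_iff pointwise)

lemma span_mult:
  fixes A B C :: "('x \<Rightarrow> complex) set"
  assumes F: "F \<in> fun_space.span A" and G: "G \<in> fun_space.span B"
    and gen: "\<And>a b. a \<in> A \<Longrightarrow> b \<in> B \<Longrightarrow> a * b \<in> fun_space.span C"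
  shows "F * G \<in> fun_space.span C"
proof -
  have "a * G \<in> fun_space.span C" if a: "a \<in> A" for a
    by (rule fspan_induct[OF G, of "\<lambda>G. a * G \<in> fun_space.span C"])
       (simp_all add: gen[OF a] distrib_left fscale_mult fun_space.span_zero fun_space.span_add fun_space.span_scale)
  then show ?thesis
    by (intro fspan_induct[OF F, of "\<lambda>F. F * G \<in> fun_space.span C"])
       (simp_all add: distrib_right fscale_mult fun_space.span_zero fun_space.span_add fun_space.span_scale)
qed

definition monomials :: "('x \<Rightarrow> complex) set \<Rightarrow> nat \<Rightarrow> 'x sym set" where
  "monomials B r = {prod_list (map sym_gen ws) | ws. length ws = r \<and> set ws \<subseteq> B}"

lemma sym_power_monomials: "sym_power W r = fun_space.span (monomials W r)"
  by (simp add: sym_power_def monomials_def)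

lemma finite_monomials: "finite B \<Longrightarrow> finite (monomials B r)"
proof -
  assume "finite B"
  then have "finite {ws. set ws \<subseteq> B \<and> length ws = r}"
    by (rule finite_lists_length_eq)
  moreover have "monomials B r = (\<lambda>ws. prod_list (map sym_gen ws)) ` {ws. set ws \<subseteq> B \<and> length ws = r}"
    by (auto simp: monomials_def)
  ultimately show ?thesis by simp
qed

lemma monomialsI: "length ws = r \<Longrightarrow> set ws \<subseteq> B \<Longrightarrow> prod_list (map sym_gen ws) \<in> monomials B r"
  by (auto simp: monomials_def)

lemma monomialsE:
  assumes "F \<in> monomials B r"
  obtains ws where "F = prod_list (map sym_gen ws)" "length ws = r" "set ws \<subseteq> B"
  using assms unfolding monomials_def by blast

lemma sym_power_mult:
  assumes "F \<in> sym_power W r" "G \<in> sym_power W s"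
  shows "F * G \<in> sym_power W (r + s)"
proof -
  have "a * b \<in> monomials W (r + s)" if a: "a \<in> monomials W r" and b: "b \<in> monomials W s" for a b
  proof -
    obtain vs where "a = prod_list (map sym_gen vs)" "length vs = r" "set vs \<subseteq> W"
      using a by (rule monomialsE)
    moreover obtain ws where "b = prod_list (map sym_gen ws)" "length ws = s" "set ws \<subseteq> W"
      using b by (rule monomialsE)
    ultimately show ?thesis
      using monomialsI[of "vs @ ws" "r + s" W] by simp
  qed
  then show ?thesis
    using assms unfolding sym_power_monomials by (blast intro: span_mult fun_space.span_base)
qed

lemma sym_gen_simps:
  "sym_gen (v + w) = sym_gen v + sym_gen w" "sym_gen (fscale c v) = fscale c (sym_gen v)" "sym_gen 0 = 0"
  by (auto simp: sym_gen_def fun_eq_iff pointwise fdual_zero fdual_add fdual_scale)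

text \<open>
  With a finite spanning set of weight vectors as \<open>B\<close>, this provides both finite dimension and a
  weight decomposition of the symmetric powers.
\<close>

lemma sym_power_span: "sym_power (fun_space.span B) r = fun_space.span (monomials B r)"
proof
  have gen: "sym_gen w \<in> fun_space.span (sym_gen ` B)" if "w \<in> fun_space.span B" for w
    by (rule fspan_induct[OF that])
       (simp_all add: sym_gen_simps fun_space.span_base fun_space.span_zero fun_space.span_add fun_space.span_scale)
  have "prod_list (map sym_gen ws) \<in> fun_space.span (monomials B (length ws))"
    if "set ws \<subseteq> fun_space.span B" for ws
    using that
  proof (induction ws)
    case Nil
    then show ?case using monomialsI[of "[]" 0 B] by (simp add: fun_space.span_base)
  next
    case (Cons w ws)
    have "sym_gen w * prod_list (map sym_gen ws) \<in> fun_space.span (monomials B (Suc (length ws)))"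
    proof (rule span_mult)
      fix a b assume ab: "a \<in> sym_gen ` B" "b \<in> monomials B (length ws)"
      from ab(1) obtain v where "a = sym_gen v" "v \<in> B"
        by blast
      moreover obtain vs where "b = prod_list (map sym_gen vs)" "length vs = length ws" "set vs \<subseteq> B"
        using ab(2) by (rule monomialsE)
      ultimately show "a * b \<in> fun_space.span (monomials B (Suc (length ws)))"
        using monomialsI[of "v # vs" "Suc (length ws)" B] by (simp add: fun_space.span_base)
    qed (use Cons gen in auto)
    then show ?case by simp
  qed
  then show "sym_power (fun_space.span B) r \<subseteq> fun_space.span (monomials B r)"
    unfolding sym_power_monomials
    by (intro fun_space.span_minimal fun_space.subspace_span) (auto simp: monomials_def)
  show "fun_space.span (monomials B r) \<subseteq> sym_power (fun_space.span B) r"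
    unfolding sym_power_monomials
    by (intro fun_space.span_mono) (use fun_space.span_superset[of B] in \<open>auto simp: monomials_def\<close>)
qed

lemma sym_power_subspace: "fun_space.subspace (sym_power W r)"
  by (simp add: sym_power_def)

lemma carrier_sym_algebra: "carrier (sym_algebra W) = fun_space.span (\<Union>r. sym_power W r)"
  and sym_algebra_ops [simp]: "mult (sym_algebra W) = (*)" "one (sym_algebra W) = 1"
    "zero (sym_algebra W) = 0" "add (sym_algebra W) = (+)"
  by (simp_all add: sym_algebra_def)

lemma sym_power_subset_carrier: "sym_power W r \<subseteq> carrier (sym_algebra W)"
  unfolding carrier_sym_algebra by (rule order_trans[OF _ fun_space.span_superset]) auto

lemma const_in_sym_algebra: "fscale c 1 \<in> carrier (sym_algebra W)"
proof -
  have "1 \<in> sym_power W 0"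
    unfolding sym_power_monomials using monomialsI[of "[]" 0 W] by (simp add: fun_space.span_base)
  then show ?thesis
    unfolding carrier_sym_algebra by (intro fun_space.span_scale fun_space.span_base) auto
qed

lemma sym_algebra_mult_closed:
  assumes "F \<in> carrier (sym_algebra W)" "G \<in> carrier (sym_algebra W)"
  shows "F * G \<in> carrier (sym_algebra W)"
  using assms unfolding carrier_sym_algebra
proof (rule span_mult)
  fix a b assume "a \<in> (\<Union>r. sym_power W r)" "b \<in> (\<Union>r. sym_power W r)"
  then obtain r s where "a \<in> sym_power W r" "b \<in> sym_power W s"
    by auto
  then have "a * b \<in> sym_power W (r + s)"
    by (rule sym_power_mult)
  then show "a * b \<in> fun_space.span (\<Union>r. sym_power W r)"
    by (intro fun_space.span_base) auto
qed

lemma sym_algebra_cring: "cring (sym_algebra W)"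
proof (rule cringI)
  have uminus: "- F \<in> carrier (sym_algebra W)" if "F \<in> carrier (sym_algebra W)" for F
    using that unfolding carrier_sym_algebra by (rule fun_space.span_neg)
  show "abelian_group (sym_algebra W)"
  proof (rule abelian_groupI)
    fix F assume "F \<in> carrier (sym_algebra W)"
    then show "\<exists>y\<in>carrier (sym_algebra W). y \<oplus>\<^bsub>sym_algebra W\<^esub> F = \<zero>\<^bsub>sym_algebra W\<^esub>"
      by (intro bexI[of _ "- F"]) (simp_all add: uminus)
  qed (auto simp: carrier_sym_algebra add.assoc add.commute fun_space.span_zero intro: fun_space.span_add)
  show "Group.comm_monoid (sym_algebra W)"
    using const_in_sym_algebra[of 1 W]
    by (intro comm_monoidI) (auto simp: sym_algebra_mult_closed mult.assoc mult.commute)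
qed (auto simp: distrib_right)

definition lin_comb :: "complex list \<Rightarrow> ('x \<Rightarrow> complex) list \<Rightarrow> 'x \<Rightarrow> complex" where
  "lin_comb cs us = sum_list (map2 fscale cs us)"

lemma lin_comb_in_span: "lin_comb cs us \<in> fun_space.span (set us)"
proof (induction us arbitrary: cs)
  case Nil
  then show ?case by (simp add: lin_comb_def fun_space.span_zero)
next
  case (Cons u us)
  show ?case
  proof (cases cs)
    case Nil
    then show ?thesis by (simp add: lin_comb_def fun_space.span_zero)
  next
    case c: (Cons c cs')
    have "lin_comb cs' us \<in> fun_space.span (set (u # us))"
      using Cons.IH fun_space.span_mono[of "set us" "set (u # us)"] by auto
    moreover have "lin_comb cs (u # us) = fscale c u + lin_comb cs' us"
      by (simp add: c lin_comb_def)
    ultimately show ?thesis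
      by (simp add: fun_space.span_add fun_space.span_scale fun_space.span_base)
  qed
qed

lemma span_lin_comb:
  assumes "distinct us" "F \<in> fun_space.span (set us)"
  obtains cs where "length cs = length us" "F = lin_comb cs us"
proof -
  obtain a where "F = (\<Sum>u\<in>set us. fscale (a u) u)"
    using assms(2) fun_space.span_finite[of "set us"] by auto
  also have "\<dots> = lin_comb (map a us) us"
    using assms(1) by (simp add: lin_comb_def zip_map1 comp_def zip_same_conv_map sum_list_distinct_conv_sum_set)
  finally show ?thesis
    using that by (metis length_map)
qed

lemma ideal_subspace:
  assumes "ideal I (sym_algebra W)"
  shows "fun_space.subspace I"
proof -
  interpret ideal I "sym_algebra W" by fact
  show ?thesis
    unfolding fun_space.subspace_def
  proof (intro conjI ballI allI)
    show "0 \<in> I" using additive_subgroup.zero_closed[OF is_additive_subgroup] by simp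
    show "x + y \<in> I" if "x \<in> I" "y \<in> I" for x y using additive_subgroup.a_closed[OF is_additive_subgroup that] by simp
    show "fscale c x \<in> I" if "x \<in> I" for c x
      using I_l_closed[OF that const_in_sym_algebra[of c]] by (simp add: fscale_mult)
  qed
qed

text \<open>
  A basis of \<open>sym_power W r \<inter> I\<close> extends to a basis of \<open>sym_power W r\<close>, and the vectors that
  have been added map to a basis of the degree \<open>r\<close> component of the quotient. For a proper ideal
  the image of the constants is a field, so that this component has a well-defined dimension over it.
\<close>

lemma hilbert_function_eq:
  fixes W :: "('x \<Rightarrow> complex) set" and J :: "'x sym set"
  defines "I \<equiv> genideal (sym_algebra W) J"
  assumes J: "J \<subseteq> carrier (sym_algebra W)" and one: "1 \<notin> I"
    and fin: "finite B" "sym_power W r \<subseteq> fun_space.span B"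
  shows "hilbert_function W J r + fun_space.dim (sym_power W r \<inter> I) = fun_space.dim (sym_power W r)"
proof -
  define R where "R = sym_algebra W"
  define S where "S = sym_power W r"
  interpret R: cring R unfolding R_def by (rule sym_algebra_cring)
  interpret I: ideal I R
    unfolding I_def R_def using R.genideal_ideal J unfolding R_def by blast
  define h where "h = (\<lambda>F. I +>\<^bsub>R\<^esub> F)"
  interpret h: ring_hom_ring R "R Quot I" h
    unfolding h_def using I.rcos_ring_hom_ring .
  have ops: "mult R = (*)" "one R = 1" "zero R = 0" "add R = (+)"
    by (simp_all add: R_def)
  have subI: "fun_space.subspace I"
    using ideal_subspace I.ideal_axioms unfolding R_def .
  have subS: "fun_space.subspace S" and SR: "S \<subseteq> carrier R"
    unfolding S_def R_def by (rule sym_power_subspace, rule sym_power_subset_carrier)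
  have carr_add: "F + G \<in> carrier R" if "F \<in> carrier R" "G \<in> carrier R" for F G
    using R.a_closed[OF that] by (simp add: ops)
  have carr_const: "fscale c 1 \<in> carrier R" for c
    unfolding R_def by (rule const_in_sym_algebra)
  have h_zero_iff: "h F = \<zero>\<^bsub>R Quot I\<^esub> \<longleftrightarrow> F \<in> I" if "F \<in> carrier R" for F
    using I.rcos_const_imp_mem[OF that] R.a_rcos_zero[OF I.ideal_axioms]
    by (auto simp: h_def FactRing_def)
  have h_eq: "F - G \<in> I" if "h F = h G" "F \<in> carrier R" "G \<in> carrier R" for F G
  proof -
    have "\<ominus>\<^bsub>R\<^esub> G = - G"
      using R.minus_equality[of "- G" G] that(3) fun_space.span_neg[of G]
      by (simp add: ops R_def carrier_sym_algebra)
    then have mG: "- G \<in> carrier R" using R.a_inv_closed[OF that(3)] by simp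
    have "h (F \<oplus>\<^bsub>R\<^esub> \<ominus>\<^bsub>R\<^esub> G) = \<zero>\<^bsub>R Quot I\<^esub>"
      using that by (simp add: h.S.r_neg)
    then have "h (F + - G) = \<zero>\<^bsub>R Quot I\<^esub>"
      by (simp add: ops \<open>\<ominus>\<^bsub>R\<^esub> G = - G\<close>)
    then show ?thesis
      using h_zero_iff[OF carr_add[OF that(2) mG]] by simp
  qed
  define K where "K = h ` range (\<lambda>c. fscale c 1)"
  have "subfield (range (\<lambda>c. fscale c 1)) R"
  proof (rule R.subfieldI)
    show "subcring (range (\<lambda>c. fscale c 1)) R"
    proof (rule R.subcringI'[OF R.subringI])
      show "range (\<lambda>c. fscale c 1) \<subseteq> carrier R"
        using carr_const by auto
      show "\<one>\<^bsub>R\<^esub> \<in> range (\<lambda>c. fscale c 1)"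
        by (auto simp: ops intro!: range_eqI[of _ _ 1])
      fix F G assume F: "F \<in> range (\<lambda>c. fscale c (1 :: 'x sym))" and G: "G \<in> range (\<lambda>c. fscale c (1 :: 'x sym))"
      from F obtain a where a: "F = fscale a 1" by auto
      from G obtain b where b: "G = fscale b 1" by auto
      show "F \<otimes>\<^bsub>R\<^esub> G \<in> range (\<lambda>c. fscale c 1)"
        by (rule range_eqI[of _ _ "a * b"]) (simp add: ops a b fun_eq_iff pointwise)
      show "F \<oplus>\<^bsub>R\<^esub> G \<in> range (\<lambda>c. fscale c 1)"
        by (rule range_eqI[of _ _ "a + b"]) (simp add: ops a b fun_eq_iff pointwise)
      have "fscale (- a) 1 \<oplus>\<^bsub>R\<^esub> F = \<zero>\<^bsub>R\<^esub>"
        by (simp add: ops a fun_eq_iff pointwise)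
      then have "\<ominus>\<^bsub>R\<^esub> F = fscale (- a) 1"
        using R.minus_equality carr_const a by blast
      then show "\<ominus>\<^bsub>R\<^esub> F \<in> range (\<lambda>c. fscale c 1)"
        by (rule range_eqI)
    qed
    have nz: "fscale c (1 :: 'x sym) = 0 \<longleftrightarrow> c = 0" for c
      by (auto simp: fun_eq_iff pointwise)
    show "Units (R\<lparr>carrier := range (\<lambda>c. fscale c 1)\<rparr>) = range (\<lambda>c. fscale c 1) - {\<zero>\<^bsub>R\<^esub>}"
    proof (intro equalityI subsetI)
      fix F assume "F \<in> Units (R\<lparr>carrier := range (\<lambda>c. fscale c 1)\<rparr>)"
      then show "F \<in> range (\<lambda>c. fscale c 1) - {\<zero>\<^bsub>R\<^esub>}"
        by (auto simp: Units_def ops)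
    next
      fix F assume "F \<in> range (\<lambda>c. fscale c (1 :: 'x sym)) - {\<zero>\<^bsub>R\<^esub>}"
      then obtain c where c: "F = fscale c 1" "c \<noteq> 0" by (auto simp: ops)
      then have "fscale (inverse c) 1 * F = 1"
        by (simp add: fun_eq_iff pointwise)
      then show "F \<in> Units (R\<lparr>carrier := range (\<lambda>c. fscale c 1)\<rparr>)"
        using c by (auto simp: Units_def ops mult.commute intro!: bexI[of _ "fscale (inverse c) 1"])
    qed
  qed
  moreover have "\<one>\<^bsub>R Quot I\<^esub> \<noteq> \<zero>\<^bsub>R Quot I\<^esub>"
    using h_zero_iff[OF R.one_closed] one h.hom_one by (metis ops(2))
  ultimately have K: "subfield K (R Quot I)"
    unfolding K_def by (rule h.img_is_subfield(2))
  have KE: "\<exists>cs. length cs = length Ks \<and> Ks = map (\<lambda>c. h (fscale c 1)) cs" if "set Ks \<subseteq> K" for Ks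
    using that
  proof (induction Ks)
    case (Cons k Ks)
    then obtain c cs where "k = h (fscale c 1)" "length cs = length Ks" "Ks = map (\<lambda>c. h (fscale c 1)) cs"
      by (auto simp: K_def)
    then show ?case by (intro exI[of _ "c # cs"]) simp
  qed simp
  have lin_comb_carrier: "lin_comb cs us \<in> carrier R" if "set us \<subseteq> carrier R" for cs us
    using lin_comb_in_span[of cs us] fun_space.span_minimal[OF that] fun_space.subspace_span
    by (auto simp: R_def carrier_sym_algebra)
  have combine: "h.S.combine (map (\<lambda>c. h (fscale c 1)) cs) (map h us) = h (lin_comb cs us)"
    if "length cs = length us" "set us \<subseteq> carrier R" for cs us
    using that
  proof (induction cs us rule: list_induct2)
    case Nil
    then show ?case using h.hom_zero by (simp add: lin_comb_def ops)
  next
    case (Cons c cs u us)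
    have "h (fscale c u) = h (fscale c 1) \<otimes>\<^bsub>R Quot I\<^esub> h u"
      using h.hom_mult[OF carr_const[of c], of u] Cons.prems by (simp add: ops fscale_mult)
    moreover have "fscale c u \<in> carrier R"
      using R.m_closed[OF carr_const[of c], of u] Cons.prems by (simp add: ops fscale_mult)
    ultimately show ?case
      using Cons h.hom_add[of "fscale c u" "lin_comb cs us"] lin_comb_carrier[of us cs]
      by (simp add: lin_comb_def ops)
  qed
  have Span: "h.S.Span K (map h us) = {h (lin_comb cs us) | cs. length cs = length us}"
    if "set us \<subseteq> carrier R" for us
  proof -
    have "set (map h us) \<subseteq> carrier (R Quot I)"
      using that by auto
    then have "h.S.Span K (map h us) = {h.S.combine Ks (map h us) | Ks. length Ks = length us \<and> set Ks \<subseteq> K}"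
      using h.S.Span_eq_combine_set_length_version[OF K] by simp
    also have "\<dots> = {h (lin_comb cs us) | cs. length cs = length us}"
    proof (intro equalityI subsetI)
      fix x assume "x \<in> {h.S.combine Ks (map h us) | Ks. length Ks = length us \<and> set Ks \<subseteq> K}"
      then obtain Ks where Ks: "x = h.S.combine Ks (map h us)" "length Ks = length us" "set Ks \<subseteq> K" by blast
      with KE[OF Ks(3)] combine[OF _ that] show "x \<in> {h (lin_comb cs us) | cs. length cs = length us}"
        by auto
    next
      fix x assume "x \<in> {h (lin_comb cs us) | cs. length cs = length us}"
      then obtain cs where cs: "x = h (lin_comb cs us)" "length cs = length us" by blast
      then show "x \<in> {h.S.combine Ks (map h us) | Ks. length Ks = length us \<and> set Ks \<subseteq> K}"
        using combine[OF cs(2) that]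
        by (intro CollectI exI[of _ "map (\<lambda>c. h (fscale c 1)) cs"]) (auto simp: K_def)
    qed
    finally show ?thesis .
  qed
  obtain C0 where C0: "C0 \<subseteq> S \<inter> I" "fun_space.independent C0" "S \<inter> I \<subseteq> fun_space.span C0"
    "card C0 = fun_space.dim (S \<inter> I)"
    using fun_space.basis_exists by blast
  obtain C where C: "C0 \<subseteq> C" "C \<subseteq> S" "fun_space.independent C" "S \<subseteq> fun_space.span C"
    using fun_space.maximal_independent_subset_extend[of C0 S] C0(1,2) by blast
  have finC: "finite C"
    using fun_space.independent_span_bound[OF fin(1) C(3)] C(2) fin(2) by (auto simp: S_def)
  have dimS: "fun_space.dim S = card C"
    using fun_space.dim_unique[OF C(2) C(4) C(3) refl] .
  obtain us where us: "set us = C - C0" "distinct us"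
    using finite_distinct_list[of "C - C0"] finC by blast
  have len_us: "length us = card C - card C0"
    using us C(1) finC by (metis card_Diff_subset distinct_card finite_subset)
  have usS: "set us \<subseteq> S" and usR: "set us \<subseteq> carrier R"
    using us C(2) SR by auto
  have indep: "h.S.independent K (map h vs)"
    if "distinct vs" "set vs \<inter> C0 = {}" "fun_space.independent (set vs \<union> C0)" "set vs \<subseteq> S" for vs
    using that
  proof (induction vs)
    case (Cons v vs)
    have vR: "v \<in> carrier R" "set vs \<subseteq> carrier R"
      using Cons.prems SR by auto
    have "h v \<notin> h.S.Span K (map h vs)"
    proof
      assume "h v \<in> h.S.Span K (map h vs)"
      then obtain cs where cs: "h v = h (lin_comb cs vs)"
        using Span[OF vR(2)] by auto
      have "lin_comb cs vs \<in> S"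
        using lin_comb_in_span[of cs vs] fun_space.span_minimal[OF _ subS, of "set vs"] Cons.prems by auto
      then have "v - lin_comb cs vs \<in> S \<inter> I"
        using h_eq[OF cs vR(1) lin_comb_carrier[OF vR(2)]] Cons.prems subS
        by (auto intro: fun_space.subspace_diff)
      then have "v - lin_comb cs vs \<in> fun_space.span (set vs \<union> C0)"
        using C0(3) fun_space.span_mono[of C0 "set vs \<union> C0"] by auto
      moreover have "lin_comb cs vs \<in> fun_space.span (set vs \<union> C0)"
        using lin_comb_in_span[of cs vs] fun_space.span_mono[of "set vs" "set vs \<union> C0"] by auto
      ultimately have "v \<in> fun_space.span (set vs \<union> C0)"
        using fun_space.span_add by fastforce
      moreover have "v \<notin> set vs \<union> C0"
        using Cons.prems by auto
      ultimately show False
        using Cons.prems(3) by (simp add: fun_space.independent_insert)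
    qed
    moreover have "fun_space.independent (set vs \<union> C0)"
      using Cons.prems(3) by (rule fun_space.independent_mono) auto
    then have "h.S.independent K (map h vs)"
      using Cons.prems by (intro Cons.IH) auto
    ultimately show ?case
      using vR(1) by (auto intro: h.S.independent.li_Cons)
  qed simp
  have "h.S.independent K (map h us)"
    using us usS C by (intro indep) (auto simp: Un_absorb2 intro: fun_space.independent_mono)
  then have "h.S.dimension (length us) K (h.S.Span K (map h us))"
    using h.S.dimension_independent[of K "map h us"] by simp
  also have "h.S.Span K (map h us) = h ` S"
  proof (intro equalityI subsetI)
    fix x assume "x \<in> h.S.Span K (map h us)"
    then obtain cs where "x = h (lin_comb cs us)"
      using Span[OF usR] by auto
    moreover have "lin_comb cs us \<in> S"
      using lin_comb_in_span[of cs us] fun_space.span_minimal[OF usS subS] by auto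
    ultimately show "x \<in> h ` S" by blast
  next
    fix x assume "x \<in> h ` S"
    then obtain F where F: "F \<in> S" "x = h F" by blast
    have "C = set us \<union> C0" using us C(1) by auto
    then have "F \<in> fun_space.span (set us \<union> C0)"
      using F(1) C(4) by auto
    then obtain G H where GH: "F = G + H" "G \<in> fun_space.span (set us)" "H \<in> fun_space.span C0"
      unfolding fun_space.span_Un by auto
    obtain cs where cs: "length cs = length us" "G = lin_comb cs us"
      using span_lin_comb[OF us(2) GH(2)] by blast
    have HI: "H \<in> I"
      using GH(3) fun_space.span_minimal[OF _ subI, of C0] C0(1) by auto
    have "G \<in> carrier R"
      using lin_comb_carrier[OF usR] cs by simp
    then have "h F = h G"
      using h.hom_add[of G H] h_zero_iff[of H] HI I.Icarr[OF HI] GH(1) by (simp add: ops)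
    then show "x \<in> h.S.Span K (map h us)"
      using Span[OF usR] cs F(2) by auto
  qed
  finally have "h.S.dim K (h ` S) = length us"
    using h.S.dimI[OF K] by (simp add: over_def)
  moreover have "hilbert_function W J r = h.S.dim K (h ` S)"
    unfolding hilbert_function_def Let_def K_def h_def S_def I_def R_def ..
  moreover have "card C0 \<le> card C"
    using C(1) finC by (rule card_mono[rotated])
  ultimately show ?thesis
    using len_us dimS C0(4) by (simp add: S_def)
qed


section \<open>Direct sums and symmetric powers\<close>

text \<open>
  Rank and nullity as an inequality: a basis of \<open>Z\<close> together with preimages of the elements of \<open>E\<close> is
  independent.
\<close>

lemma dim_add_card_image_le:
  fixes S Z :: "('x \<Rightarrow> complex) set" and L :: "('x \<Rightarrow> complex) \<Rightarrow> 'y \<Rightarrow> complex"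
  assumes S: "fun_space.subspace S" and fin: "finite B" "S \<subseteq> fun_space.span B"
    and Z: "fun_space.subspace Z" "Z \<subseteq> S" "\<And>x. x \<in> Z \<Longrightarrow> L x = 0"
    and L: "\<And>x y. x \<in> S \<Longrightarrow> y \<in> S \<Longrightarrow> L (x + y) = L x + L y"
      "\<And>c x. x \<in> S \<Longrightarrow> L (fscale c x) = fscale c (L x)"
    and E: "finite E" "fun_space.independent E" "E \<subseteq> L ` S"
  shows "fun_space.dim Z + card E \<le> fun_space.dim S"
proof -
  obtain C where C: "C \<subseteq> Z" "fun_space.independent C" "Z \<subseteq> fun_space.span C" "card C = fun_space.dim Z"
    using fun_space.basis_exists by blast
  have finC: "finite C"
    using fun_space.independent_span_bound[OF fin(1) C(2)] C(1) Z(2) fin(2) by blast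
  from E(3) have "\<forall>e\<in>E. \<exists>x\<in>S. L x = e" by auto
  then obtain b where b: "\<And>e. e \<in> E \<Longrightarrow> b e \<in> S" "\<And>e. e \<in> E \<Longrightarrow> L (b e) = e"
    by metis
  have inj: "inj_on b E"
    by (rule inj_on_inverseI[where g = L]) (simp add: b)
  have E0: "0 \<notin> E"
    using E(2) fun_space.dependent_zero by blast
  have disj: "C \<inter> b ` E = {}"
    using C(1) Z(3) b(2) E0 by force
  have L0: "L 0 = 0"
    using Z(1,3) fun_space.subspace_0 by blast
  have L_sum: "L (sum f A) = (\<Sum>a\<in>A. L (f a))" if "finite A" "\<And>a. a \<in> A \<Longrightarrow> f a \<in> S" for f :: "_ \<Rightarrow> 'x \<Rightarrow> complex" and A :: "('y \<Rightarrow> complex) set"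
    using that
  proof (induction A rule: finite_induct)
    case (insert a A)
    have "L (f a + sum f A) = L (f a) + L (sum f A)"
      using insert.prems fun_space.subspace_sum[OF S, of A f] by (intro L(1)) auto
    then show ?case using insert by simp
  qed (simp add: L0)
  have "fun_space.independent (C \<union> b ` E)"
  proof (rule fun_space.independent_if_scalars_zero)
    show "finite (C \<union> b ` E)" using finC E(1) by simp
    fix a x assume a: "(\<Sum>x\<in>C \<union> b ` E. fscale (a x) x) = 0" and x: "x \<in> C \<union> b ` E"
    have CZ: "(\<Sum>x\<in>C. fscale (a x) x) \<in> Z"
      using C(1) by (intro fun_space.subspace_sum[OF Z(1)] fun_space.subspace_scale[OF Z(1)]) auto
    have ES: "fscale (a (b e)) (b e) \<in> S" if "e \<in> E" for e
      using b(1)[OF that] by (rule fun_space.subspace_scale[OF S])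
    have eq: "(\<Sum>x\<in>C. fscale (a x) x) + (\<Sum>e\<in>E. fscale (a (b e)) (b e)) = 0"
      using a finC E(1) disj by (simp add: sum.union_disjoint sum.reindex[OF inj])
    then have "0 = L ((\<Sum>x\<in>C. fscale (a x) x) + (\<Sum>e\<in>E. fscale (a (b e)) (b e)))"
      using L0 by simp
    also have "\<dots> = L (\<Sum>x\<in>C. fscale (a x) x) + L (\<Sum>e\<in>E. fscale (a (b e)) (b e))"
      using CZ Z(2) ES fun_space.subspace_sum[OF S, of E] by (intro L(1)) auto
    also have "\<dots> = (\<Sum>e\<in>E. fscale (a (b e)) e)"
      using Z(3)[OF CZ] ES E(1) b by (simp add: L_sum L(2))
    finally have "a (b e) = 0" if "e \<in> E" for e
      using fun_space.independentD[OF E(2) E(1) subset_refl, of "a \<circ> b"] that by simp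
    moreover from this have "(\<Sum>x\<in>C. fscale (a x) x) = 0"
      using eq by simp
    then have "a c = 0" if "c \<in> C" for c
      using fun_space.independentD[OF C(2) finC subset_refl] that by blast
    ultimately show "a x = 0" using x by auto
  qed
  moreover have "C \<union> b ` E \<subseteq> S" using C(1) Z(2) b(1) by auto
  ultimately have "card (C \<union> b ` E) \<le> fun_space.dim S"
  proof -
    assume ind: "fun_space.independent (C \<union> b ` E)" and sub: "C \<union> b ` E \<subseteq> S"
    obtain D where D: "C \<union> b ` E \<subseteq> D" "D \<subseteq> S" "fun_space.independent D" "S \<subseteq> fun_space.span D"
      using fun_space.maximal_independent_subset_extend[OF sub ind] by blast
    have "finite D"
      using fun_space.independent_span_bound[OF fin(1) D(3)] D(2) fin(2) by blast
    then show ?thesis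
      using card_mono[OF _ D(1)] fun_space.dim_unique[OF D(2) D(4) D(3) refl] by simp
  qed
  then show ?thesis
    using C(4) disj finC E(1) card_image[OF inj] by (simp add: card_Un_disjoint)
qed

definition inject :: "'i \<Rightarrow> ('x \<Rightarrow> complex) \<Rightarrow> 'i \<times> 'x \<Rightarrow> complex" where
  "inject a b = (\<lambda>(i, x). if i = a then b x else 0)"

lemma direct_sum_basis:
  fixes B :: "'i \<Rightarrow> ('x \<Rightarrow> complex) set"
  assumes "finite G" "\<And>a. a \<in> G \<Longrightarrow> finite (B a)" "\<And>a. a \<in> G \<Longrightarrow> fun_space.independent (B a)"
  defines "E \<equiv> (\<lambda>(a, b). inject a b) ` (SIGMA a:G. B a)"
  shows "finite E" "fun_space.independent E" "card E = (\<Sum>a\<in>G. card (B a))"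
proof -
  have fin: "finite (SIGMA a:G. B a)"
    using assms by auto
  then show "finite E" by (simp add: E_def)
  have at: "inject a b (a, x) = b x" for a x and b :: "'x \<Rightarrow> complex"
    by (simp add: inject_def)
  have inj: "inj_on (\<lambda>(a, b). inject a b) (SIGMA a:G. B a)"
  proof (rule inj_onI, clarify)
    fix a b a' b'
    assume ab: "a \<in> G" "b \<in> B a" "a' \<in> G" "b' \<in> B a'" and eq: "inject a b = inject a' b'"
    have "b \<noteq> 0"
      using assms(3)[OF ab(1)] ab(2) fun_space.dependent_zero by blast
    then obtain x where "b x \<noteq> 0" by (auto simp: fun_eq_iff pointwise)
    then have "inject a' b' (a, x) \<noteq> 0"
      using at[of a b x] eq by simp
    then have "a = a'" by (auto simp: inject_def split: if_splits)
    moreover have "b = b'"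
      using at[of a b] at[of a' b'] eq \<open>a = a'\<close> by (auto simp: fun_eq_iff)
    ultimately show "a = a' \<and> b = b'" by simp
  qed
  show "card E = (\<Sum>a\<in>G. card (B a))"
    using assms(1,2) by (simp add: E_def card_image[OF inj] card_SigmaI)
  show "fun_space.independent E"
  proof (rule fun_space.independent_if_scalars_zero[OF \<open>finite E\<close>])
    fix f z assume f: "(\<Sum>z\<in>E. fscale (f z) z) = 0" and "z \<in> E"
    then obtain a b where z: "a \<in> G" "b \<in> B a" "z = inject a b" by (auto simp: E_def)
    have "(\<Sum>b\<in>B a. fscale (f (inject a b)) b) = 0"
    proof
      fix x
      have "0 = (\<Sum>z\<in>E. fscale (f z) z) (a, x)"
        by (simp add: f pointwise)
      also have "\<dots> = (\<Sum>z\<in>E. f z * z (a, x))"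
        by (simp only: sum_fun_apply fscale_apply)
      also have "\<dots> = (\<Sum>(a', b)\<in>(SIGMA a:G. B a). f (inject a' b) * inject a' b (a, x))"
        unfolding E_def sum.reindex[OF inj] by (intro sum.cong refl) auto
      also have "\<dots> = (\<Sum>a'\<in>G. \<Sum>b\<in>B a'. f (inject a' b) * inject a' b (a, x))"
        using assms(1,2) by (simp add: sum.Sigma)
      also have "\<dots> = (\<Sum>a'\<in>G. if a' = a then \<Sum>b\<in>B a. f (inject a b) * b x else 0)"
        by (intro sum.cong refl) (auto simp: inject_def)
      also have "\<dots> = (\<Sum>b\<in>B a. fscale (f (inject a b)) b) x"
        using z(1) assms(1) by (simp add: pointwise)
      finally show "(\<Sum>b\<in>B a. fscale (f (inject a b)) b) x = 0 x"
        by (simp add: pointwise)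
    qed
    then show "f z = 0"
      using fun_space.independentD[OF assms(3)[OF z(1)] assms(2)[OF z(1)] subset_refl, of "\<lambda>b. f (inject a b)" b] z
      by simp
  qed
qed

lemma sym_act_simps:
  "sym_act act g (F + G) = sym_act act g F + sym_act act g G"
  "sym_act act g (F * G) = sym_act act g F * sym_act act g G"
  "sym_act act g (fscale c F) = fscale c (sym_act act g F)"
  "sym_act act g 0 = 0" "sym_act act g 1 = 1"
  by (simp_all add: sym_act_def fun_eq_iff pointwise)

lemma sym_power_homogeneous:
  assumes "F \<in> sym_power W r" "\<psi> \<in> dual fscale"
  shows "F (\<lambda>x. c * \<psi> x) = c ^ r * F \<psi>"
proof (rule fspan_induct[OF assms(1)[unfolded sym_power_monomials], of "\<lambda>F. F (\<lambda>x. c * \<psi> x) = c ^ r * F \<psi>"])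
  have d: "(\<lambda>x. c * \<psi> x) \<in> dual fscale"
    using assms(2) by (simp add: fdual_iff algebra_simps)
  have "prod_list (map sym_gen ws) (\<lambda>x. c * \<psi> x) = c ^ length ws * prod_list (map sym_gen ws) \<psi>" for ws
  proof (induction ws)
    case (Cons w ws)
    then show ?case using d assms(2) by (simp add: pointwise sym_gen_def)
  qed (simp add: pointwise)
  then show "F (\<lambda>x. c * \<psi> x) = c ^ r * F \<psi>" if "F \<in> monomials W r" for F
    using that by (auto simp: monomials_def)
qed (simp_all add: pointwise algebra_simps)

lemma sym_power_outside_dual:
  assumes "F \<in> sym_power W r" "r > 0" "\<psi> \<notin> dual fscale"
  shows "F \<psi> = 0"
proof (rule fspan_induct[OF assms(1)[unfolded sym_power_monomials], of "\<lambda>F. F \<psi> = 0"])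
  fix F assume "F \<in> monomials W r"
  then obtain ws where ws: "F = prod_list (map sym_gen ws)" "length ws = r"
    by (rule monomialsE)
  then obtain w ws' where "ws = w # ws'"
    using assms(2) by (cases ws) auto
  then show "F \<psi> = 0"
    using ws assms(3) by (simp add: pointwise sym_gen_def)
qed (simp_all add: pointwise)

lemma rep_hom_D:
  assumes "rep_hom G U actU W actW f"
  shows "x \<in> U \<Longrightarrow> f x \<in> W" "x \<in> U \<Longrightarrow> y \<in> U \<Longrightarrow> f (x + y) = f x + f y"
    "x \<in> U \<Longrightarrow> f (fscale c x) = fscale c (f x)" "g \<in> G \<Longrightarrow> x \<in> U \<Longrightarrow> f (actU g x) = actW g (f x)"
  using assms unfolding rep_hom_def by blast+

context coordinate_space
begin

lemma comp_act_in_fdual: "\<psi> \<in> dual fscale \<Longrightarrow> \<psi> \<circ> tensor_act g \<in> dual fscale"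
  by (simp add: fdual_iff tensor_act_simps)

lemma comp_act_in_fdual_iff:
  assumes "g \<in> GL scale"
  shows "\<psi> \<circ> tensor_act g \<in> dual fscale \<longleftrightarrow> \<psi> \<in> dual fscale"
proof
  assume "\<psi> \<circ> tensor_act g \<in> dual fscale"
  then have "\<psi> \<circ> tensor_act g \<circ> tensor_act (Hilbert_Choice.inv g) \<in> dual fscale"
    by (rule comp_act_in_fdual)
  moreover have "tensor_act g \<circ> tensor_act (Hilbert_Choice.inv g) = id"
  proof
    fix t :: "'v tensor"
    have "g \<circ> Hilbert_Choice.inv g = id"
      using bij_is_surj[OF GL_D(3)[OF assms]] unfolding surj_iff .
    then show "(tensor_act g \<circ> tensor_act (Hilbert_Choice.inv g)) t = id t"
      by (simp add: tensor_act_compose) (simp add: tensor_act_def)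
  qed
  ultimately show "\<psi> \<in> dual fscale"
    by (simp add: comp_assoc)
qed (rule comp_act_in_fdual)

lemma sym_act_gen: "g \<in> GL scale \<Longrightarrow> sym_act tensor_act g (sym_gen w) = sym_gen (tensor_act g w)"
  by (simp add: sym_act_def sym_gen_def fun_eq_iff comp_act_in_fdual_iff)

lemma sym_act_prod:
  "g \<in> GL scale \<Longrightarrow> sym_act tensor_act g (prod_list (map sym_gen ws)) = prod_list (map sym_gen (map (tensor_act g) ws))"
  by (induction ws) (simp_all add: sym_act_simps sym_act_gen)

lemma sym_act_in:
  assumes "g \<in> GL scale" "\<And>w. w \<in> W \<Longrightarrow> tensor_act g w \<in> W" "F \<in> sym_power W r"
  shows "sym_act tensor_act g F \<in> sym_power W r"
proof (rule fspan_induct[OF assms(3)[unfolded sym_power_monomials]])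
  fix F assume "F \<in> monomials W r"
  then obtain ws where "F = prod_list (map sym_gen ws)" "length ws = r" "set ws \<subseteq> W"
    by (rule monomialsE)
  moreover from this have "prod_list (map sym_gen (map (tensor_act g) ws)) \<in> monomials W r"
    using assms(2) by (intro monomialsI) auto
  ultimately show "sym_act tensor_act g F \<in> sym_power W r"
    unfolding sym_power_monomials by (simp only: sym_act_prod[OF assms(1)] fun_space.span_base)
qed (simp_all add: sym_act_simps sym_power_subspace fun_space.subspace_0 fun_space.subspace_add fun_space.subspace_scale)

section \<open>Degeneration along curves\<close>

text \<open>
  The functional \<open>t\<^sup>-\<^sup>k \<psi> \<circ> D(t) \<circ> g\<close>. The factor \<open>t\<^sup>-\<^sup>k\<close> compensates the smallest weight that
  occurs among the generators, so that their values stay polynomial in \<open>t\<close>.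
\<close>

definition orbit_point ::
  "nat \<Rightarrow> nat \<Rightarrow> ('v tensor \<Rightarrow> complex) \<Rightarrow> ('v \<Rightarrow> 'v) \<Rightarrow> complex \<Rightarrow> 'v tensor \<Rightarrow> complex" where
  "orbit_point l k \<psi> g t = (\<lambda>x. inverse t ^ k * \<psi> (tensor_act (torus l t) (tensor_act g x)))"

text \<open>
  \<open>regular\<close> and \<open>vanishing\<close> describe the functions that extend to \<open>t = 0\<close> along all curves
  \<open>t \<mapsto> orbit_point l k \<psi> g t\<close>, in the second case with limit \<open>0\<close>. In degree \<open>r\<close> they say that no
  translate has a component of weight below \<open>r * k\<close>, respectively of weight at most \<open>r * k\<close>, yet they
  make sense for inhomogeneous functions and are visibly compatible with products.
\<close>

definition regular :: "nat \<Rightarrow> nat \<Rightarrow> ('v \<Rightarrow> complex) list sym \<Rightarrow> bool" where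
  "regular l k F \<longleftrightarrow> (\<forall>\<psi>\<in>dual fscale. \<forall>g\<in>GL scale. \<exists>p. \<forall>t. t \<noteq> 0 \<longrightarrow> F (orbit_point l k \<psi> g t) = poly p t)"

definition vanishing :: "nat \<Rightarrow> nat \<Rightarrow> ('v \<Rightarrow> complex) list sym \<Rightarrow> bool" where
  "vanishing l k F \<longleftrightarrow> (\<forall>\<psi>\<in>dual fscale. \<forall>g\<in>GL scale.
     \<exists>p. poly p 0 = 0 \<and> (\<forall>t. t \<noteq> 0 \<longrightarrow> F (orbit_point l k \<psi> g t) = poly p t))"

lemma orbit_point_in_dual:
  assumes "\<psi> \<in> dual fscale"
  shows "orbit_point l k \<psi> g t \<in> dual fscale"
  using assms unfolding fdual_iff orbit_point_def by (simp add: tensor_act_simps algebra_simps)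

lemma regular_const: "regular l k (fscale c 1)"
  unfolding regular_def by (intro ballI exI[of _ "[:c:]"]) (simp add: pointwise)

lemma regular_add: "regular l k F \<Longrightarrow> regular l k G \<Longrightarrow> regular l k (F + G)"
  unfolding regular_def by (metis plus_fun_apply poly_add)

lemma regular_mult: "regular l k F \<Longrightarrow> regular l k G \<Longrightarrow> regular l k (F * G)"
  unfolding regular_def by (metis times_fun_apply poly_mult)

lemma vanishing_add:
  assumes "vanishing l k F" "vanishing l k G"
  shows "vanishing l k (F + G)"
  unfolding vanishing_def
proof (intro ballI)
  fix \<psi> :: "'v tensor \<Rightarrow> complex" and g assume "\<psi> \<in> dual fscale" "g \<in> GL scale"
  with assms obtain p q where "poly p 0 = 0" "\<forall>t. t \<noteq> 0 \<longrightarrow> F (orbit_point l k \<psi> g t) = poly p t"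
    "poly q 0 = 0" "\<forall>t. t \<noteq> 0 \<longrightarrow> G (orbit_point l k \<psi> g t) = poly q t"
    unfolding vanishing_def by blast
  then show "\<exists>p. poly p 0 = 0 \<and> (\<forall>t. t \<noteq> 0 \<longrightarrow> (F + G) (orbit_point l k \<psi> g t) = poly p t)"
    by (intro exI[of _ "p + q"]) (simp add: pointwise)
qed

lemma vanishing_mult:
  assumes "vanishing l k F" "regular l k G"
  shows "vanishing l k (F * G)"
  unfolding vanishing_def
proof (intro ballI)
  fix \<psi> :: "'v tensor \<Rightarrow> complex" and g assume a: "\<psi> \<in> dual fscale" "g \<in> GL scale"
  then obtain p where "poly p 0 = 0" "\<forall>t. t \<noteq> 0 \<longrightarrow> F (orbit_point l k \<psi> g t) = poly p t"
    using assms(1) unfolding vanishing_def by blast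
  moreover obtain q where "\<forall>t. t \<noteq> 0 \<longrightarrow> G (orbit_point l k \<psi> g t) = poly q t"
    using a assms(2) unfolding regular_def by blast
  ultimately show "\<exists>p. poly p 0 = 0 \<and> (\<forall>t. t \<noteq> 0 \<longrightarrow> (F * G) (orbit_point l k \<psi> g t) = poly p t)"
    by (intro exI[of _ "p * q"]) (simp add: pointwise)
qed

lemma vanishing_zero: "vanishing l k 0"
  unfolding vanishing_def by (intro ballI exI[of _ 0]) (simp add: pointwise)

lemma not_vanishing_one: "\<not> vanishing l k 1"
proof
  assume v: "vanishing l k 1"
  have "(\<lambda>_. 0) \<in> dual fscale" by (simp add: fdual_iff)
  moreover have "id \<in> GL scale" by (simp add: GL_iff)
  ultimately obtain p where p: "poly p 0 = 0" "\<forall>t. t \<noteq> 0 \<longrightarrow> 1 (orbit_point l k (\<lambda>_. 0) id t) = poly p t"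
    using v unfolding vanishing_def by blast
  then have "p = [:1:]"
    by (intro poly_eqI_cofinite[of "{0}"]) (auto simp: pointwise)
  with p(1) show False by simp
qed

text \<open>
  Values of generators are linear combinations of powers \<open>t ^ (a - k)\<close>, one for each weight \<open>a\<close>.
\<close>

lemma regular_sym_algebra:
  assumes wt: "\<And>xs. xs \<in> words d (sum_list \<nu>) \<Longrightarrow> young_symmetrizer \<nu> (word_tensor xs) \<noteq> 0 \<Longrightarrow> k \<le> wt l xs"
    and F: "F \<in> carrier (sym_algebra (schur_module scale \<nu>))"
  shows "regular l k F"
proof -
  let ?W = "schur_module scale \<nu>"
  have lim: "\<exists>p. \<forall>t. t \<noteq> 0 \<longrightarrow> inverse t ^ k * \<psi> (tensor_act (torus l t) w) = poly p t"
    if \<psi>: "\<psi> \<in> dual fscale" and w: "w \<in> ?W" for \<psi> w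
  proof (rule fspan_induct[OF w[unfolded schur_span],
        of "\<lambda>w. \<exists>p. \<forall>t. t \<noteq> 0 \<longrightarrow> inverse t ^ k * \<psi> (tensor_act (torus l t) w) = poly p t"])
    fix z assume "z \<in> (\<lambda>xs. young_symmetrizer \<nu> (word_tensor xs)) ` words d (sum_list \<nu>)"
    then obtain xs where xs: "xs \<in> words d (sum_list \<nu>)" "z = young_symmetrizer \<nu> (word_tensor xs)"
      by blast
    show "\<exists>p. \<forall>t. t \<noteq> 0 \<longrightarrow> inverse t ^ k * \<psi> (tensor_act (torus l t) z) = poly p t"
    proof (cases "z = 0")
      case True
      then show ?thesis
        by (intro exI[of _ 0]) (simp add: tensor_act_simps fdual_zero[OF \<psi>])
    next
      case False
      then have le: "k \<le> wt l xs" using wt xs by blast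
      show ?thesis
      proof (intro exI allI impI)
        fix t :: complex assume t: "t \<noteq> 0"
        have "inverse t ^ k * t ^ wt l xs = t ^ (wt l xs - k)"
          using t le by (simp add: power_diff field_simps)
        then show "inverse t ^ k * \<psi> (tensor_act (torus l t) z) = poly (monom (\<psi> z) (wt l xs - k)) t"
          using t by (simp add: xs torus_young_word fdual_scale[OF \<psi>] poly_monom mult.assoc[symmetric])
      qed
    qed
  next
    show "\<exists>p. \<forall>t. t \<noteq> 0 \<longrightarrow> inverse t ^ k * \<psi> (tensor_act (torus l t) 0) = poly p t"
      by (intro exI[of _ 0]) (simp add: tensor_act_simps fdual_zero[OF \<psi>])
  next
    fix x y assume "\<exists>p. \<forall>t. t \<noteq> 0 \<longrightarrow> inverse t ^ k * \<psi> (tensor_act (torus l t) x) = poly p t"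
      "\<exists>p. \<forall>t. t \<noteq> 0 \<longrightarrow> inverse t ^ k * \<psi> (tensor_act (torus l t) y) = poly p t"
    then obtain p q where "\<forall>t. t \<noteq> 0 \<longrightarrow> inverse t ^ k * \<psi> (tensor_act (torus l t) x) = poly p t"
      "\<forall>t. t \<noteq> 0 \<longrightarrow> inverse t ^ k * \<psi> (tensor_act (torus l t) y) = poly q t" by blast
    then show "\<exists>p. \<forall>t. t \<noteq> 0 \<longrightarrow> inverse t ^ k * \<psi> (tensor_act (torus l t) (x + y)) = poly p t"
      by (intro exI[of _ "p + q"]) (simp add: tensor_act_simps fdual_add[OF \<psi>] distrib_left)
  next
    fix c x assume "\<exists>p. \<forall>t. t \<noteq> 0 \<longrightarrow> inverse t ^ k * \<psi> (tensor_act (torus l t) x) = poly p t"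
    then obtain p where "\<forall>t. t \<noteq> 0 \<longrightarrow> inverse t ^ k * \<psi> (tensor_act (torus l t) x) = poly p t" by blast
    then show "\<exists>p. \<forall>t. t \<noteq> 0 \<longrightarrow> inverse t ^ k * \<psi> (tensor_act (torus l t) (fscale c x)) = poly p t"
      by (intro exI[of _ "smult c p"]) (simp add: tensor_act_simps fdual_scale[OF \<psi>] mult.left_commute)
  qed
  have gen: "regular l k (sym_gen w)" if w: "w \<in> ?W" for w
    unfolding regular_def
  proof (intro ballI)
    fix \<psi> :: "'v tensor \<Rightarrow> complex" and g assume a: "\<psi> \<in> dual fscale" "g \<in> GL scale"
    have "sym_gen w (orbit_point l k \<psi> g t) = inverse t ^ k * \<psi> (tensor_act (torus l t) (tensor_act g w))" for t
      using orbit_point_in_dual[OF a(1)] by (simp add: sym_gen_def) (simp add: orbit_point_def)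
    then show "\<exists>p. \<forall>t. t \<noteq> 0 \<longrightarrow> sym_gen w (orbit_point l k \<psi> g t) = poly p t"
      using lim[OF a(1) schur_act[OF a(2) w]] by simp
  qed
  have one: "regular l k 1"
    using regular_const[of l k 1] by simp
  have prod: "regular l k (prod_list (map sym_gen ws))" if "set ws \<subseteq> ?W" for ws
    using that by (induction ws) (auto simp: one intro: regular_mult gen)
  have scale: "regular l k (fscale c G)" if "regular l k G" for c G
    using regular_mult[OF regular_const[of l k c] that] by (simp add: fscale_mult)
  have zero: "regular l k 0"
    using regular_const[of l k 0] by simp
  have power: "regular l k G" if "G \<in> sym_power ?W r" for r G
    by (rule fspan_induct[OF that[unfolded sym_power_monomials]])
       (auto simp: zero scale regular_add monomials_def prod)
  show ?thesis
    by (rule fspan_induct[OF F[unfolded carrier_sym_algebra]]) (auto simp: zero scale regular_add power)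
qed

lemma vanishing_ideal:
  assumes wt: "\<And>xs. xs \<in> words d (sum_list \<nu>) \<Longrightarrow> young_symmetrizer \<nu> (word_tensor xs) \<noteq> 0 \<Longrightarrow> k \<le> wt l xs"
  shows "ideal {F \<in> carrier (sym_algebra (schur_module scale \<nu>)). vanishing l k F} (sym_algebra (schur_module scale \<nu>))"
    (is "ideal ?I ?R")
proof -
  interpret R: cring ?R by (rule sym_algebra_cring)
  have reg: "F \<in> carrier ?R \<Longrightarrow> regular l k F" for F
    by (rule regular_sym_algebra[OF wt])
  have mult: "F * G \<in> ?I" if "F \<in> ?I" "G \<in> carrier ?R" for F G
    using that reg by (auto intro: sym_algebra_mult_closed vanishing_mult)
  show ?thesis
  proof (rule idealI[OF R.ring_axioms])
    show "subgroup ?I (add_monoid ?R)"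
    proof (rule R.add.subgroupI)
      show "?I \<noteq> {}"
        using vanishing_zero R.zero_closed by auto
      fix F assume F: "F \<in> ?I"
      have "fscale (- 1) 1 * F \<in> ?I"
        using mult[OF F const_in_sym_algebra[of "- 1"]] by (simp add: mult.commute)
      moreover have "fscale (- 1) 1 * F \<oplus>\<^bsub>?R\<^esub> F = \<zero>\<^bsub>?R\<^esub>"
        by (simp add: fun_eq_iff pointwise)
      ultimately show "\<ominus>\<^bsub>?R\<^esub> F \<in> ?I"
        using R.minus_equality F by fastforce
    next
      fix F G assume "F \<in> ?I" "G \<in> ?I"
      then show "F \<oplus>\<^bsub>?R\<^esub> G \<in> ?I"
        using R.a_closed[of F G] by (simp add: vanishing_add)
    qed auto
  next
    fix a x assume "a \<in> ?I" "x \<in> carrier ?R"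
    then show "a \<otimes>\<^bsub>?R\<^esub> x \<in> ?I" "x \<otimes>\<^bsub>?R\<^esub> a \<in> ?I"
      using mult[of a x] by (simp_all add: mult.commute)
  qed
qed

text \<open>
  Homogeneity turns the normalising factor of each of the \<open>r\<close> generators into one power of \<open>t\<close>, which
  links vanishing along curves with weights.
\<close>

lemma sym_act_torus_orbit:
  assumes "F \<in> sym_power W r" "\<psi> \<in> dual fscale"
  shows "F (orbit_point l k \<psi> g t)
    = inverse t ^ (k * r) * sym_act tensor_act (torus l t) (sym_act tensor_act g F) \<psi>"
proof -
  have "F (orbit_point l k \<psi> g t) = F (\<lambda>x. inverse t ^ k * (\<psi> \<circ> tensor_act (torus l t) \<circ> tensor_act g) x)"
    by (simp add: orbit_point_def)
  also have "\<dots> = (inverse t ^ k) ^ r * F (\<psi> \<circ> tensor_act (torus l t) \<circ> tensor_act g)"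
    by (rule sym_power_homogeneous[OF assms(1)]) (intro comp_act_in_fdual assms(2))
  finally show ?thesis
    by (simp add: sym_act_def power_mult)
qed

text \<open>
  By equivariance of \<open>j\<close>, the value of \<open>j u\<close> along a curve is a combination of the powers
  \<open>t ^ (a - 2 * k)\<close> for weights \<open>a\<close> of the Schur module, and all these exponents are positive.
\<close>

lemma vanishing_image:
  assumes j: "rep_hom (GL scale) (schur_module scale \<mu>) tensor_act (sym_power W 2) (sym_act tensor_act) j"
    and wt: "\<And>xs. xs \<in> words d (sum_list \<mu>) \<Longrightarrow> young_symmetrizer \<mu> (word_tensor xs) \<noteq> 0 \<Longrightarrow> 2 * k < wt l xs"
    and u: "u \<in> schur_module scale \<mu>"
  shows "vanishing l k (j u)"
  unfolding vanishing_def
proof (intro ballI)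
  fix \<psi> :: "'v tensor \<Rightarrow> complex" and g assume \<psi>: "\<psi> \<in> dual fscale" and g: "g \<in> GL scale"
  let ?U = "schur_module scale \<mu>"
  let ?P = "\<lambda>v. v \<in> ?U \<and> (\<exists>p. poly p 0 = 0 \<and> (\<forall>t. t \<noteq> 0 \<longrightarrow> inverse t ^ (2 * k) * j (tensor_act (torus l t) v) \<psi> = poly p t))"
  note U = schur_subspace[of \<mu>]
  have j0: "j 0 = 0"
    using rep_hom_D(3)[OF j fun_space.subspace_0[OF U], of 0] by simp
  have tU: "tensor_act (torus l t) v \<in> ?U" if "v \<in> ?U" "t \<noteq> 0" for v t
    using schur_act[OF torus_in_GL[OF that(2)] that(1)] .
  have "?P (tensor_act g u)"
  proof (rule fspan_induct[OF schur_act[OF g u, unfolded schur_span]])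
    fix z assume "z \<in> (\<lambda>xs. young_symmetrizer \<mu> (word_tensor xs)) ` words d (sum_list \<mu>)"
    then obtain xs where xs: "xs \<in> words d (sum_list \<mu>)" "z = young_symmetrizer \<mu> (word_tensor xs)"
      by blast
    have zU: "z \<in> ?U"
      using xs by (auto simp: words_def intro!: schurI word_tensor_in)
    show "?P z"
    proof (cases "z = 0")
      case True
      then show ?thesis
        using zU by (intro conjI exI[of _ 0]) (simp_all add: tensor_act_simps j0 pointwise)
    next
      case False
      then have le: "2 * k < wt l xs" using wt xs by blast
      have "inverse t ^ (2 * k) * j (tensor_act (torus l t) z) \<psi> = poly (monom (j z \<psi>) (wt l xs - 2 * k)) t"
        if t: "t \<noteq> 0" for t
      proof -
        have "inverse t ^ (2 * k) * t ^ wt l xs = t ^ (wt l xs - 2 * k)"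
          using t le by (simp add: power_diff field_simps)
        moreover have "tensor_act (torus l t) z = fscale (t ^ wt l xs) z"
          using torus_young_word[OF xs(1) t] xs(2) by simp
        ultimately show ?thesis
          by (simp add: rep_hom_D(3)[OF j zU] pointwise poly_monom mult.assoc[symmetric])
      qed
      moreover have "poly (monom (j z \<psi>) (wt l xs - 2 * k)) 0 = 0"
        using le by (simp add: poly_monom)
      ultimately show ?thesis using zU by blast
    qed
  next
    show "?P 0"
      using fun_space.subspace_0[OF U]
      by (intro conjI exI[of _ 0]) (simp_all add: tensor_act_simps j0 pointwise)
  next
    fix x y assume x: "?P x" and y: "?P y"
    then obtain p q where pq: "poly p 0 = 0" "poly q 0 = 0"
      "\<And>t. t \<noteq> 0 \<Longrightarrow> inverse t ^ (2 * k) * j (tensor_act (torus l t) x) \<psi> = poly p t"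
      "\<And>t. t \<noteq> 0 \<Longrightarrow> inverse t ^ (2 * k) * j (tensor_act (torus l t) y) \<psi> = poly q t" by blast
    have "inverse t ^ (2 * k) * j (tensor_act (torus l t) (x + y)) \<psi> = poly (p + q) t" if "t \<noteq> 0" for t
      using pq(3,4)[OF that] x y tU that
      by (simp only: tensor_act_simps) (simp add: rep_hom_D(2)[OF j] plus_fun_apply distrib_left)
    then show "?P (x + y)"
      using x y pq fun_space.subspace_add[OF U] by (intro conjI exI[of _ "p + q"]) auto
  next
    fix c x assume x: "?P x"
    then obtain p where p: "poly p 0 = 0"
      "\<And>t. t \<noteq> 0 \<Longrightarrow> inverse t ^ (2 * k) * j (tensor_act (torus l t) x) \<psi> = poly p t" by blast
    have "inverse t ^ (2 * k) * j (tensor_act (torus l t) (fscale c x)) \<psi> = poly (smult c p) t" if "t \<noteq> 0" for t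
      using p(2)[OF that] x tU that
      by (simp only: tensor_act_simps) (simp add: rep_hom_D(3)[OF j] fscale_apply mult.left_commute)
    then show "?P (fscale c x)"
      using x p fun_space.subspace_scale[OF U] by (intro conjI exI[of _ "smult c p"]) auto
  qed
  then obtain p where p: "poly p 0 = 0"
    "\<And>t. t \<noteq> 0 \<Longrightarrow> inverse t ^ (2 * k) * j (tensor_act (torus l t) (tensor_act g u)) \<psi> = poly p t" by blast
  have "j u (orbit_point l k \<psi> g t) = poly p t" if t: "t \<noteq> 0" for t
  proof -
    have "j u (orbit_point l k \<psi> g t)
        = inverse t ^ (k * 2) * sym_act tensor_act (torus l t) (sym_act tensor_act g (j u)) \<psi>"
      by (rule sym_act_torus_orbit[OF rep_hom_D(1)[OF j u] \<psi>])
    also have "sym_act tensor_act (torus l t) (sym_act tensor_act g (j u)) = j (tensor_act (torus l t) (tensor_act g u))"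
      using rep_hom_D(4)[OF j] torus_in_GL[OF t] g u schur_act by simp
    finally show ?thesis
      using p(2)[OF t] by (simp add: mult.commute)
  qed
  then show "\<exists>p. poly p 0 = 0 \<and> (\<forall>t. t \<noteq> 0 \<longrightarrow> j u (orbit_point l k \<psi> g t) = poly p t)"
    using p(1) by blast
qed

lemma sym_power_weight_decomposition:
  assumes "x \<in> sym_power (schur_module scale \<nu>) r"
  obtains A and X :: "nat \<Rightarrow> ('v \<Rightarrow> complex) list sym"
  where "finite A" "x = (\<Sum>a\<in>A. X a)"
    "\<And>a. X a \<in> sym_power (schur_module scale \<nu>) r"
    "\<And>a t. t \<noteq> 0 \<Longrightarrow> sym_act tensor_act (torus l t) (X a) = fscale (t ^ a) (X a)"
proof -
  let ?B = "(\<lambda>xs. young_symmetrizer \<nu> (word_tensor xs)) ` words d (sum_list \<nu>)"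
  have span: "sym_power (schur_module scale \<nu>) r = fun_space.span (monomials ?B r)"
    by (simp only: schur_span sym_power_span)
  have fin: "finite (monomials ?B r)"
    by (simp add: finite_monomials finite_words)
  have "\<exists>a. \<forall>t. t \<noteq> 0 \<longrightarrow> sym_act tensor_act (torus l t) (prod_list (map sym_gen ws)) = fscale (t ^ a) (prod_list (map sym_gen ws))"
    if "set ws \<subseteq> ?B" for ws
    using that
  proof (induction ws)
    case Nil
    show ?case by (intro exI[of _ 0]) (simp add: sym_act_simps)
  next
    case (Cons w ws)
    then obtain a where a: "\<And>t. t \<noteq> 0 \<Longrightarrow> sym_act tensor_act (torus l t) (prod_list (map sym_gen ws)) = fscale (t ^ a) (prod_list (map sym_gen ws))"
      by auto
    obtain xs where xs: "xs \<in> words d (sum_list \<nu>)" "w = young_symmetrizer \<nu> (word_tensor xs)"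
      using Cons.prems by auto
    show ?case
    proof (intro exI allI impI)
      fix t :: complex assume t: "t \<noteq> 0"
      have "sym_act tensor_act (torus l t) (sym_gen w) = fscale (t ^ wt l xs) (sym_gen w)"
        using torus_young_word[OF xs(1) t] xs(2) by (simp add: sym_act_gen[OF torus_in_GL[OF t]] sym_gen_simps)
      then show "sym_act tensor_act (torus l t) (prod_list (map sym_gen (w # ws))) = fscale (t ^ (wt l xs + a)) (prod_list (map sym_gen (w # ws)))"
        using a[OF t] by (simp add: sym_act_simps fscale_mult power_add)
    qed
  qed
  then have "\<forall>F\<in>monomials ?B r. \<exists>a. \<forall>t. t \<noteq> 0 \<longrightarrow> sym_act tensor_act (torus l t) F = fscale (t ^ a) F"
    by (auto simp: monomials_def)
  then obtain w where w: "\<And>F t. F \<in> monomials ?B r \<Longrightarrow> t \<noteq> 0 \<Longrightarrow> sym_act tensor_act (torus l t) F = fscale (t ^ w F) F"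
    by metis
  obtain c where c: "x = (\<Sum>F\<in>monomials ?B r. fscale (c F) F)"
    using assms unfolding span fun_space.span_finite[OF fin] by blast
  \<comment> \<open>Collect the terms of equal weight.\<close>
  define X where "X a = (\<Sum>F\<in>{F \<in> monomials ?B r. w F = a}. fscale (c F) F)" for a
  show ?thesis
  proof (rule that)
    show "finite (w ` monomials ?B r)" using fin by simp
    show "x = (\<Sum>a\<in>w ` monomials ?B r. X a)"
      unfolding X_def c by (rule sum.image_gen[OF fin])
    show "X a \<in> sym_power (schur_module scale \<nu>) r" for a
      unfolding X_def span by (intro fun_space.span_sum fun_space.span_scale fun_space.span_base) auto
    show "sym_act tensor_act (torus l t) (X a) = fscale (t ^ a) (X a)" if "t \<noteq> 0" for a t
    proof -
      have "sym_act tensor_act (torus l t) (X a) = (\<Sum>F\<in>{F \<in> monomials ?B r. w F = a}. sym_act tensor_act (torus l t) (fscale (c F) F))"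
        unfolding X_def by (rule additive_sum[of "sym_act tensor_act (torus l t)"]) (simp_all add: sym_act_simps)
      also have "\<dots> = (\<Sum>F\<in>{F \<in> monomials ?B r. w F = a}. fscale (t ^ a) (fscale (c F) F))"
        using w that by (intro sum.cong refl) (simp add: sym_act_simps mult.commute)
      also have "\<dots> = fscale (t ^ a) (X a)"
        unfolding X_def by (rule fun_space.scale_sum_right[symmetric])
      finally show ?thesis .
    qed
  qed
qed

text \<open>
  Otherwise some translate of the component has a nonzero coordinate at the tableau \<open>row_word \<nu>\<close>.
  Reading off this coordinate is a linear form \<open>\<xi>\<close> on the symmetric power which scales with the weight
  \<open>w\<close> of the tableau, so it factors through the part \<open>X w\<close> of weight \<open>w\<close>, which is therefore nonzero.
  But \<open>X w \<psi>\<close> is a coefficient of the polynomial along a curve through the translate, and this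
  polynomial is divisible by \<open>t ^ (k * r + 1)\<close>.
\<close>

lemma vanishing_component:
  fixes f :: "('v \<Rightarrow> complex) list sym \<Rightarrow> 'i \<times> ('v \<Rightarrow> complex) list \<Rightarrow> complex"
    and \<mu> \<nu> :: "nat list"
  defines "W \<equiv> schur_module scale \<mu>"
  assumes f: "rep_hom (GL scale) (sym_power W r) (sym_act tensor_act) D (direct_sum_act tensor_act) f"
    and comp: "(\<lambda>x. f F (a, x)) \<in> schur_module scale \<nu>" "length \<nu> = d"
      "\<And>F. F \<in> sym_power W r \<Longrightarrow> (\<lambda>x. f F (a, x)) \<in> tensors (sum_list \<nu>)"
    and F: "F \<in> sym_power W r" "r > 0" "vanishing l k F"
    and le: "wt l (row_word \<nu>) \<le> k * r"
  shows "(\<lambda>x. f F (a, x)) = 0"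
proof (rule ccontr)
  assume "(\<lambda>x. f F (a, x)) \<noteq> 0"
  then obtain g where g: "g \<in> GL scale" "tensor_act g (\<lambda>x. f F (a, x)) (map coord (row_word \<nu>)) \<noteq> 0"
    using schur_highest_coordinate[OF comp(1) _ comp(2)] by blast
  let ?S = "sym_power W r" and ?w = "wt l (row_word \<nu>)"
  have S: "fun_space.subspace ?S" by (rule sym_power_subspace)
  define \<xi> where "\<xi> z = f z (a, map coord (row_word \<nu>))" for z
  have f0: "f 0 = 0"
    using rep_hom_D(3)[OF f fun_space.subspace_0[OF S], of 0] by simp
  have \<xi>_sum: "\<xi> (sum X A) = (\<Sum>b\<in>A. \<xi> (X b))" if "finite A" "\<And>b. X b \<in> ?S" for A :: "nat set" and X
    using that(1)
  proof (induction A rule: finite_induct)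
    case empty
    have "\<xi> 0 = 0" by (simp add: \<xi>_def f0 zero_fun_apply)
    then show ?case by simp
  next
    case (insert b A)
    have "f (X b + sum X A) = f (X b) + f (sum X A)"
      by (intro rep_hom_D(2)[OF f] that(2) fun_space.subspace_sum[OF S])
    then have "\<xi> (X b + sum X A) = \<xi> (X b) + \<xi> (sum X A)"
      by (simp add: \<xi>_def plus_fun_apply)
    then show ?case
      using insert by simp
  qed
  have \<xi>_torus: "\<xi> (sym_act tensor_act (torus l t) z) = t ^ ?w * \<xi> z" if "z \<in> ?S" "t \<noteq> 0" for z t
  proof -
    have "\<xi> (sym_act tensor_act (torus l t) z) = tensor_act (torus l t) (\<lambda>x. f z (a, x)) (map coord (row_word \<nu>))"
      using rep_hom_D(4)[OF f torus_in_GL[OF that(2)] that(1)] by (simp add: \<xi>_def direct_sum_act_def)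
    also have "\<dots> = t ^ ?w * f z (a, map coord (row_word \<nu>))"
      using row_word_in_words[of \<nu>] comp(2) by (intro torus_coordinate[OF comp(3)[OF that(1)] _ that(2)]) simp
    finally show ?thesis by (simp add: \<xi>_def)
  qed
  let ?x = "sym_act tensor_act g F"
  have xS: "?x \<in> ?S"
    using F(1) unfolding W_def by (intro sym_act_in[OF g(1)] schur_act[OF g(1)])
  obtain A X where X: "finite A" "?x = (\<Sum>b\<in>A. X b)" "\<And>b. X b \<in> ?S"
    "\<And>b t. t \<noteq> 0 \<Longrightarrow> sym_act tensor_act (torus l t) (X b) = fscale (t ^ b) (X b)"
    using sym_power_weight_decomposition[OF xS[unfolded W_def], of l] unfolding W_def by metis
  have \<xi>X: "\<xi> (X b) = 0" if "b \<noteq> ?w" for b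
  proof -
    \<comment> \<open>The single value \<open>t = 2\<close> already separates all weights.\<close>
    have "2 ^ ?w * \<xi> (X b) = \<xi> (fscale (2 ^ b) (X b))"
      using \<xi>_torus[OF X(3), of 2 b] X(4)[of 2 b] by simp
    also have "\<dots> = 2 ^ b * \<xi> (X b)"
      using rep_hom_D(3)[OF f X(3)] by (simp add: \<xi>_def pointwise)
    finally have "(2 ^ ?w - 2 ^ b) * \<xi> (X b) = 0"
      by (simp add: left_diff_distrib)
    moreover have "(2 ^ ?w :: complex) \<noteq> 2 ^ b"
    proof
      assume "(2 ^ ?w :: complex) = 2 ^ b"
      then have "of_nat (2 ^ ?w) = (of_nat (2 ^ b) :: complex)" by simp
      then have "(2 :: nat) ^ ?w = 2 ^ b" by (simp only: of_nat_eq_iff)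
      then show False using that by (simp add: power_inject_exp)
    qed
    ultimately show ?thesis by simp
  qed
  have "\<xi> ?x = tensor_act g (\<lambda>x. f F (a, x)) (map coord (row_word \<nu>))"
    using rep_hom_D(4)[OF f g(1) F(1)] by (simp add: \<xi>_def direct_sum_act_def)
  then have "(\<Sum>b\<in>A. \<xi> (X b)) \<noteq> 0"
    using g(2) \<xi>_sum[OF X(1,3)] X(2) by simp
  then obtain b where "b \<in> A" "\<xi> (X b) \<noteq> 0"
    by (meson sum.neutral)
  then have w: "?w \<in> A" "\<xi> (X ?w) \<noteq> 0"
    using \<xi>X by metis+
  then have "X ?w \<noteq> 0"
    by (auto simp: \<xi>_def f0 pointwise)
  then obtain \<psi> where nz: "X ?w \<psi> \<noteq> 0"
    by (auto simp: fun_eq_iff pointwise)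
  then have \<psi>: "\<psi> \<in> dual fscale"
    using sym_power_outside_dual[OF X(3) F(2)] by blast
  obtain p where p: "poly p 0 = 0" "\<And>t. t \<noteq> 0 \<Longrightarrow> F (orbit_point l k \<psi> g t) = poly p t"
    using F(3) \<psi> g(1) unfolding vanishing_def by blast
  let ?q = "\<Sum>b\<in>A. monom (X b \<psi>) b"
  have "?q = monom 1 (k * r) * p"
  proof (rule poly_eqI_cofinite)
    show "finite {0 :: complex}" by simp
    fix t :: complex assume "t \<notin> {0}"
    then have t: "t \<noteq> 0" by simp
    have "sym_act tensor_act (torus l t) ?x = (\<Sum>b\<in>A. sym_act tensor_act (torus l t) (X b))"
      unfolding X(2) by (rule additive_sum[of "sym_act tensor_act (torus l t)"]) (simp_all add: sym_act_simps)
    then have "sym_act tensor_act (torus l t) ?x \<psi> = poly ?q t"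
      by (simp add: X(4)[OF t] pointwise poly_sum poly_monom mult.commute)
    moreover have "poly p t = inverse t ^ (k * r) * sym_act tensor_act (torus l t) ?x \<psi>"
      using p(2)[OF t] sym_act_torus_orbit[OF F(1) \<psi>] by simp
    ultimately show "poly ?q t = poly (monom 1 (k * r) * p) t"
      using t by (simp add: poly_monom field_simps)
  qed
  moreover have "coeff ?q ?w = X ?w \<psi>"
    using w(1) X(1) by (simp add: coeff_sum)
  moreover have "coeff (monom 1 (k * r) * p) ?w = 0"
    using le p(1) by (simp add: coeff_monom_mult poly_0_coeff_0)
  ultimately show False
    using nz by simp
qed

end


section \<open>The lower bound\<close>

lemma finite_partitions: "finite (partitions d n)"
proof (rule finite_subset)
  show "partitions d n \<subseteq> {\<nu>. set \<nu> \<subseteq> {..n} \<and> length \<nu> = d}"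
    using member_le_sum_list by (fastforce simp: partitions_def)
  show "finite {\<nu>. set \<nu> \<subseteq> {..n} \<and> length \<nu> = d}"
    by (rule finite_lists_length_eq) simp
qed

context coordinate_space
begin

text \<open>
  The first column has \<open>d - 1\<close> boxes, and \<open>k + 1\<close> of the \<open>d\<close> indices are scaled.
\<close>

lemma generator_weight:
  assumes "d \<ge> 3" "k \<le> d - 1" "xs \<in> words d (sum_list (3 # replicate (d - 2) 1 @ [0]))"
    "young_symmetrizer (3 # replicate (d - 2) 1 @ [0]) (word_tensor xs) \<noteq> 0"
  shows "k \<le> wt (d - 1 - k) xs"
proof -
  let ?\<nu> = "3 # replicate (d - 2) 1 @ [0 :: nat]"
  have len: "length ?\<nu> = d"
    using assms(1) by simp
  have nth: "?\<nu> ! i = (if i = 0 then 3 else if i < d - 1 then 1 else 0)" if "i < d" for i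
    using that assms(1) by (cases i) (auto simp: nth_append nth_Cons')
  have "{i. i < length ?\<nu> \<and> 0 < ?\<nu> ! i} = {..<d - 1}"
    unfolding len using nth assms(1) by (auto split: if_splits)
  then show ?thesis
    using young_word_weight[OF assms(3,4), of "{0}" "d - 1 - k"] assms(1,2) by simp
qed

text \<open>
  The first two columns have \<open>d\<close> and \<open>d - 1\<close> boxes; they contribute \<open>k + 1\<close> and \<open>k\<close>.
\<close>

lemma relation_weight:
  assumes "d \<ge> 3" "k \<le> d - 1" "xs \<in> words d (sum_list ([4, 3] @ replicate (d - 3) 2 @ [1]))"
    "young_symmetrizer ([4, 3] @ replicate (d - 3) 2 @ [1]) (word_tensor xs) \<noteq> 0"
  shows "2 * k < wt (d - 1 - k) xs"
proof -
  let ?\<mu> = "[4, 3] @ replicate (d - 3) 2 @ [1 :: nat]"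
  have len: "length ?\<mu> = d"
    using assms(1) by simp
  have nth: "?\<mu> ! i = (if i = 0 then 4 else if i = 1 then 3 else if i < d - 1 then 2 else 1)" if "i < d" for i
    using that assms(1) by (auto simp: nth_append nth_Cons')
  have "{i. i < length ?\<mu> \<and> 0 < ?\<mu> ! i} = {..<d}"
    unfolding len using nth assms(1) by (auto split: if_splits)
  moreover have "{i. i < length ?\<mu> \<and> 1 < ?\<mu> ! i} = {..<d - 1}"
    unfolding len using nth assms(1) by (auto split: if_splits)
  ultimately show ?thesis
    using young_word_weight[OF assms(3,4), of "{0, 1}" "d - 1 - k"] assms(1,2)
    by (simp del: length_append append_Cons)
qed

text \<open>
  The ideal lies in the kernel of the projection of the symmetric power to the sum of the Schur
  modules that are counted on the left, and this projection is onto.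
\<close>

lemma hilbert_function_lower_bound:
  fixes W :: "'v tensor set" and j :: "'v tensor \<Rightarrow> ('v \<Rightarrow> complex) list sym" and m :: "nat list \<Rightarrow> nat"
    and \<mu> \<kappa> :: "nat list"
  defines "W \<equiv> schur_module scale \<mu>"
  assumes gen: "\<And>xs. xs \<in> words d (sum_list \<mu>) \<Longrightarrow> young_symmetrizer \<mu> (word_tensor xs) \<noteq> 0 \<Longrightarrow> k \<le> wt l xs"
    and rel: "\<And>xs. xs \<in> words d (sum_list \<kappa>) \<Longrightarrow> young_symmetrizer \<kappa> (word_tensor xs) \<noteq> 0 \<Longrightarrow> 2 * k < wt l xs"
    and j: "rep_hom (GL scale) (schur_module scale \<kappa>) tensor_act (sym_power W 2) (sym_act tensor_act) j"
    and r: "r > 0"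
    and P: "finite P" "\<And>\<nu>. \<nu> \<in> P \<Longrightarrow> length \<nu> = d"
    and iso: "rep_isomorphic (GL scale) (sym_power W r) (sym_act tensor_act)
           (direct_sum (SIGMA \<nu>:P. {..<m \<nu>}) (\<lambda>(\<nu>, _). schur_module scale \<nu>)) (direct_sum_act tensor_act)"
  shows "(\<Sum>\<nu> | \<nu> \<in> P \<and> wt l (row_word \<nu>) \<le> r * k. m \<nu> * fun_space.dim (schur_module scale \<nu>))
    \<le> hilbert_function W (j ` schur_module scale \<kappa>) r"
proof -
  let ?R = "sym_algebra W" and ?S = "sym_power W r" and ?U = "schur_module scale \<kappa>"
  let ?D = "direct_sum (SIGMA \<nu>:P. {..<m \<nu>}) (\<lambda>(\<nu>, _). schur_module scale \<nu>)"
  define I where "I = genideal ?R (j ` ?U)"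
  obtain f where f: "rep_hom (GL scale) ?S (sym_act tensor_act) ?D (direct_sum_act tensor_act) f"
    and bij: "bij_betw f ?S ?D"
    using iso unfolding rep_isomorphic_def by blast
  interpret R: cring ?R by (rule sym_algebra_cring)
  have J: "j ` ?U \<subseteq> carrier ?R"
    using rep_hom_D(1)[OF j] sym_power_subset_carrier by blast
  have idl: "ideal I ?R"
    unfolding I_def by (rule R.genideal_ideal[OF J])
  have "I \<subseteq> {F \<in> carrier ?R. vanishing l k F}"
    unfolding I_def
  proof (rule R.genideal_minimal)
    show "ideal {F \<in> carrier ?R. vanishing l k F} ?R"
      unfolding W_def by (rule vanishing_ideal[OF gen])
    show "j ` ?U \<subseteq> {F \<in> carrier ?R. vanishing l k F}"
      using J vanishing_image[OF j rel] by blast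
  qed
  then have I: "vanishing l k F" if "F \<in> I" for F
    using that by blast
  have one: "1 \<notin> I"
    using I not_vanishing_one by blast
  let ?B = "(\<lambda>xs. young_symmetrizer \<mu> (word_tensor xs)) ` words d (sum_list \<mu>)"
  have S_span: "?S \<subseteq> fun_space.span (monomials ?B r)"
    unfolding W_def schur_span sym_power_span ..
  have finM: "finite (monomials ?B r)"
    by (simp add: finite_monomials finite_words)
  have hilb: "hilbert_function W (j ` ?U) r + fun_space.dim (?S \<inter> I) = fun_space.dim ?S"
    unfolding I_def by (rule hilbert_function_eq[OF J one[unfolded I_def] finM S_span])
  define G where "G = (SIGMA \<nu>:{\<nu> \<in> P. wt l (row_word \<nu>) \<le> r * k}. {..<m \<nu>})"
  have finG: "finite G"
    using P(1) by (simp add: G_def)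
  have "\<exists>b. b \<subseteq> schur_module scale \<nu> \<and> fun_space.independent b \<and> finite b
      \<and> card b = fun_space.dim (schur_module scale \<nu>)" for \<nu>
  proof -
    obtain b where b: "b \<subseteq> schur_module scale \<nu>" "fun_space.independent b"
      "schur_module scale \<nu> \<subseteq> fun_space.span b" "card b = fun_space.dim (schur_module scale \<nu>)"
      by (rule fun_space.basis_exists)
    have "finite b"
      using fun_space.independent_span_bound[OF finite_imageI[OF finite_words] b(2) b(1)[unfolded schur_span]]
      by (rule conjunct1)
    with b(1,2,4) show ?thesis by blast
  qed
  then obtain b where b: "\<And>\<nu>. b \<nu> \<subseteq> schur_module scale \<nu>" "\<And>\<nu>. fun_space.independent (b \<nu>)"
    "\<And>\<nu>. finite (b \<nu>)" "\<And>\<nu>. card (b \<nu>) = fun_space.dim (schur_module scale \<nu>)"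
    by metis
  define E where "E = (\<lambda>(a, y). inject a y) ` (SIGMA a:G. b (fst a))"
  note E = direct_sum_basis[OF finG, of "\<lambda>a. b (fst a)", folded E_def, OF b(3) b(2)]
  \<comment> \<open>The projection to the components that are counted.\<close>
  define L where "L F = (\<lambda>(a, x). if a \<in> G then f F (a, x) else 0)" for F
  have comp: "(\<lambda>x. f F (a, x)) \<in> schur_module scale (fst a)" if "F \<in> ?S" "a \<in> G" for F a
    using rep_hom_D(1)[OF f that(1)] that(2) by (auto simp: direct_sum_def G_def split: prod.splits)
  have "fun_space.dim (?S \<inter> I) + card E \<le> fun_space.dim ?S"
  proof (rule dim_add_card_image_le[OF sym_power_subspace finM S_span, where L = L])
    show "fun_space.subspace (?S \<inter> I)"
      by (intro fun_space.subspace_inter sym_power_subspace ideal_subspace[OF idl])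
    show "L F = 0" if F: "F \<in> ?S \<inter> I" for F
    proof
      fix p :: "(nat list \<times> nat) \<times> ('v \<Rightarrow> complex) list"
      obtain a x where p: "p = (a, x)" by (cases p)
      have "f F (a, x) = 0" if a: "a \<in> G"
      proof -
        obtain \<nu> i where \<nu>: "a = (\<nu>, i)" "\<nu> \<in> P" "wt l (row_word \<nu>) \<le> r * k"
          using a by (auto simp: G_def)
        have sub: "(\<lambda>x. f H (a, x)) \<in> schur_module scale \<nu>" if "H \<in> ?S" for H
          using comp[OF that a] \<nu>(1) by simp
        have "(\<lambda>x. f F (a, x)) = 0"
        proof (rule vanishing_component[OF f[unfolded W_def]])
          show "(\<lambda>x. f F (a, x)) \<in> schur_module scale \<nu>" using F sub by blast
          show "length \<nu> = d" using P(2) \<nu>(2) .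
          show "(\<lambda>x. f H (a, x)) \<in> tensors (sum_list \<nu>)" if "H \<in> sym_power (schur_module scale \<mu>) r" for H
            using sub[of H] that schur_subset unfolding W_def by blast
          show "F \<in> sym_power (schur_module scale \<mu>) r" using F unfolding W_def by blast
          show "vanishing l k F" using F I by blast
          show "wt l (row_word \<nu>) \<le> k * r" using \<nu>(3) by (simp add: mult.commute)
        qed (rule r)
        then show ?thesis by (simp add: fun_eq_iff zero_fun_apply)
      qed
      then show "L F p = 0 p" by (simp add: L_def p zero_fun_apply)
    qed
    show "L (F + H) = L F + L H" if "F \<in> ?S" "H \<in> ?S" for F H
      using rep_hom_D(2)[OF f that] by (auto simp: L_def fun_eq_iff pointwise)
    show "L (fscale c F) = fscale c (L F)" if "F \<in> ?S" for c F
      using rep_hom_D(3)[OF f that] by (auto simp: L_def fun_eq_iff pointwise)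
    show "E \<subseteq> L ` ?S"
    proof
      fix z assume "z \<in> E"
      then obtain a y where z: "a \<in> G" "y \<in> b (fst a)" "z = inject a y"
        by (auto simp: E_def)
      have zero: "(\<lambda>_. 0) \<in> schur_module scale \<nu>" for \<nu>
        using fun_space.subspace_0[OF schur_subspace] by (simp add: zero_fun_def)
      have "y \<in> schur_module scale (fst a)"
        using z(2) b(1) by blast
      moreover have if_mem: "(Q \<Longrightarrow> y \<in> schur_module scale \<nu>) \<Longrightarrow> (\<lambda>x. if Q then y x else 0) \<in> schur_module scale \<nu>"
        for Q \<nu>
        by (cases Q) (simp_all add: zero)
      ultimately have "z \<in> ?D"
        using z(1) by (auto simp: z(3) direct_sum_def inject_def G_def intro!: if_mem)
      then have "z \<in> f ` ?S"
        using bij by (simp add: bij_betw_def)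
      then obtain F where F: "F \<in> ?S" "f F = z"
        by blast
      have "L F = z"
        using z(1) by (auto simp: L_def F(2) z(3) inject_def fun_eq_iff)
      with F(1) show "z \<in> L ` ?S" by blast
    qed
  qed (use E in auto)
  moreover have "card E = (\<Sum>\<nu> | \<nu> \<in> P \<and> wt l (row_word \<nu>) \<le> r * k. m \<nu> * fun_space.dim (schur_module scale \<nu>))"
  proof -
    have "card E = (\<Sum>(\<nu>, i)\<in>G. fun_space.dim (schur_module scale \<nu>))"
      using E(3) by (simp add: b(4) case_prod_unfold)
    also have "\<dots> = (\<Sum>\<nu> | \<nu> \<in> P \<and> wt l (row_word \<nu>) \<le> r * k. \<Sum>i<m \<nu>. fun_space.dim (schur_module scale \<nu>))"
      unfolding G_def using P(1) by (subst sum.Sigma) auto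
    finally show ?thesis by simp
  qed
  ultimately show ?thesis
    using hilb by simp
qed

end

lemma vector_space_coordinates:
  assumes "vector_space scale" "vector_space.dim scale (UNIV :: 'v::ab_group_add set) = d" "d > 0"
  shows "\<exists>e. coordinate_space scale d (e :: nat \<Rightarrow> 'v)"
proof -
  interpret vector_space scale by fact
  obtain B where B: "independent B" "UNIV \<subseteq> span B" "card B = d"
    using basis_exists[of UNIV] assms(2) by metis
  then have "finite B" using assms(3) card.infinite by fastforce
  then obtain e where "bij_betw e {0..<d} B"
    using ex_bij_betw_nat_finite[of B] B(3) by auto
  then have "inj_on e {..<d}" "e ` {..<d} = B"
    by (auto simp: bij_betw_def lessThan_atLeast0)
  then have "coordinate_space scale d e"
    using B by unfold_locales auto
  then show ?thesis by blast
qed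

theorem corollary3:
  fixes scale :: "complex \<Rightarrow> 'v::ab_group_add \<Rightarrow> 'v"
    and d r k :: nat
    and j :: "'v tensor \<Rightarrow> ('v \<Rightarrow> complex) list sym"
    and m :: "nat list \<Rightarrow> nat"
  defines "W \<equiv> schur_module scale (3 # replicate (d - 2) 1 @ [0])"
    and "U \<equiv> schur_module scale ([4, 3] @ replicate (d - 3) 2 @ [1])"
  assumes "d \<ge> 3"
    and "vector_space scale"
    and "vector_space.dim scale (UNIV :: 'v set) = d"
    and "rep_hom (GL scale) U tensor_act (sym_power W 2) (sym_act tensor_act) j"
    and "inj_on j U"
    and "r \<ge> 2"
    and "rep_isomorphic (GL scale)
           (sym_power W r) (sym_act tensor_act)
           (direct_sum (SIGMA \<nu>:partitions d (r * (d + 1)). {..<m \<nu>}) (\<lambda>(\<nu>, _). schur_module scale \<nu>))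
           (direct_sum_act tensor_act)"
    and "k \<le> d - 1"
  shows "hilbert_function W (j ` U) r \<ge>
           (\<Sum>\<nu> | \<nu> \<in> partitions d (r * (d + 1)) \<and> (\<Sum>i=d-k..d. \<nu> ! (i - 1)) \<le> r * k.
              m \<nu> * fun_space.dim (schur_module scale \<nu>))"
proof -
  let ?l = "d - 1 - k" and ?P = "partitions d (r * (d + 1))"
  obtain e where "coordinate_space scale d e"
    using vector_space_coordinates[OF assms(4,5)] assms(3) by auto
  then interpret coordinate_space scale d e .
  \<comment> \<open>The parts of \<open>\<nu>\<close> are numbered from 1 in the sum and the entries of \<open>row_word \<nu>\<close> from 0.\<close>
  have tail: "(\<Sum>i=d-k..d. \<nu> ! (i - 1)) = wt ?l (row_word \<nu>)" if "\<nu> \<in> ?P" for \<nu>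
  proof -
    have "d - k = Suc ?l" "d = Suc (d - 1)"
      using assms(3,10) by auto
    then have "(\<Sum>i=d-k..d. \<nu> ! (i - 1)) = (\<Sum>i=Suc ?l..Suc (d - 1). \<nu> ! (i - 1))"
      by simp
    also have "\<dots> = (\<Sum>i=?l..d - 1. \<nu> ! i)"
      by (subst sum.shift_bounds_cl_Suc_ivl) simp
    also have "{?l..d - 1} = {?l..<d}"
      using assms(3) by auto
    finally show ?thesis
      using that by (simp add: wt_row_word partitions_def)
  qed
  have "(\<Sum>\<nu> | \<nu> \<in> ?P \<and> wt ?l (row_word \<nu>) \<le> r * k. m \<nu> * fun_space.dim (schur_module scale \<nu>))
      \<le> hilbert_function W (j ` U) r"
    unfolding W_def U_def
  proof (rule hilbert_function_lower_bound)
    show "k \<le> wt ?l xs" if "xs \<in> words d (sum_list (3 # replicate (d - 2) 1 @ [0]))"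
      "young_symmetrizer (3 # replicate (d - 2) 1 @ [0]) (word_tensor xs) \<noteq> 0" for xs
      using generator_weight[OF assms(3,10) that] .
    show "2 * k < wt ?l xs" if "xs \<in> words d (sum_list ([4, 3] @ replicate (d - 3) 2 @ [1]))"
      "young_symmetrizer ([4, 3] @ replicate (d - 3) 2 @ [1]) (word_tensor xs) \<noteq> 0" for xs
      using relation_weight[OF assms(3,10) that] .
    show "length \<nu> = d" if "\<nu> \<in> ?P" for \<nu>
      using that by (simp add: partitions_def)
  qed (use assms in \<open>auto simp: W_def U_def finite_partitions\<close>)
  also have "{\<nu>. \<nu> \<in> ?P \<and> wt ?l (row_word \<nu>) \<le> r * k} = {\<nu>. \<nu> \<in> ?P \<and> (\<Sum>i=d-k..d. \<nu> ! (i - 1)) \<le> r * k}"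
    using tail by auto
  finally show ?thesis .
qed


end
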